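(* Let $\mathfrak g=\mathfrak k(1|6)=\bigoplus_{i\ge -2}\mathfrak g_i$ be the polynomial contact Lie superalgebra over $\mathbb C$ with its standard $\mathbb Z$-grading, let $\mathfrak g_-=\mathfrak g_{-2}\oplus\mathfrak g_{-1}$, and let $\mathfrak g_{11}^{\xi},\mathfrak g_{11}^{\eta},\mathfrak g_{12}\subset\mathfrak g_1$ be the $\mathfrak g_0$-submodules defined in the context. Then the partial Cartan prolong $(\mathfrak g_-\oplus\mathfrak g_0,\ \mathfrak g_{11}^{\xi}\oplus\mathfrak g_{12})_*^{mk}$ is an infinite dimensional simple Lie superalgebra, and it is isomorphic to $(\mathfrak g_-\oplus\mathfrak g_0,\ \mathfrak g_{11}^{\eta}\oplus\mathfrak g_{12})_*^{mk}$.
   Context: All algebras are over $\mathbb C$. The Lie superalgebra $\mathfrak k(1|6)$. As a superspace it is $\mathbb C[t,\xi_1,\xi_2,\xi_3,\eta_1,\eta_2,\eta_3]$ ($t$ even, $\xi_i,\eta_i$ odd); a polynomial $f$ stands for the contact vector field $K_f$ preserving the Pfaff equation $dt+\sum_{i\le 3}(\xi_i d\eta_i+\eta_i d\xi_i)=0$. The Lie superbracket of generating functions is $$\{f,g\}=\Delta(f)\frac{\partial g}{\partial t}-\frac{\partial f}{\partial t}\Delta(g)-\{f,g\}_{P.b.},\qquad \{f,g\}_{P.b.}=-(-1)^{p(f)}\sum_{i\le 3}\Big(\frac{\partial f}{\partial \xi_i}\frac{\partial g}{\partial \eta_i}+\frac{\partial f}{\partial \eta_i}\frac{\partial g}{\partial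 \xi_i}\Big),$$ where $\Delta(f)=2f-E(f)$, $E=\sum_i(\xi_i\partial_{\xi_i}+\eta_i\partial_{\eta_i})$, $p$ is parity, and the derivatives are left derivatives. Grading. With $\deg t=2$, $\deg\xi_i=\deg\eta_i=1$, put $\deg K_f=\deg f-2$. Writing $\Lambda^k$ for the span of degree $k$ monomials in $\xi,\eta$ (without $t$), one has $\mathfrak g_{-2}=\mathbb C\cdot 1$, $\mathfrak g_{-1}=\Lambda^1$, $\mathfrak g_0=\Lambda^2\oplus\mathbb C t\cong\mathfrak{co}(6)\cong\mathfrak{gl}(4)$, $\mathfrak g_1=\Lambda^3\oplus t\Lambda^1$. Submodules of $\mathfrak g_1$. Put $\mathfrak g_{12}=t\Lambda^1$ and $\mathfrak g_{11}=\Lambda^3$. The $\mathfrak g_0$-module $\mathfrak g_{11}$ is the direct sum of two irreducible $10$-dimensional submodules; $\mathfrak g_{11}^{\xi}$ denotes the one containing $\xi_1\xi_2\xi_3$ and $\mathfrak g_{11}^{\eta}$ the one containing $\eta_1\eta_2\eta_3$. (As $\mathfrak{gl}(4)$-modules they are, up to the action of the center, the symmetric square of the $4$-dimensional identity module and that of its dual.) Partial prolong. For a $\mathfrak g_0$-submodule $\mathfrak h_1\subset\mathfrak g_1$, the prolong $(\mathfrak g_-\oplus\mathfrak g_0,\mathfrak h_1)_*^{mk}$ is $\bigoplus_{i\ge -2}\mathfrak h_i\subset\mathfrak g$, where $\mathfrak h_i=\mathfrak g_i$ for $i\le 0$, $\mathfrak h_1$ is the given submodule, and for $i\ge 2$ inductively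 $\mathfrak h_i=\{D\in\mathfrak g_i:\ [D,\mathfrak g_{-1}]\subset\mathfrak h_{i-1}\}$. It is a Lie subsuperalgebra of $\mathfrak g$. *)

theory Defs
  imports
    "HOL-Library.Function_Algebras"
    "HOL-Computational_Algebra.Polynomial"
begin

section \<open>Lie superalgebras\<close>

text \<open>The superspace is a subset \<open>V\<close> of an ambient complex vector space, and \<open>part False\<close>,
  \<open>part True\<close> are its even and odd parts. The type \<^typ>\<open>bool\<close> serves as \<open>\<int>/2\<close>, with addition
  \<open>\<noteq>\<close>.\<close>

definition koszul_sign :: "bool \<Rightarrow> bool \<Rightarrow> complex" where
  "koszul_sign p q = (if p \<and> q then -1 else 1)"

locale lie_superalgebra = vector_space scale
  for scale :: "complex \<Rightarrow> 'a::ab_group_add \<Rightarrow> 'a" +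
  fixes bracket :: "'a \<Rightarrow> 'a \<Rightarrow> 'a"
    and V :: "'a set"
    and part :: "bool \<Rightarrow> 'a set"
  assumes subspace_part: "subspace (part p)"
    and parts_disjoint: "part False \<inter> part True = {0}"
    and parts_sum: "V = {x + y | x y. x \<in> part False \<and> y \<in> part True}"
    and bracket_add_left:
      "\<lbrakk>x \<in> V; y \<in> V; z \<in> V\<rbrakk> \<Longrightarrow> bracket (x + y) z = bracket x z + bracket y z"
    and bracket_add_right:
      "\<lbrakk>x \<in> V; y \<in> V; z \<in> V\<rbrakk> \<Longrightarrow> bracket x (y + z) = bracket x y + bracket x z"
    and bracket_scale_left:
      "\<lbrakk>x \<in> V; y \<in> V\<rbrakk> \<Longrightarrow> bracket (scale c x) y = scale c (bracket x y)"
    and bracket_scale_right: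
      "\<lbrakk>x \<in> V; y \<in> V\<rbrakk> \<Longrightarrow> bracket x (scale c y) = scale c (bracket x y)"
    and bracket_part:
      "\<lbrakk>x \<in> part p; y \<in> part q\<rbrakk> \<Longrightarrow> bracket x y \<in> part (p \<noteq> q)"
    and super_antisym:
      "\<lbrakk>x \<in> part p; y \<in> part q\<rbrakk> \<Longrightarrow> bracket x y = - scale (koszul_sign p q) (bracket y x)"
    and super_jacobi:
      "\<lbrakk>x \<in> part p; y \<in> part q; z \<in> part r\<rbrakk> \<Longrightarrow>
        bracket x (bracket y z) =
          bracket (bracket x y) z + scale (koszul_sign p q) (bracket y (bracket x z))"
begin

text \<open>Ideals of a superalgebra are sub-superspaces, i.e. compatible with the parity.\<close>

definition ideal :: "'a set \<Rightarrow> bool" where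
  "ideal J \<longleftrightarrow> subspace J \<and> J \<subseteq> V
     \<and> (\<forall>z\<in>J. \<exists>x\<in>J \<inter> part False. \<exists>y\<in>J \<inter> part True. z = x + y)
     \<and> (\<forall>x\<in>V. \<forall>y\<in>J. bracket x y \<in> J)"

definition abelian :: bool where
  "abelian \<longleftrightarrow> (\<forall>x\<in>V. \<forall>y\<in>V. bracket x y = 0)"

definition infinite_dimensional :: bool where
  "infinite_dimensional \<longleftrightarrow> \<not> (\<exists>B. finite B \<and> V \<subseteq> span B)"

end

locale simple_lie_superalgebra = lie_superalgebra +
  assumes not_abelian: "\<not> abelian"
    and no_proper_ideal: "ideal J \<Longrightarrow> J = {0} \<or> J = V"

text \<open>Isomorphisms are even.\<close>

definition lie_superalgebra_iso ::
  "(complex \<Rightarrow> 'a::ab_group_add \<Rightarrow> 'a) \<Rightarrow> ('a \<Rightarrow> 'a \<Rightarrow> 'a) \<Rightarrow> 'a set \<Rightarrow> (bool \<Rightarrow> 'a set) \<Rightarrow>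
   (complex \<Rightarrow> 'b::ab_group_add \<Rightarrow> 'b) \<Rightarrow> ('b \<Rightarrow> 'b \<Rightarrow> 'b) \<Rightarrow> 'b set \<Rightarrow> (bool \<Rightarrow> 'b set) \<Rightarrow>
   ('a \<Rightarrow> 'b) \<Rightarrow> bool" where
  "lie_superalgebra_iso scale br V part scale' br' V' part' \<phi> \<longleftrightarrow>
     lie_superalgebra scale br V part \<and> lie_superalgebra scale' br' V' part' \<and>
     bij_betw \<phi> V V' \<and>
     (\<forall>x\<in>V. \<forall>y\<in>V. \<phi> (x + y) = \<phi> x + \<phi> y) \<and>
     (\<forall>c. \<forall>x\<in>V. \<phi> (scale c x) = scale' c (\<phi> x)) \<and>
     (\<forall>p. \<phi> ` part p = part' p) \<and>
     (\<forall>x\<in>V. \<forall>y\<in>V. \<phi> (br x y) = br' (\<phi> x) (\<phi> y))"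

definition lie_superalgebra_isomorphic ::
  "(complex \<Rightarrow> 'a::ab_group_add \<Rightarrow> 'a) \<Rightarrow> ('a \<Rightarrow> 'a \<Rightarrow> 'a) \<Rightarrow> 'a set \<Rightarrow> (bool \<Rightarrow> 'a set) \<Rightarrow>
   (complex \<Rightarrow> 'b::ab_group_add \<Rightarrow> 'b) \<Rightarrow> ('b \<Rightarrow> 'b \<Rightarrow> 'b) \<Rightarrow> 'b set \<Rightarrow> (bool \<Rightarrow> 'b set) \<Rightarrow>
   bool" where
  "lie_superalgebra_isomorphic scale br V part scale' br' V' part' \<longleftrightarrow>
     (\<exists>\<phi>. lie_superalgebra_iso scale br V part scale' br' V' part' \<phi>)"


section \<open>The superspace \<open>\<complex>[t, \<xi>\<^sub>1, \<xi>\<^sub>2, \<xi>\<^sub>3, \<eta>\<^sub>1, \<eta>\<^sub>2, \<eta>\<^sub>3]\<close>\<close>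

datatype idx = I1 | I2 | I3

datatype gen = Xi idx | Eta idx

lemma UNIV_idx: "(UNIV :: idx set) = {I1, I2, I3}"
  using idx.exhaust by auto

instance idx :: finite
  by intro_classes (simp add: UNIV_idx)

lemma UNIV_gen: "(UNIV :: gen set) = range Xi \<union> range Eta"
proof -
  have "x \<in> range Xi \<union> range Eta" for x
    by (cases x) auto
  then show ?thesis by auto
qed

instance gen :: finite
  by intro_classes (simp add: UNIV_gen)

fun idx_pos :: "idx \<Rightarrow> nat" where
  "idx_pos I1 = 0"
| "idx_pos I2 = 1"
| "idx_pos I3 = 2"

fun gen_pos :: "gen \<Rightarrow> nat" where
  "gen_pos (Xi i) = idx_pos i"
| "gen_pos (Eta i) = 3 + idx_pos i"

text \<open>For a set \<open>S\<close> of odd generators let \<open>\<theta>\<^sub>S\<close> be the product of its elements in the order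
  \<open>\<xi>\<^sub>1, \<xi>\<^sub>2, \<xi>\<^sub>3, \<eta>\<^sub>1, \<eta>\<^sub>2, \<eta>\<^sub>3\<close> given by \<^const>\<open>gen_pos\<close>. The function \<open>f\<close> stands for
  \<open>\<Sum>S. f S \<cdot> \<theta>\<^sub>S\<close>, where \<open>f S\<close> is a polynomial in \<open>t\<close>. Addition, subtraction and zero are
  pointwise; the product is \<open>kmult\<close> below, not the pointwise \<open>*\<close>.\<close>

type_synonym kfun = "gen set \<Rightarrow> complex poly"

definition kscale :: "complex \<Rightarrow> kfun \<Rightarrow> kfun" where
  "kscale c f = (\<lambda>S. smult c (f S))"

interpretation kfun: vector_space kscale
  by unfold_locales
    (auto simp: kscale_def fun_eq_iff smult_add_left smult_add_right)

definition theta_sign :: "gen set \<Rightarrow> gen set \<Rightarrow> complex poly" where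
  "theta_sign S T = (-1) ^ card {(x, y). x \<in> S \<and> y \<in> T \<and> gen_pos y < gen_pos x}"

definition kmult :: "kfun \<Rightarrow> kfun \<Rightarrow> kfun" where
  "kmult f g = (\<lambda>S. \<Sum>T\<in>Pow S. theta_sign T (S - T) * f T * g (S - T))"

definition kt :: kfun where
  "kt = (\<lambda>S. if S = {} then monom 1 1 else 0)"

definition kgen :: "gen \<Rightarrow> kfun" where
  "kgen x = (\<lambda>S. if S = {x} then 1 else 0)"

definition d_t :: "kfun \<Rightarrow> kfun" where
  "d_t f = (\<lambda>S. pderiv (f S))"

text \<open>The left derivative: \<open>\<partial>\<^sub>x (\<theta>\<^sub>x \<cdot> h) = h\<close> if \<open>h\<close> does not depend on \<open>x\<close>.\<close>

definition d_gen :: "gen \<Rightarrow> kfun \<Rightarrow> kfun" where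
  "d_gen x f = (\<lambda>S. if x \<in> S then 0
                    else (-1) ^ card {y \<in> S. gen_pos y < gen_pos x} * f (insert x S))"

definition parity_part :: "bool \<Rightarrow> kfun set" where
  "parity_part p = {f. \<forall>S. f S \<noteq> 0 \<longrightarrow> odd (card S) = p}"

text \<open>The linear operator \<open>f \<mapsto> (-1)\<^bsup>p(f)\<^esup> f\<close>. It extends the sign in the Poisson bracket to
  inhomogeneous \<open>f\<close>; there it acts before the derivative, so the sign is the parity of \<open>f\<close>.\<close>

definition parity_op :: "kfun \<Rightarrow> kfun" where
  "parity_op f = (\<lambda>S. (-1) ^ card S * f S)"

definition euler :: "kfun \<Rightarrow> kfun" where
  "euler f = (\<Sum>i\<in>UNIV. kmult (kgen (Xi i)) (d_gen (Xi i) f)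
                      + kmult (kgen (Eta i)) (d_gen (Eta i) f))"

definition Delta :: "kfun \<Rightarrow> kfun" where
  "Delta f = kscale 2 f - euler f"

definition poisson :: "kfun \<Rightarrow> kfun \<Rightarrow> kfun" where
  "poisson f g =
     - (\<Sum>i\<in>UNIV. kmult (d_gen (Xi i) (parity_op f)) (d_gen (Eta i) g)
                 + kmult (d_gen (Eta i) (parity_op f)) (d_gen (Xi i) g))"

definition contact_bracket :: "kfun \<Rightarrow> kfun \<Rightarrow> kfun" where
  "contact_bracket f g =
     kmult (Delta f) (d_t g) - kmult (d_t f) (Delta g) - poisson f g"


section \<open>Grading and submodules of the degree one component\<close>

definition graded_part :: "int \<Rightarrow> kfun set" where
  "graded_part d =
     {f. \<forall>S n. coeff (f S) n \<noteq> 0 \<longrightarrow> 2 * int n + int (card S) - 2 = d}"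

definition Lambda :: "nat \<Rightarrow> kfun set" where
  "Lambda k = {f. \<forall>S n. coeff (f S) n \<noteq> 0 \<longrightarrow> n = 0 \<and> card S = k}"

definition g11 :: "kfun set" where
  "g11 = Lambda 3"

definition g12 :: "kfun set" where
  "g12 = kmult kt ` Lambda 1"

definition g0_submodule :: "kfun set \<Rightarrow> bool" where
  "g0_submodule M \<longleftrightarrow> kfun.subspace M \<and>
     (\<forall>D\<in>graded_part 0. \<forall>m\<in>M. contact_bracket D m \<in> M)"

definition irreducible_g0_submodule :: "kfun set \<Rightarrow> bool" where
  "irreducible_g0_submodule M \<longleftrightarrow> g0_submodule M \<and> M \<noteq> {0} \<and>
     (\<forall>N. g0_submodule N \<and> N \<subseteq> M \<longrightarrow> N = {0} \<or> N = M)"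

definition xi_cubed :: kfun where
  "xi_cubed = kmult (kgen (Xi I1)) (kmult (kgen (Xi I2)) (kgen (Xi I3)))"

definition eta_cubed :: kfun where
  "eta_cubed = kmult (kgen (Eta I1)) (kmult (kgen (Eta I2)) (kgen (Eta I3)))"

text \<open>\<open>\<Lambda>\<^sup>3\<close> is the direct sum of two irreducible submodules of dimension 10, one
  containing \<open>\<xi>\<^sub>1\<xi>\<^sub>2\<xi>\<^sub>3\<close> and the other \<open>\<eta>\<^sub>1\<eta>\<^sub>2\<eta>\<^sub>3\<close>. Distinct irreducible submodules
  meet in 0, so each is the only irreducible submodule containing its vector.\<close>

definition g11_xi :: "kfun set" where
  "g11_xi = (THE M. irreducible_g0_submodule M \<and> M \<subseteq> g11 \<and> xi_cubed \<in> M)"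

definition g11_eta :: "kfun set" where
  "g11_eta = (THE M. irreducible_g0_submodule M \<and> M \<subseteq> g11 \<and> eta_cubed \<in> M)"

definition sum_space :: "kfun set \<Rightarrow> kfun set \<Rightarrow> kfun set" where
  "sum_space A B = {a + b | a b. a \<in> A \<and> b \<in> B}"


section \<open>Partial Cartan prolongs\<close>

text \<open>\<open>prolong_pos H n\<close> is the component of degree \<open>n + 1\<close>.\<close>

primrec prolong_pos :: "kfun set \<Rightarrow> nat \<Rightarrow> kfun set" where
  "prolong_pos H 0 = H"
| "prolong_pos H (Suc n) =
     {D \<in> graded_part (int n + 2).
        \<forall>v\<in>graded_part (-1). contact_bracket D v \<in> prolong_pos H n}"

definition prolong_part :: "kfun set \<Rightarrow> int \<Rightarrow> kfun set" where
  "prolong_part H i = (if i \<le> 0 then graded_part i else prolong_pos H (nat (i - 1)))"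

text \<open>The direct sum of the components: they lie in different degrees, so it is the span of
  their union.\<close>

definition partial_prolong :: "kfun set \<Rightarrow> kfun set" where
  "partial_prolong H = kfun.span (\<Union>i\<in>{-2..}. prolong_part H i)"

definition prolong_parity :: "kfun set \<Rightarrow> bool \<Rightarrow> kfun set" where
  "prolong_parity H p = partial_prolong H \<inter> parity_part p"

end

theory Submission
  imports Defs
begin

text \<open>
  The operators of multiplication by the odd generators and the left derivatives satisfy the
  Clifford relations, and bracketing with a generator \<open>x\<close> is the odd operator
  \<open>x \<partial>\<^sub>t - \<partial>\<^bsub>bar x\<^esub>\<close>, which is a derivation of the contact bracket. Since an element killed by
  all these operators is constant, the Jacobi identity follows by induction on the total degree;
  it implies that partial prolongs are closed under the bracket.

  Simplicity: by the same transitivity a nonzero ideal contains \<open>1\<close>. As \<open>t\<^sup>2\<close> lies in the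
  prolong, the ideal contains \<open>t\<close>, whose adjoint action is the degree, hence every component of
  nonzero degree; the brackets \<open>{x, t z}\<close> then yield degree 0.

  The module containing \<open>\<xi>\<^sub>1\<xi>\<^sub>2\<xi>\<^sub>3\<close> consists of the cubic forms fixed by a Hodge operator, which
  intertwines multiplication by \<open>x\<close> with \<open>- \<partial>\<^bsub>bar x\<^esub>\<close>; its ten weights have multiplicity one and
  root vectors lead through all of them in a cycle. The Hodge operator also yields the elements
  \<open>t\<^sup>n + \<partial>\<^sub>t\<^sup>3 (star t\<^sup>n)\<close> of the prolong for every \<open>n\<close>. Exchanging \<open>\<xi>\<^sub>1\<close> and \<open>\<eta>\<^sub>1\<close> gives the
  isomorphism.
\<close>

section \<open>Clifford calculus\<close>

text \<open>The bracket of three general arguments is never expanded; that would need full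
  associativity and many second derivatives. Everything is moved to the operators
  \<open>agen x\<close>, for which products having one generator as a factor suffice. Membership in
  a prolong is a recursive condition, so high degree elements are hard to exhibit. The powers t^n
  fail for n >= 3: brackets with generators and 1 lead from t^n to a multiple of eta_1 eta_2 eta_3,
  which is not self-dual. What rescues them is that \<open>star\<close> exchanges the two terms x
  and - d_(bar x) of \<open>agen x\<close> (up to the factor d_t), so that conditions linking odd
  degree k with odd degree 6 - k survive all brackets with generators. \<open>g11_xi\<close> and
  \<open>g11_eta\<close> are definite descriptions and become usable only after an explicit
  irreducible module containing the given cubic form is known. Exchanging one dual pair is a
  reflection of determinant -1 and therefore anticommutes with \<open>star\<close>; this is why it
  maps one half of the cubic forms to the other.\<close>

lemma sum_kfun_apply: "(\<Sum>i\<in>A. F i) S = (\<Sum>i\<in>A. F i S)" for F :: "'b \<Rightarrow> kfun"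
  by (induction A rule: infinite_finite_induct) auto

lemma inj_gen_pos: "gen_pos x = gen_pos y \<Longrightarrow> x = y"
proof -
  have "idx_pos i < 3" for i by (cases i) auto
  moreover have "idx_pos i = idx_pos j \<Longrightarrow> i = j" for i j
    by (cases i; cases j) auto
  ultimately show "gen_pos x = gen_pos y \<Longrightarrow> x = y"
    by (cases x; cases y) (auto, (metis less_add_same_cancel1 not_add_less1 not_less)+)
qed

section \<open>Signs of reordered monomials\<close>

lemma theta_sign_empty [simp]: "theta_sign {} B = 1" "theta_sign A {} = 1"
  by (auto simp: theta_sign_def)

lemma theta_sign_Un_left:
  "A \<inter> B = {} \<Longrightarrow> theta_sign (A \<union> B) C = theta_sign A C * theta_sign B C"
  unfolding theta_sign_def power_add[symmetric]
  by (subst card_Un_disjoint[symmetric])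
    (auto intro!: arg_cong[where f="\<lambda>X. (-1) ^ card X"])

lemma theta_sign_Un_right:
  "B \<inter> C = {} \<Longrightarrow> theta_sign A (B \<union> C) = theta_sign A B * theta_sign A C"
  unfolding theta_sign_def power_add[symmetric]
  by (subst card_Un_disjoint[symmetric])
    (auto intro!: arg_cong[where f="\<lambda>X. (-1) ^ card X"])

lemma theta_sign_insert_left:
  "x \<notin> A \<Longrightarrow> theta_sign (insert x A) B = theta_sign {x} B * theta_sign A B"
  using theta_sign_Un_left[of "{x}" A B] by simp

lemma theta_sign_insert_right:
  "x \<notin> B \<Longrightarrow> theta_sign A (insert x B) = theta_sign A {x} * theta_sign A B"
  using theta_sign_Un_right[of "{x}" B A] by simp

lemma theta_sign_split_right:
  "T \<subseteq> S \<Longrightarrow> theta_sign A S = theta_sign A T * theta_sign A (S - T)"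
  using theta_sign_Un_right[of T "S - T" A] by (simp add: Un_absorb1)

lemma theta_sign_cases: "theta_sign A B = 1 \<or> theta_sign A B = -1"
  by (simp add: theta_sign_def minus_one_power_iff)

lemma theta_sign_square [simp]: "theta_sign A B * theta_sign A B = 1"
  using theta_sign_cases[of A B] by auto

lemma theta_sign_square_left [simp]: "theta_sign A B * (theta_sign A B * p) = p"
  by (simp flip: mult.assoc)

text \<open>Positions are injective and the sets disjoint, so every pair of
  \<open>A \<times> B\<close> is an inversion for exactly one of the two orders. The two inversion
  numbers therefore add up to \<open>card A * card B\<close>.\<close>

lemma theta_sign_flip:
  assumes "A \<inter> B = {}"
  shows "theta_sign B A = (-1) ^ (card A * card B) * theta_sign A B"
proof -
  let ?P = "{(x, y). x \<in> A \<and> y \<in> B \<and> gen_pos y < gen_pos x}"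
  let ?Q = "{(x, y). x \<in> B \<and> y \<in> A \<and> gen_pos y < gen_pos x}"
  have "card A * card B = card (A \<times> B)" by (simp add: card_cartesian_product)
  also have "A \<times> B = ?P \<union> prod.swap ` ?Q"
    using assms inj_gen_pos by (auto simp: image_iff) (metis IntI emptyE nat_neq_iff)
  also have "card \<dots> = card ?P + card (prod.swap ` ?Q)"
    by (rule card_Un_disjoint) auto
  also have "card (prod.swap ` ?Q) = card ?Q" by (rule card_image) auto
  finally have "card A * card B = card ?P + card ?Q" .
  then have "(-1) ^ (card A * card B) * theta_sign A B
      = theta_sign A B * theta_sign B A * theta_sign A B"
    by (simp add: power_add theta_sign_def)
  then show ?thesis by (simp add: mult.commute)
qed

lemma theta_sign_flip_gen: "x \<notin> T \<Longrightarrow> theta_sign T {x} = (-1) ^ card T * theta_sign {x} T"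
  using theta_sign_flip[of "{x}" T] by simp

text \<open>Expressing the sign of the left derivative by \<open>theta_sign\<close> lets products
  and derivatives share the same sign rules.\<close>

lemma d_gen_apply:
  "d_gen x f S = (if x \<in> S then 0 else theta_sign {x} S * f (insert x S))"
proof -
  have "{(z, y). z \<in> {x} \<and> y \<in> S \<and> gen_pos y < gen_pos z}
      = Pair x ` {y \<in> S. gen_pos y < gen_pos x}" by auto
  then have "theta_sign {x} S = (-1) ^ card {y \<in> S. gen_pos y < gen_pos x}"
    unfolding theta_sign_def by (simp add: card_image inj_on_def)
  then show ?thesis by (simp add: d_gen_def)
qed

lemma kgen_mult_apply:
  "kmult (kgen x) f S = (if x \<in> S then theta_sign {x} (S - {x}) * f (S - {x}) else 0)"
proof -
  have "kmult (kgen x) f S =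
      (\<Sum>T\<in>Pow S. if T = {x} then theta_sign {x} (S - {x}) * f (S - {x}) else 0)"
    unfolding kmult_def kgen_def by (rule sum.cong) auto
  then show ?thesis by (simp add: sum.delta)
qed

section \<open>Linearity of products, derivatives and the parity operator\<close>

lemma kmult_add_left: "kmult (f + g) h = kmult f h + kmult g h"
  by (rule ext) (simp add: kmult_def algebra_simps sum.distrib)

lemma kmult_add_right: "kmult h (f + g) = kmult h f + kmult h g"
  by (rule ext) (simp add: kmult_def algebra_simps sum.distrib)

lemma smult_sum_right: "smult c (\<Sum>i\<in>A. p i) = (\<Sum>i\<in>A. smult c (p i))"
  by (induction A rule: infinite_finite_induct) (simp_all add: smult_add_right)

lemma pderiv_sum: "pderiv (\<Sum>i\<in>A. p i) = (\<Sum>i\<in>A. pderiv (p i))"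
  by (induction A rule: infinite_finite_induct) (simp_all add: pderiv_add)

lemma kmult_scale_left: "kmult (kscale c f) h = kscale c (kmult f h)"
  by (rule ext) (simp add: kmult_def kscale_def smult_sum_right)

lemma kmult_scale_right: "kmult h (kscale c f) = kscale c (kmult h f)"
  by (rule ext) (simp add: kmult_def kscale_def smult_sum_right)

lemma kmult_zero [simp]: "kmult 0 f = 0" "kmult f 0 = 0"
  by (auto simp: kmult_def fun_eq_iff)

lemma kmult_minus_left: "kmult (- f) h = - kmult f h"
  using kmult_scale_left[of "-1" f h] by (simp add: kfun.scale_minus_left)

lemma kmult_minus_right: "kmult h (- f) = - kmult h f"
  using kmult_scale_right[of h "-1" f] by (simp add: kfun.scale_minus_left)

lemma kmult_diff_left: "kmult (f - g) h = kmult f h - kmult g h"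
  using kmult_add_left[of f "- g" h] by (simp add: kmult_minus_left)

lemma kmult_diff_right: "kmult h (f - g) = kmult h f - kmult h g"
  using kmult_add_right[of h f "- g"] by (simp add: kmult_minus_right)

lemma kmult_sum_right: "kmult h (\<Sum>i\<in>A. F i) = (\<Sum>i\<in>A. kmult h (F i))" for F :: "'b \<Rightarrow> kfun"
  by (induction A rule: infinite_finite_induct)
    (simp_all only: sum.infinite sum.empty sum.insert not_False_eq_True kmult_add_right kmult_zero)

lemma d_gen_add: "d_gen x (f + g) = d_gen x f + d_gen x g"
  by (rule ext) (simp add: d_gen_apply algebra_simps)

lemma d_gen_scale: "d_gen x (kscale c f) = kscale c (d_gen x f)"
  by (rule ext) (simp add: d_gen_apply kscale_def)

lemma d_gen_minus: "d_gen x (- f) = - d_gen x f"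
  by (rule ext) (simp add: d_gen_apply)

lemma d_gen_diff: "d_gen x (f - g) = d_gen x f - d_gen x g"
  by (rule ext) (simp add: d_gen_apply algebra_simps)

lemma d_gen_zero [simp]: "d_gen x 0 = 0"
  by (rule ext) (simp add: d_gen_apply)

lemma d_gen_sum: "d_gen x (\<Sum>i\<in>A. F i) = (\<Sum>i\<in>A. d_gen x (F i))" for F :: "'b \<Rightarrow> kfun"
  by (induction A rule: infinite_finite_induct)
    (simp_all only: sum.infinite sum.empty sum.insert not_False_eq_True d_gen_add d_gen_zero)

lemma d_t_add: "d_t (f + g) = d_t f + d_t g"
  by (rule ext) (simp add: d_t_def pderiv_add)

lemma d_t_scale: "d_t (kscale c f) = kscale c (d_t f)"
  by (rule ext) (simp add: d_t_def kscale_def pderiv_smult)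

lemma d_t_minus: "d_t (- f) = - d_t f"
  by (rule ext) (simp add: d_t_def pderiv_minus)

lemma d_t_diff: "d_t (f - g) = d_t f - d_t g"
  by (rule ext) (simp add: d_t_def pderiv_diff)

lemma d_t_zero [simp]: "d_t 0 = 0"
  by (rule ext) (simp add: d_t_def)

lemma d_t_sum: "d_t (\<Sum>i\<in>A. F i) = (\<Sum>i\<in>A. d_t (F i))" for F :: "'b \<Rightarrow> kfun"
  by (induction A rule: infinite_finite_induct)
    (simp_all only: sum.infinite sum.empty sum.insert not_False_eq_True d_t_add d_t_zero)

lemma parity_op_add: "parity_op (f + g) = parity_op f + parity_op g"
  by (rule ext) (simp add: parity_op_def algebra_simps)

lemma parity_op_minus: "parity_op (- f) = - parity_op f"
  by (rule ext) (simp add: parity_op_def)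

lemma parity_op_diff: "parity_op (f - g) = parity_op f - parity_op g"
  by (rule ext) (simp add: parity_op_def algebra_simps)

lemma parity_op_scale: "parity_op (kscale c f) = kscale c (parity_op f)"
  by (rule ext) (simp add: parity_op_def kscale_def)

lemma parity_op_parity_op [simp]: "parity_op (parity_op f) = f"
  by (rule ext) (simp add: parity_op_def flip: mult.assoc power_add)

section \<open>Leibniz rules and rearrangement of products\<close>

lemma pderiv_signed:
  "s = 1 \<or> s = -1 \<Longrightarrow> pderiv (s * p) = s * pderiv p" for s p :: "complex poly"
  by (auto simp: pderiv_minus)

lemma pderiv_theta_sign: "pderiv (theta_sign A B * p) = theta_sign A B * pderiv p"
  by (rule pderiv_signed) (rule theta_sign_cases)

lemma d_t_kmult: "d_t (kmult f g) = kmult (d_t f) g + kmult f (d_t g)"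
proof (rule ext)
  fix S :: "gen set"
  have "d_t (kmult f g) S = (\<Sum>T\<in>Pow S. theta_sign T (S - T) * (pderiv (f T * g (S - T))))"
    by (simp only: kmult_def d_t_def pderiv_sum mult.assoc pderiv_theta_sign)
  then show "d_t (kmult f g) S = (kmult (d_t f) g + kmult f (d_t g)) S"
    by (simp add: kmult_def d_t_def pderiv_mult algebra_simps sum.distrib)
qed

lemma d_t_d_gen: "d_t (d_gen x f) = d_gen x (d_t f)"
  by (rule ext) (simp add: d_t_def d_gen_apply pderiv_theta_sign)

lemma d_t_parity_op: "d_t (parity_op f) = parity_op (d_t f)"
proof (rule ext)
  fix S :: "gen set"
  show "d_t (parity_op f) S = parity_op (d_t f) S"
    unfolding d_t_def parity_op_def
    by (rule pderiv_signed) (simp add: minus_one_power_iff)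
qed

lemma d_gen_parity_op: "d_gen x (parity_op f) = - parity_op (d_gen x f)"
  by (rule ext) (auto simp: d_gen_apply parity_op_def)

lemma kgen_mult_parity_op: "kmult (kgen x) (parity_op f) = - parity_op (kmult (kgen x) f)"
proof (rule ext)
  fix S
  have "x \<in> S \<Longrightarrow> (-1) ^ card S = (- ((-1) ^ card (S - {x})) :: complex poly)"
    by (subst card.remove[of S x]) auto
  then show "kmult (kgen x) (parity_op f) S = (- parity_op (kmult (kgen x) f)) S"
    by (auto simp: kgen_mult_apply parity_op_def simp del: card_Diff_insert card_Diff_singleton)
qed

lemma parity_op_kmult: "parity_op (kmult f g) = kmult (parity_op f) (parity_op g)"
proof (rule ext)
  fix S :: "gen set"
  have "card S = card T + card (S - T)" if "T \<subseteq> S" for T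
    using that by (metis card_mono card_Diff_subset finite le_add_diff_inverse)
  then have "(- 1) ^ card S = ((- 1) ^ card T * (- 1) ^ card (S - T) :: complex poly)"
    if "T \<subseteq> S" for T using that by (simp add: power_add)
  then show "parity_op (kmult f g) S = kmult (parity_op f) (parity_op g) S"
    by (simp add: kmult_def parity_op_def sum_distrib_left) (rule sum.cong, auto)
qed

lemma sum_Pow_insert:
  fixes F :: "gen set \<Rightarrow> 'b::comm_monoid_add"
  assumes "x \<notin> S"
  shows "(\<Sum>T\<in>Pow (insert x S). F T) = (\<Sum>T\<in>Pow S. F T) + (\<Sum>T\<in>Pow S. F (insert x T))"
proof -
  have inj: "inj_on (insert x) (Pow S)" using assms
    by (auto intro!: inj_onI elim!: insert_ident[THEN iffD1, rotated 2])
  show ?thesis unfolding Pow_insert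
    using assms by (subst sum.union_disjoint) (auto simp: sum.reindex[OF inj])
qed

text \<open>If \<open>x\<close> lies in \<open>S\<close>, the summands for \<open>T\<close> and
  \<open>insert x T\<close> cancel. Otherwise the subsets of \<open>insert x S\<close> without
  \<open>x\<close> give the term in which the derivative falls on \<open>g\<close>, and those with
  \<open>x\<close> the term in which it falls on \<open>f\<close>.\<close>

lemma d_gen_kmult:
  "d_gen x (kmult f g) = kmult (d_gen x f) g + kmult (parity_op f) (d_gen x g)"
proof (rule ext)
  fix S
  show "d_gen x (kmult f g) S = (kmult (d_gen x f) g + kmult (parity_op f) (d_gen x g)) S"
  proof (cases "x \<in> S")
    case True
    define S' where "S' = S - {x}"
    have S: "S = insert x S'" "x \<notin> S'" using True by (auto simp: S'_def)
    let ?t = "\<lambda>T. theta_sign T (S - T) * d_gen x f T * g (S - T)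
        + theta_sign T (S - T) * parity_op f T * d_gen x g (S - T)"
    have *: "?t T + ?t (insert x T) = 0" if "T \<subseteq> S'" for T
    proof -
      have "x \<notin> T" "S - T = insert x (S' - T)" "S - insert x T = S' - T" using that S by auto
      then show ?thesis using S(2)
        by (simp add: theta_sign_insert_left[of x T] theta_sign_insert_right[of x "S' - T"]
            theta_sign_flip_gen d_gen_apply parity_op_def mult_ac)
    qed
    have "(kmult (d_gen x f) g + kmult (parity_op f) (d_gen x g)) S
        = (\<Sum>T\<in>Pow (insert x S'). ?t T)"
      unfolding S(1)[symmetric] by (simp add: kmult_def sum.distrib)
    also have "\<dots> = 0"
      unfolding sum_Pow_insert[OF S(2)] sum.distrib[symmetric] using * by simp
    finally show ?thesis using True by (simp add: d_gen_apply[of x _ S])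
  next
    case False
    have 1: "theta_sign {x} S * (theta_sign T (insert x S - T) * f T * g (insert x S - T))
        = theta_sign T (S - T) * parity_op f T * d_gen x g (S - T)" if "T \<subseteq> S" for T
    proof -
      have "x \<notin> T" "insert x S - T = insert x (S - T)" using that False by auto
      moreover have "theta_sign {x} S = theta_sign {x} T * theta_sign {x} (S - T)"
        using that by (rule theta_sign_split_right)
      ultimately show ?thesis using False
        by (simp add: theta_sign_insert_right[of x "S - T"] theta_sign_flip_gen d_gen_apply parity_op_def mult_ac)
    qed
    have 2: "theta_sign {x} S * (theta_sign (insert x T) (insert x S - insert x T)
          * f (insert x T) * g (insert x S - insert x T))
        = theta_sign T (S - T) * d_gen x f T * g (S - T)" if "T \<subseteq> S" for T
    proof -
      have "x \<notin> T" "insert x S - insert x T = S - T" using that False by auto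
      moreover have "theta_sign {x} S = theta_sign {x} T * theta_sign {x} (S - T)"
        using that by (rule theta_sign_split_right)
      ultimately show ?thesis using False
        by (simp add: theta_sign_insert_left[of x T] d_gen_apply mult_ac)
    qed
    have "d_gen x (kmult f g) S = (\<Sum>T\<in>Pow (insert x S).
        theta_sign {x} S * (theta_sign T (insert x S - T) * f T * g (insert x S - T)))"
      using False by (simp add: d_gen_apply kmult_def sum_distrib_left)
    also have "\<dots> = (\<Sum>T\<in>Pow S. theta_sign T (S - T) * parity_op f T * d_gen x g (S - T))
        + (\<Sum>T\<in>Pow S. theta_sign T (S - T) * d_gen x f T * g (S - T))"
      unfolding sum_Pow_insert[OF False]
      by (intro arg_cong2[where f="(+)"] sum.cong refl 1 2) auto
    finally show ?thesis by (simp add: kmult_def)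
  qed
qed

text \<open>Associativity for a generator in front: only index sets containing \<open>x\<close>
  contribute. Together with \<open>kmult_kgen_mult\<close> this handles the triple products met
  later.\<close>

lemma kgen_mult_assoc: "kmult (kmult (kgen x) f) g = kmult (kgen x) (kmult f g)"
proof (rule ext)
  fix S
  show "kmult (kmult (kgen x) f) g S = kmult (kgen x) (kmult f g) S"
  proof (cases "x \<in> S")
    case False
    then have "kmult (kgen x) f T = 0" if "T \<subseteq> S" for T
      using that by (auto simp: kgen_mult_apply)
    then show ?thesis using False
      by (simp add: kgen_mult_apply[of x _ S] kmult_def[of "kmult _ _"])
  next
    case True
    define S' where "S' = S - {x}"
    have S: "S = insert x S'" "x \<notin> S'" using True by (auto simp: S'_def)
    have *: "theta_sign (insert x T) (S - insert x T) * kmult (kgen x) f (insert x T)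
          * g (S - insert x T)
        = theta_sign {x} S' * (theta_sign T (S' - T) * f T * g (S' - T))" if "T \<subseteq> S'" for T
    proof -
      have "x \<notin> T" "S - insert x T = S' - T" "insert x T - {x} = T" using that S by auto
      moreover have "theta_sign {x} S' = theta_sign {x} T * theta_sign {x} (S' - T)"
        using that by (rule theta_sign_split_right)
      ultimately show ?thesis
        by (simp add: kgen_mult_apply theta_sign_insert_left[of x T] mult_ac)
    qed
    have 0: "kmult (kgen x) f T = 0" if "T \<subseteq> S'" for T
      using that S by (auto simp: kgen_mult_apply)
    have "kmult (kmult (kgen x) f) g S = (\<Sum>T\<in>Pow (insert x S').
        theta_sign T (S - T) * kmult (kgen x) f T * g (S - T))"
      unfolding kmult_def[of "kmult (kgen x) f"] S(1)[symmetric] ..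
    also have "\<dots> = (\<Sum>T\<in>Pow S'. theta_sign {x} S' * (theta_sign T (S' - T) * f T * g (S' - T)))"
      unfolding sum_Pow_insert[OF S(2)] using 0 * by simp
    also have "\<dots> = kmult (kgen x) (kmult f g) S"
      unfolding kgen_mult_apply[of x _ S] using True
      by (simp add: S'_def[symmetric] kmult_def sum_distrib_left)
    finally show ?thesis .
  qed
qed

text \<open>Moving \<open>x\<close> past \<open>f\<close> costs the sign of the parity of
  \<open>f\<close>. Writing the sign as \<open>parity_op\<close> keeps the rule linear, so
  \<open>f\<close> may be inhomogeneous.\<close>

lemma kmult_kgen_mult: "kmult f (kmult (kgen x) g) = kmult (kgen x) (kmult (parity_op f) g)"
proof (rule ext)
  fix S
  show "kmult f (kmult (kgen x) g) S = kmult (kgen x) (kmult (parity_op f) g) S"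
  proof (cases "x \<in> S")
    case False
    then show ?thesis
      by (simp add: kgen_mult_apply kmult_def[of f])
  next
    case True
    define S' where "S' = S - {x}"
    have S: "S = insert x S'" "x \<notin> S'" using True by (auto simp: S'_def)
    have *: "theta_sign T (S - T) * f T * kmult (kgen x) g (S - T)
        = theta_sign {x} S' * (theta_sign T (S' - T) * parity_op f T * g (S' - T))"
      if "T \<subseteq> S'" for T
    proof -
      have "x \<notin> T" "S - T = insert x (S' - T)" "insert x (S' - T) - {x} = S' - T"
        using that S by auto
      moreover have "theta_sign {x} S' = theta_sign {x} T * theta_sign {x} (S' - T)"
        using that by (rule theta_sign_split_right)
      ultimately show ?thesis using S(2)
        by (simp add: kgen_mult_apply theta_sign_insert_right[of x "S' - T"] theta_sign_flip_gen parity_op_def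
            mult_ac)
    qed
    have 0: "kmult (kgen x) g (S - insert x T) = 0" for T
      by (auto simp: kgen_mult_apply)
    have "kmult f (kmult (kgen x) g) S = (\<Sum>T\<in>Pow (insert x S').
        theta_sign T (S - T) * f T * kmult (kgen x) g (S - T))"
      unfolding kmult_def[of f] S(1)[symmetric] ..
    also have "\<dots> = (\<Sum>T\<in>Pow S'. theta_sign {x} S' * (theta_sign T (S' - T) * parity_op f T * g (S' - T)))"
      unfolding sum_Pow_insert[OF S(2)] using 0 * by simp
    also have "\<dots> = kmult (kgen x) (kmult (parity_op f) g) S"
      unfolding kgen_mult_apply[of x _ S] using True
      by (simp add: S'_def[symmetric] kmult_def sum_distrib_left)
    finally show ?thesis .
  qed
qed

lemma kmult_comm:
  assumes "f \<in> parity_part p" "g \<in> parity_part q"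
  shows "kmult f g = kscale (koszul_sign p q) (kmult g f)"
proof (rule ext)
  fix S
  have *: "theta_sign T (S - T) * f T * g (S - T)
      = smult (koszul_sign p q) (theta_sign (S - T) T * g (S - T) * f T)" if "T \<subseteq> S" for T
  proof (cases "f T = 0 \<or> g (S - T) = 0")
    case False
    then have "odd (card T) = p" "odd (card (S - T)) = q"
      using assms by (auto simp: parity_part_def)
    then have "(-1) ^ (card (S - T) * card T) = [:koszul_sign p q:]"
      by (auto simp: koszul_sign_def minus_one_power_iff pCons_one) (simp add: one_pCons)
    moreover have "theta_sign T (S - T) = (-1) ^ (card (S - T) * card T) * theta_sign (S - T) T"
      by (rule theta_sign_flip) auto
    ultimately show ?thesis by (simp add: mult_ac)
  qed auto
  have "kmult f g S = (\<Sum>T\<in>Pow S. smult (koszul_sign p q) (theta_sign (S - T) T * g (S - T) * f T))"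
    unfolding kmult_def by (rule sum.cong) (auto simp: *)
  also have "\<dots> = (\<Sum>T\<in>Pow S. smult (koszul_sign p q) (theta_sign T (S - T) * g T * f (S - T)))"
    by (rule sum.reindex_bij_witness[of _ "\<lambda>T. S - T" "\<lambda>T. S - T"]) (auto simp: double_diff)
  finally show "kmult f g S = kscale (koszul_sign p q) (kmult g f) S"
    by (simp add: kmult_def kscale_def smult_sum_right)
qed

section \<open>The unit and the Clifford relations\<close>

definition kone :: kfun where
  "kone = (\<lambda>S. if S = {} then 1 else 0)"

lemma kone_mult [simp]: "kmult kone f = f"
proof (rule ext)
  fix S :: "gen set"
  have "kmult kone f S = (\<Sum>T\<in>Pow S. if T = {} then f S else 0)"
    unfolding kmult_def kone_def by (rule sum.cong) auto
  then show "kmult kone f S = f S" by (simp add: sum.delta)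
qed

lemma mult_kone [simp]: "kmult f kone = f"
proof (rule ext)
  fix S :: "gen set"
  have "kmult f kone S = (\<Sum>T\<in>Pow S. if T = S then f S else 0)"
    unfolding kmult_def kone_def by (rule sum.cong) auto
  then show "kmult f kone S = f S" by (simp add: sum.delta)
qed

lemma d_gen_kone [simp]: "d_gen x kone = 0"
  by (rule ext) (simp add: d_gen_apply kone_def)

lemma d_t_kone [simp]: "d_t kone = 0"
  by (rule ext) (simp add: d_t_def kone_def)

lemma d_t_kgen [simp]: "d_t (kgen x) = 0"
  by (rule ext) (simp add: d_t_def kgen_def)

lemma parity_op_kone [simp]: "parity_op kone = kone"
  by (rule ext) (simp add: parity_op_def kone_def)

lemma parity_op_kgen [simp]: "parity_op (kgen x) = - kgen x"
  by (rule ext) (simp add: parity_op_def kgen_def)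

lemma d_gen_kgen: "d_gen x (kgen y) = (if x = y then kone else 0)"
  by (rule ext) (auto simp: d_gen_apply kone_def kgen_def)

lemma d_t_kgen_mult: "d_t (kmult (kgen x) f) = kmult (kgen x) (d_t f)"
  by (simp add: d_t_kmult)

lemma d_gen_kgen_mult:
  "d_gen x (kmult (kgen y) f) = (if x = y then f else 0) - kmult (kgen y) (d_gen x f)"
  by (simp add: d_gen_kmult d_gen_kgen kmult_minus_left)

lemma kgen_mult_anticomm: "kmult (kgen x) (kmult (kgen y) f) = - kmult (kgen y) (kmult (kgen x) f)"
  by (subst kmult_kgen_mult) (simp add: kmult_minus_left kmult_minus_right)

lemma kfun_self_minus: "f = - f \<Longrightarrow> f = 0" for f :: kfun
  by (simp add: fun_eq_iff equal_neg_zero)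

lemma kgen_mult_twice [simp]: "kmult (kgen x) (kmult (kgen x) f) = 0"
  using kgen_mult_anticomm kfun_self_minus by blast

lemma d_gen_anticomm: "d_gen x (d_gen y f) = - d_gen y (d_gen x f)"
proof (cases "x = y")
  case True
  then show ?thesis by (auto simp: d_gen_apply fun_eq_iff)
next
  case False
  then have "theta_sign {y} {x} = - theta_sign {x} {y}"
    using theta_sign_flip[of "{x}" "{y}"] by simp
  then have "d_gen x (d_gen y f) S = (- d_gen y (d_gen x f)) S" for S
    using False theta_sign_insert_right[of x S "{y}"] theta_sign_insert_right[of y S "{x}"]
    by (auto simp: d_gen_apply insert_commute[of x y])
  then show ?thesis by (rule ext)
qed

lemma d_gen_twice [simp]: "d_gen x (d_gen x f) = 0"
  using d_gen_anticomm kfun_self_minus by blast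

section \<open>Dual generators, the Euler operator and bilinearity of the bracket\<close>

fun bar :: "gen \<Rightarrow> gen" where
  "bar (Xi i) = Eta i"
| "bar (Eta i) = Xi i"

lemma bar_bar [simp]: "bar (bar x) = x"
  by (cases x) auto

lemma sum_gen: "(\<Sum>y\<in>UNIV. F y) = (\<Sum>i\<in>UNIV. F (Xi i) + F (Eta i))"
  for F :: "gen \<Rightarrow> 'b::comm_monoid_add"
proof -
  have "inj Xi" "inj Eta" by (auto simp: inj_def)
  then show ?thesis
    unfolding UNIV_gen by (subst sum.union_disjoint) (auto simp: sum.reindex sum.distrib)
qed

lemma euler_eq: "euler f = (\<Sum>x\<in>UNIV. kmult (kgen x) (d_gen x f))"
  by (simp add: euler_def sum_gen)

lemma euler_apply: "euler f S = of_nat (card S) * f S"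
proof -
  have "euler f S = (\<Sum>x\<in>UNIV. if x \<in> S then f S else 0)"
    unfolding euler_eq sum_kfun_apply
    by (rule sum.cong) (auto simp: kgen_mult_apply d_gen_apply insert_absorb)
  then show ?thesis by (simp flip: sum.inter_filter)
qed

lemma Delta_apply: "Delta f S = smult (2 - of_nat (card S)) (f S)"
  by (simp add: Delta_def kscale_def euler_apply smult_diff_left of_nat_poly)

text \<open>With \<open>bar\<close> the two kinds of summands in \<open>poisson\<close> merge into
  one sum over all generators, and its minus sign cancels against the one in the bracket.\<close>

lemma contact_bracket_eq:
  "contact_bracket f g = kmult (Delta f) (d_t g) - kmult (d_t f) (Delta g)
     + (\<Sum>y\<in>UNIV. kmult (d_gen y (parity_op f)) (d_gen (bar y) g))"
  by (simp add: contact_bracket_def poisson_def sum_gen)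

lemma kscale_minus_one [simp]: "kscale (- 1) f = - f"
  by (simp add: kfun.scale_minus_left)

lemma smult_two: "smult 2 p = p + p" for p :: "complex poly"
  by (metis one_add_one smult_1_left smult_add_left)

lemma Delta_add: "Delta (f + g) = Delta f + Delta g"
  by (rule ext) (simp add: Delta_apply smult_add_right)

lemma Delta_scale: "Delta (kscale c f) = kscale c (Delta f)"
  by (rule ext) (simp add: Delta_apply kscale_def mult.commute)

lemma Delta_d_t: "Delta (d_t f) = d_t (Delta f)"
  by (rule ext) (simp add: Delta_apply d_t_def pderiv_smult)

lemma Delta_parity_op: "Delta (parity_op f) = parity_op (Delta f)"
  by (rule ext) (simp add: Delta_apply parity_op_def)

lemma Delta_kgen [simp]: "Delta (kgen x) = kgen x"
  by (rule ext) (simp add: Delta_apply kgen_def)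

lemma Delta_kone [simp]: "Delta kone = kscale 2 kone"
  by (rule ext) (simp add: Delta_apply kone_def kscale_def)

lemma Delta_kgen_mult:
  "Delta (kmult (kgen x) f) = kmult (kgen x) (Delta f) - kmult (kgen x) f"
proof (rule ext)
  fix S
  have "x \<in> S \<Longrightarrow> card S = Suc (card (S - {x}))" by (subst card.remove[of S x]) auto
  then show "Delta (kmult (kgen x) f) S = (kmult (kgen x) (Delta f) - kmult (kgen x) f) S"
    by (auto simp: Delta_apply kgen_mult_apply algebra_simps smult_diff_left smult_add_left
        simp del: card_Diff_insert card_Diff_singleton)
qed

lemma Delta_d_gen: "Delta (d_gen x f) = d_gen x (Delta f) + d_gen x f"
  by (rule ext)
    (auto simp: Delta_apply d_gen_apply algebra_simps smult_diff_left smult_add_left smult_two)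

lemma contact_bracket_add_left:
  "contact_bracket (f + g) h = contact_bracket f h + contact_bracket g h"
  by (simp add: contact_bracket_eq Delta_add d_t_add parity_op_add d_gen_add kmult_add_left
      sum.distrib algebra_simps)

lemma contact_bracket_add_right:
  "contact_bracket h (f + g) = contact_bracket h f + contact_bracket h g"
  by (simp add: contact_bracket_eq Delta_add d_t_add d_gen_add kmult_add_right
      sum.distrib algebra_simps)

lemma contact_bracket_scale_left:
  "contact_bracket (kscale c f) h = kscale c (contact_bracket f h)"
  by (simp add: contact_bracket_eq Delta_scale d_t_scale parity_op_scale d_gen_scale
      kmult_scale_left kfun.scale_right_distrib kfun.scale_right_diff_distrib kfun.scale_sum_right)

lemma contact_bracket_scale_right:
  "contact_bracket h (kscale c f) = kscale c (contact_bracket h f)"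
  by (simp add: contact_bracket_eq Delta_scale d_t_scale d_gen_scale
      kmult_scale_right kfun.scale_right_distrib kfun.scale_right_diff_distrib kfun.scale_sum_right)

lemma contact_bracket_minus_left: "contact_bracket (- f) h = - contact_bracket f h"
  using contact_bracket_scale_left[of "-1" f h] by simp

lemma contact_bracket_minus_right: "contact_bracket h (- f) = - contact_bracket h f"
  using contact_bracket_scale_right[of h "-1" f] by simp

lemma contact_bracket_zero [simp]: "contact_bracket 0 f = 0" "contact_bracket f 0 = 0"
  using contact_bracket_scale_left[of 0 f f] contact_bracket_scale_right[of f 0 f] by simp_all

lemma contact_bracket_sum_left:
  "contact_bracket (\<Sum>i\<in>A. F i) h = (\<Sum>i\<in>A. contact_bracket (F i) h)" for F :: "'b \<Rightarrow> kfun"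
  by (induction A rule: infinite_finite_induct)
    (simp_all only: sum.infinite sum.empty sum.insert not_False_eq_True
      contact_bracket_add_left contact_bracket_zero)

lemma contact_bracket_sum_right:
  "contact_bracket h (\<Sum>i\<in>A. F i) = (\<Sum>i\<in>A. contact_bracket h (F i))" for F :: "'b \<Rightarrow> kfun"
  by (induction A rule: infinite_finite_induct)
    (simp_all only: sum.infinite sum.empty sum.insert not_False_eq_True
      contact_bracket_add_right contact_bracket_zero)

lemma contact_bracket_kone: "contact_bracket kone f = kscale 2 (d_t f)"
  by (simp add: contact_bracket_eq kmult_scale_left)

section \<open>The adjoint action of the generators\<close>

definition agen :: "gen \<Rightarrow> kfun \<Rightarrow> kfun" where
  "agen x f = kmult (kgen x) (d_t f) - d_gen (bar x) f"

lemma contact_bracket_kgen: "contact_bracket (kgen x) f = agen x f"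
proof -
  have "(\<Sum>y\<in>UNIV. kmult (d_gen y (parity_op (kgen x))) (d_gen (bar y) f))
      = (\<Sum>y\<in>UNIV. if y = x then - d_gen (bar x) f else 0)"
    by (rule sum.cong) (auto simp: d_gen_minus d_gen_kgen kmult_minus_left)
  also have "\<dots> = - d_gen (bar x) f" by (subst sum.delta) auto
  finally show ?thesis by (simp add: contact_bracket_eq agen_def)
qed

lemma agen_add: "agen x (f + g) = agen x f + agen x g"
  by (simp add: agen_def d_t_add d_gen_add kmult_add_right)

lemma agen_minus: "agen x (- f) = - agen x f"
  by (simp add: agen_def d_t_minus d_gen_minus kmult_minus_right)

lemma agen_diff: "agen x (f - g) = agen x f - agen x g"
  by (simp add: agen_def d_t_diff d_gen_diff kmult_diff_right)

lemma agen_scale: "agen x (kscale c f) = kscale c (agen x f)"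
  by (simp add: agen_def d_t_scale d_gen_scale kmult_scale_right kfun.scale_right_diff_distrib)

lemma agen_sum: "agen x (\<Sum>i\<in>A. F i) = (\<Sum>i\<in>A. agen x (F i))" for F :: "'b \<Rightarrow> kfun"
  by (simp add: agen_def d_t_sum d_gen_sum kmult_sum_right sum_subtractf)

lemma agen_d_t: "d_t (agen x f) = agen x (d_t f)"
  by (simp add: agen_def d_t_diff d_t_kgen_mult d_t_d_gen)

lemma agen_parity_op: "parity_op (agen x f) = - agen x (parity_op f)"
  by (simp add: agen_def d_t_parity_op d_gen_parity_op kgen_mult_parity_op parity_op_diff)

lemma d_gen_agen:
  "d_gen y (agen x f) = (if y = x then d_t f else 0) - agen x (d_gen y f)"
  by (simp add: agen_def d_gen_diff d_gen_kgen_mult d_t_d_gen d_gen_anticomm[of "bar x" y])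

lemma agen_kmult:
  "agen x (kmult f g) = kmult (agen x f) g + kmult (parity_op f) (agen x g)"
  by (simp add: agen_def d_t_kmult d_gen_kmult kmult_add_right kmult_diff_left kmult_diff_right
      kgen_mult_assoc kmult_kgen_mult algebra_simps)

lemma Delta_agen:
  "Delta (agen x f) = agen x (Delta f) - (kmult (kgen x) (d_t f) + d_gen (bar x) f)"
proof -
  have "Delta (f - g) = Delta f - Delta g" for f g
    by (rule ext) (simp add: Delta_apply smult_diff_right)
  then show ?thesis
    by (simp add: agen_def Delta_kgen_mult Delta_d_gen Delta_d_t)
qed

text \<open>The operator \<open>agen x\<close> anticommutes with \<open>d_gen y\<close> except for
  \<open>y = x\<close>, where \<open>d_t\<close> appears, and it fails to commute with
  \<open>Delta\<close> by the terms in \<open>Delta_agen\<close>. The exceptional Poisson summands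
  cancel against the derivative terms of that defect, and the remaining terms with a factor x cancel
  each other.\<close>

lemma agen_contact_bracket:
  "agen x (contact_bracket f g)
     = contact_bracket (agen x f) g + contact_bracket (parity_op f) (agen x g)"
proof -
  let ?a = "agen x"
  \<comment> \<open>Up to sign, \<open>X\<close> and \<open>Y\<close> are what the two Poisson sums
    would be if \<open>agen x\<close> anticommuted with all derivatives; the facts 1 and 2 isolate
    the one exceptional summand in each.\<close>
  define X where "X = (\<Sum>y\<in>UNIV. kmult (?a (d_gen y (parity_op f))) (d_gen (bar y) g))"
  define Y where "Y = (\<Sum>y\<in>UNIV. kmult (d_gen y f) (?a (d_gen (bar y) g)))"
  have "(\<Sum>y\<in>UNIV. kmult (d_gen y (parity_op (?a f))) (d_gen (bar y) g))
      = (\<Sum>y\<in>UNIV. kmult (?a (d_gen y (parity_op f))) (d_gen (bar y) g)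
          - (if y = x then kmult (d_t (parity_op f)) (d_gen (bar x) g) else 0))"
    by (rule sum.cong)
      (auto simp: agen_parity_op d_gen_minus d_gen_agen kmult_diff_left kmult_minus_left)
  also have "\<dots> = X - kmult (d_t (parity_op f)) (d_gen (bar x) g)"
    unfolding sum_subtractf X_def by (subst sum.delta) auto
  finally have 1: "(\<Sum>y\<in>UNIV. kmult (d_gen y (parity_op (?a f))) (d_gen (bar y) g))
      = X - kmult (d_t (parity_op f)) (d_gen (bar x) g)" .
  have "(\<Sum>y\<in>UNIV. kmult (d_gen y f) (d_gen (bar y) (?a g)))
      = (\<Sum>y\<in>UNIV. (if y = bar x then kmult (d_gen (bar x) f) (d_t g) else 0)
          - kmult (d_gen y f) (?a (d_gen (bar y) g)))"
    by (rule sum.cong) (auto simp: d_gen_agen kmult_diff_right kmult_minus_right)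
  also have "\<dots> = kmult (d_gen (bar x) f) (d_t g) - Y"
    unfolding sum_subtractf Y_def by (subst sum.delta) auto
  finally have 2: "(\<Sum>y\<in>UNIV. kmult (d_gen y f) (d_gen (bar y) (?a g)))
      = kmult (d_gen (bar x) f) (d_t g) - Y" .
  have "?a (\<Sum>y\<in>UNIV. kmult (d_gen y (parity_op f)) (d_gen (bar y) g))
      = (\<Sum>y\<in>UNIV. kmult (?a (d_gen y (parity_op f))) (d_gen (bar y) g)
          - kmult (d_gen y f) (?a (d_gen (bar y) g)))"
    unfolding agen_sum
    by (rule sum.cong)
      (simp_all add: agen_kmult d_gen_parity_op agen_minus parity_op_minus kmult_minus_left)
  then have 3: "?a (\<Sum>y\<in>UNIV. kmult (d_gen y (parity_op f)) (d_gen (bar y) g)) = X - Y"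
    by (simp add: sum_subtractf X_def Y_def)
  show ?thesis
    unfolding contact_bracket_eq[of f g] contact_bracket_eq[of "?a f"]
      contact_bracket_eq[of "parity_op f"] parity_op_parity_op agen_add agen_diff 1 2 3
    by (simp add: agen_kmult agen_d_t Delta_agen d_t_parity_op Delta_parity_op
        kmult_diff_left kmult_diff_right kmult_add_left kmult_add_right
        kgen_mult_assoc kmult_kgen_mult)
qed

lemma d_t_contact_bracket:
  "d_t (contact_bracket f g) = contact_bracket (d_t f) g + contact_bracket f (d_t g)"
  by (simp add: contact_bracket_eq d_t_add d_t_diff d_t_sum d_t_kmult d_t_d_gen d_t_parity_op
      Delta_d_t sum.distrib algebra_simps)

section \<open>The grading\<close>

lemma graded_partI:
  "(\<And>S n. coeff (f S) n \<noteq> 0 \<Longrightarrow> 2 * int n + int (card S) - 2 = d) \<Longrightarrow> f \<in> graded_part d"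
  by (simp add: graded_part_def)

lemma graded_partD:
  "f \<in> graded_part d \<Longrightarrow> coeff (f S) n \<noteq> 0 \<Longrightarrow> 2 * int n + int (card S) - 2 = d"
  by (auto simp: graded_part_def)

lemma subspace_graded_part: "kfun.subspace (graded_part d)"
proof (rule kfun.subspaceI)
  fix x y assume xy: "x \<in> graded_part d" "y \<in> graded_part d"
  show "x + y \<in> graded_part d"
  proof (rule graded_partI)
    fix S n assume "coeff ((x + y) S) n \<noteq> 0"
    then have "coeff (x S) n \<noteq> 0 \<or> coeff (y S) n \<noteq> 0" by auto
    then show "2 * int n + int (card S) - 2 = d" using xy graded_partD by blast
  qed
qed (auto simp: graded_part_def kscale_def)

lemmas graded_part_add = kfun.subspace_add[OF subspace_graded_part]
lemmas graded_part_diff = kfun.subspace_diff[OF subspace_graded_part]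
lemmas graded_part_scale = kfun.subspace_scale[OF subspace_graded_part]
lemmas graded_part_neg = kfun.subspace_neg[OF subspace_graded_part]
lemmas graded_part_sum = kfun.subspace_sum[OF subspace_graded_part]
lemmas graded_part_zero [simp] = kfun.subspace_0[OF subspace_graded_part]

lemma kone_graded: "kone \<in> graded_part (-2)"
  by (rule graded_partI) (auto simp: kone_def split: if_splits)

lemma kgen_graded: "kgen x \<in> graded_part (-1)"
  by (rule graded_partI) (auto simp: kgen_def split: if_splits)

lemma coeff_theta_sign_mult: "coeff (theta_sign A B * p) n \<noteq> 0 \<longleftrightarrow> coeff p n \<noteq> 0"
  using theta_sign_cases[of A B] by auto

lemma kmult_graded:
  assumes "f \<in> graded_part a" "g \<in> graded_part b"
  shows "kmult f g \<in> graded_part (a + b + 2)"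
proof (rule graded_partI)
  fix S n assume "coeff (kmult f g S) n \<noteq> 0"
  then have "(\<Sum>T\<in>Pow S. coeff (theta_sign T (S - T) * (f T * g (S - T))) n) \<noteq> 0"
    by (simp add: kmult_def coeff_sum mult.assoc)
  then obtain T where T: "T \<subseteq> S" "coeff (theta_sign T (S - T) * (f T * g (S - T))) n \<noteq> 0"
    by (meson PowD sum.neutral)
  from T(2) have "(\<Sum>i\<le>n. coeff (f T) i * coeff (g (S - T)) (n - i)) \<noteq> 0"
    unfolding coeff_theta_sign_mult by (simp add: coeff_mult)
  then obtain i where i: "i \<le> n" "coeff (f T) i * coeff (g (S - T)) (n - i) \<noteq> 0"
    by (meson atMost_iff sum.neutral)
  then have "2 * int i + int (card T) - 2 = a" "2 * int (n - i) + int (card (S - T)) - 2 = b"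
    using graded_partD[OF assms(1), of T i] graded_partD[OF assms(2), of "S - T" "n - i"] by simp_all
  moreover have "card S = card T + card (S - T)"
    using T(1) by (metis card_mono card_Diff_subset finite le_add_diff_inverse)
  ultimately show "2 * int n + int (card S) - 2 = a + b + 2"
    using i(1) by auto
qed

lemma d_t_graded: "f \<in> graded_part a \<Longrightarrow> d_t f \<in> graded_part (a - 2)"
  by (rule graded_partI) (auto simp: d_t_def coeff_pderiv dest: graded_partD)

lemma d_gen_graded:
  assumes "f \<in> graded_part a"
  shows "d_gen x f \<in> graded_part (a - 1)"
proof (rule graded_partI)
  fix S n assume "coeff (d_gen x f S) n \<noteq> 0"
  then have "x \<notin> S" "coeff (f (insert x S)) n \<noteq> 0"
    by (auto simp: d_gen_apply coeff_theta_sign_mult split: if_splits)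
  then show "2 * int n + int (card S) - 2 = a - 1"
    using graded_partD[OF assms] by fastforce
qed

lemma Delta_graded: "f \<in> graded_part a \<Longrightarrow> Delta f \<in> graded_part a"
  by (auto simp: graded_part_def Delta_apply)

lemma parity_op_graded:
  assumes "f \<in> graded_part a"
  shows "parity_op f = (if even a then f else - f)"
proof (rule ext)
  fix S
  show "parity_op f S = (if even a then f else - f) S"
  proof (cases "f S = 0")
    case False
    then have "2 * int (degree (f S)) + int (card S) - 2 = a"
      by (intro graded_partD[OF assms]) simp
    then have "even a \<longleftrightarrow> even (card S)" by presburger
    then show ?thesis by (simp add: parity_op_def)
  qed (simp add: parity_op_def)
qed

lemma graded_part_parity_part: "f \<in> graded_part a \<Longrightarrow> f \<in> parity_part (odd a)"
proof -
  assume f: "f \<in> graded_part a"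
  have "odd (card S) = odd a" if "f S \<noteq> 0" for S
  proof -
    have "2 * int (degree (f S)) + int (card S) - 2 = a"
      using that by (intro graded_partD[OF f]) simp
    then show ?thesis by presburger
  qed
  then show ?thesis by (simp add: parity_part_def)
qed

lemma kgen_mult_graded: "f \<in> graded_part a \<Longrightarrow> kmult (kgen x) f \<in> graded_part (a + 1)"
  using kmult_graded[OF kgen_graded, of f a x] by (simp add: add.commute)

lemma agen_graded: "f \<in> graded_part a \<Longrightarrow> agen x f \<in> graded_part (a - 1)"
  unfolding agen_def
  using kgen_mult_graded[OF d_t_graded, of f a x] d_gen_graded[of f a "bar x"]
  by (intro graded_part_diff) simp_all

lemma contact_bracket_graded:
  assumes "f \<in> graded_part a" "g \<in> graded_part b"
  shows "contact_bracket f g \<in> graded_part (a + b)"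
proof -
  have "parity_op f \<in> graded_part a"
    using assms(1) by (simp add: parity_op_graded graded_part_neg)
  then have "kmult (d_gen y (parity_op f)) (d_gen (bar y) g) \<in> graded_part (a + b)" for y
    using kmult_graded[OF d_gen_graded d_gen_graded, of "parity_op f" a g b y "bar y"] assms(2)
    by simp
  moreover have "kmult (Delta f) (d_t g) \<in> graded_part (a + b)"
    using kmult_graded[OF Delta_graded d_t_graded, of f a g b] assms by simp
  moreover have "kmult (d_t f) (Delta g) \<in> graded_part (a + b)"
    using kmult_graded[OF d_t_graded Delta_graded, of f a g b] assms by simp
  ultimately show ?thesis
    unfolding contact_bracket_eq by (intro graded_part_add graded_part_diff graded_part_sum)
qed

lemma graded_part_low: "a < -2 \<Longrightarrow> f \<in> graded_part a \<Longrightarrow> f = 0"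
proof (rule ext)
  fix S assume "a < -2" "f \<in> graded_part a"
  then have "coeff (f S) n = 0" for n using graded_partD[of f a S n] by fastforce
  then show "f S = 0 S" by (simp add: poly_eq_iff)
qed

lemma graded_part_minus_two:
  assumes "f \<in> graded_part (-2)"
  shows "f = kscale (coeff (f {}) 0) kone"
proof (rule ext)
  fix S
  have "coeff (f S) n = 0" if "n \<noteq> 0 \<or> S \<noteq> {}" for n
    
  proof (rule ccontr)
    assume "coeff (f S) n \<noteq> 0"
    then have "2 * int n + int (card S) = 0" using graded_partD[OF assms, of S n] by simp
    then have "n = 0 \<and> card S = 0" by linarith
    then show False using that by simp
  qed
  then show "f S = kscale (coeff (f {}) 0) kone S"
    by (auto simp: poly_eq_iff kone_def kscale_def coeff_1)
qed

lemma graded_part_minus_one: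
  assumes "f \<in> graded_part (-1)"
  shows "f = (\<Sum>x\<in>UNIV. kscale (coeff (f {x}) 0) (kgen x))"
proof (rule ext)
  fix S
  have 0: "coeff (f S) n = 0" if "n \<noteq> 0 \<or> card S \<noteq> 1" for n
    
  proof (rule ccontr)
    assume "coeff (f S) n \<noteq> 0"
    then have "2 * int n + int (card S) = 1" using graded_partD[OF assms, of S n] by simp
    then have "n = 0 \<and> card S = 1" by presburger
    then show False using that by simp
  qed
  show "f S = (\<Sum>x\<in>UNIV. kscale (coeff (f {x}) 0) (kgen x)) S"
  proof (cases "card S = 1")
    case True
    then obtain z where z: "S = {z}" by (auto simp: card_Suc_eq One_nat_def)
    have "(\<Sum>x\<in>UNIV. kscale (coeff (f {x}) 0) (kgen x)) S
        = (\<Sum>x\<in>UNIV. if x = z then smult (coeff (f {z}) 0) 1 else 0)"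
      unfolding sum_kfun_apply by (rule sum.cong) (auto simp: z kgen_def kscale_def)
    moreover have "f {z} = [:coeff (f {z}) 0:]"
      using 0 by (intro poly_eqI) (auto simp: z coeff_pCons split: nat.split)
    ultimately show ?thesis by (simp add: z)
  next
    case False
    then have "kgen x S = 0" for x by (auto simp: kgen_def)
    moreover have "f S = 0" using 0 False by (simp add: poly_eq_iff)
    ultimately show ?thesis by (simp add: sum_kfun_apply kscale_def)
  qed
qed

text \<open>The bracket of x and bar x is -1, and 1 acts as 2 d_t. Hence the operators
  \<open>agen\<close> together determine \<open>d_t\<close>.\<close>

lemma agen_agen_bar: "agen x (agen (bar x) f) + agen (bar x) (agen x f) = kscale (-2) (d_t f)"
  by (simp add: agen_def d_t_diff d_gen_diff d_t_kgen_mult d_gen_kgen_mult d_t_d_gen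
      kmult_diff_right kgen_mult_anticomm[of "bar x" x] d_gen_anticomm[of "bar x" x]
      fun_eq_iff kscale_def smult_two)

text \<open>By \<open>agen_agen_bar\<close> the t-derivative vanishes; what is left of
  \<open>agen x f = 0\<close> then says that each odd derivative vanishes as well.\<close>

lemma agen_eq_0_imp_const:
  assumes "\<And>x. agen x f = 0"
  shows "f \<in> graded_part (-2)"
proof -
  have "agen x 0 = 0" for x by (simp add: agen_def)
  then have "kscale (-2) (d_t f) = 0"
    using agen_agen_bar[of "Xi I1" f] assms by simp
  then have d_t: "d_t f = 0" by (simp only: kfun.scale_eq_0_iff) simp
  have d_gen: "d_gen x f = 0" for x
    using assms[of "bar x"] by (simp add: agen_def d_t)
  have S: "f S = 0" if "S \<noteq> {}" for S
  proof -
    from that obtain x S' where "S = insert x S'" "x \<notin> S'" by (metis ex_in_conv mk_disjoint_insert)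
    then have "theta_sign {x} S' * f S = 0"
      using fun_cong[OF d_gen[of x], of S'] by (simp add: d_gen_apply)
    then have "theta_sign {x} S' * (theta_sign {x} S' * f S) = 0" by (simp only: mult_zero_right)
    then show ?thesis by simp
  qed
  have "pderiv (f {}) = 0" using fun_cong[OF d_t, of "{}"] by (simp add: d_t_def)
  then have "degree (f {}) = 0" by (simp add: pderiv_eq_0_iff)
  then have "coeff (f {}) n \<noteq> 0 \<Longrightarrow> n = 0" for n
    using le_degree by fastforce
  then show ?thesis using S by (intro graded_partI) (metis card.empty coeff_0 diff_0 mult_zero_right of_nat_0 add_0)
qed

lemma graded_part_disjoint:
  assumes "a \<noteq> b" "f \<in> graded_part a" "f \<in> graded_part b"
  shows "f = 0"
proof (rule ext)
  fix S
  have "coeff (f S) n = 0" for n using assms graded_partD by metis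
  then show "f S = 0 S" by (simp add: poly_eq_iff)
qed

section \<open>Antisymmetry and the Jacobi identity\<close>

lemma parity_part_ops:
  assumes "f \<in> parity_part p"
  shows "Delta f \<in> parity_part p" "d_t f \<in> parity_part p" "d_gen x f \<in> parity_part (\<not> p)"
    and "parity_op f = (if p then - f else f)"
proof -
  show "Delta f \<in> parity_part p" "d_t f \<in> parity_part p"
    using assms pderiv_0 by (force simp: parity_part_def Delta_apply d_t_def)+
  show "d_gen x f \<in> parity_part (\<not> p)"
    using assms by (fastforce simp: parity_part_def d_gen_apply split: if_splits)
  show "parity_op f = (if p then - f else f)"
  proof (rule ext)
    fix S show "parity_op f S = (if p then - f else f) S"
      using assms by (cases "f S = 0") (auto simp: parity_part_def parity_op_def)
  qed
qed

text \<open>The two terms with \<open>Delta\<close> trade places, and reindexing by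
  \<open>bar\<close> turns the Poisson sum for (f, g) into the one for (g, f).\<close>

lemma contact_bracket_antisym:
  assumes f: "f \<in> parity_part p" and g: "g \<in> parity_part q"
  shows "contact_bracket f g = - kscale (koszul_sign p q) (contact_bracket g f)"
proof -
  let ?k = "koszul_sign p q"
  note of = parity_part_ops[OF f] and og = parity_part_ops[OF g]
  have "(\<Sum>y\<in>UNIV. kmult (d_gen y (parity_op f)) (d_gen (bar y) g))
      = (\<Sum>y\<in>UNIV. kscale (- ?k) (kmult (d_gen (bar y) (parity_op g)) (d_gen y f)))"
    unfolding of(4) og(4)
    by (rule sum.cong) (use kmult_comm[OF of(3) og(3)] in
        \<open>auto simp: d_gen_minus kmult_minus_left koszul_sign_def\<close>)
  also have "\<dots> = (\<Sum>y\<in>UNIV. kscale (- ?k) (kmult (d_gen y (parity_op g)) (d_gen (bar y) f)))"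
    by (rule sum.reindex_bij_witness[of _ bar bar]) auto
  finally have "(\<Sum>y\<in>UNIV. kmult (d_gen y (parity_op f)) (d_gen (bar y) g))
      = - kscale ?k (\<Sum>y\<in>UNIV. kmult (d_gen y (parity_op g)) (d_gen (bar y) f))"
    by (simp add: kfun.scale_sum_right kfun.scale_minus_left sum_negf)
  then show ?thesis
    unfolding contact_bracket_eq[of f g] contact_bracket_eq[of g f]
    using kmult_comm[OF of(1) og(2)] kmult_comm[OF of(2) og(1)]
    by (simp add: kfun.scale_right_distrib kfun.scale_right_diff_distrib)
qed

lemma contact_bracket_antisym_graded:
  assumes "f \<in> graded_part a" "g \<in> graded_part b"
  shows "contact_bracket f g = - kscale (koszul_sign (odd a) (odd b)) (contact_bracket g f)"
  using assms by (intro contact_bracket_antisym graded_part_parity_part)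

text \<open>The parities are parameters instead of being read off from \<open>f\<close> and
  \<open>g\<close>, which makes the expression additive in each argument.\<close>

definition jacobiator :: "bool \<Rightarrow> bool \<Rightarrow> kfun \<Rightarrow> kfun \<Rightarrow> kfun \<Rightarrow> kfun" where
  "jacobiator p q f g h = contact_bracket f (contact_bracket g h) - contact_bracket (contact_bracket f g) h
     - kscale (koszul_sign p q) (contact_bracket g (contact_bracket f h))"

text \<open>For a generator this is the derivation rule \<open>agen_contact_bracket\<close>, for a
  constant it is the Leibniz rule of \<open>d_t\<close>.\<close>

lemma jacobi_neg_degree:
  assumes f: "f \<in> graded_part a" and a: "a < 0" and g: "g \<in> graded_part b"
  shows "jacobiator (odd a) (odd b) f g h = 0"
proof -
  have gen: "contact_bracket (kgen x) (contact_bracket g h)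
      = contact_bracket (contact_bracket (kgen x) g) h
        + kscale (koszul_sign True (odd b)) (contact_bracket g (contact_bracket (kgen x) h))" for x
    unfolding contact_bracket_kgen agen_contact_bracket parity_op_graded[OF g]
    by (auto simp: koszul_sign_def contact_bracket_minus_left)
  consider "a < -2" | "a = -2" | "a = -1" using a by linarith
  then show ?thesis
  proof cases
    case 1
    then show ?thesis using graded_part_low[OF _ f] by (simp add: jacobiator_def)
  next
    case 2
    then obtain c where "f = kscale c kone" using graded_part_minus_two f by blast
    then show ?thesis using 2
      by (simp add: jacobiator_def koszul_sign_def contact_bracket_scale_left contact_bracket_scale_right
          contact_bracket_kone d_t_contact_bracket kfun.scale_right_distrib)
  next
    case 3
    then obtain c where f: "f = (\<Sum>x\<in>UNIV. kscale (c x) (kgen x))"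
      using graded_part_minus_one[of f] assms(1) by auto
    show ?thesis using 3
      unfolding jacobiator_def f
      by (simp add: contact_bracket_sum_left contact_bracket_sum_right
          contact_bracket_scale_left contact_bracket_scale_right gen
          kfun.scale_right_distrib kfun.scale_sum_right sum.distrib mult.commute)
  qed
qed

text \<open>If some degree is negative, antisymmetry moves that argument to the front. Otherwise
  applying \<open>agen x\<close> gives jacobiators of smaller total degree, so the jacobiator lies
  in degree -2; but its degree is a + b + c >= 0, hence it is zero.\<close>

lemma jacobi_graded:
  assumes "f \<in> graded_part a" "g \<in> graded_part b" "h \<in> graded_part c"
  shows "jacobiator (odd a) (odd b) f g h = 0"
  using assms
\<comment> \<open>The shift by 1 makes the measure drop also when the total degree passes from 0 to
  -1.\<close>
proof (induction "nat (a + b + c + 1)" arbitrary: a b c f g h rule: less_induct)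
  case less
  note f = less.prems(1) and g = less.prems(2) and h = less.prems(3)
  note fg = contact_bracket_graded[OF f g] and fh = contact_bracket_graded[OF f h]
    and gh = contact_bracket_graded[OF g h]
  note hf = contact_bracket_graded[OF h f] and hg = contact_bracket_graded[OF h g]
    and gf = contact_bracket_graded[OF g f]
  note signs = koszul_sign_def contact_bracket_minus_left contact_bracket_minus_right
  consider "a < 0" | "b < 0" | "c < 0" | "a \<ge> 0" "b \<ge> 0" "c \<ge> 0" by linarith
  then show ?case
  proof cases
    case 1
    then show ?thesis using jacobi_neg_degree f g by blast
  next
    case 2
    have "jacobiator (odd b) (odd a) g f h = 0" using jacobi_neg_degree g 2 f by blast
    then show ?thesis
      using contact_bracket_antisym_graded[OF f g]
      by (cases "even a"; cases "even b") (simp_all add: jacobiator_def signs algebra_simps)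
  next
    case 3
    have "jacobiator (odd c) (odd a) h f g = 0" using jacobi_neg_degree h 3 f by blast
    then show ?thesis
      using contact_bracket_antisym_graded[OF g h] contact_bracket_antisym_graded[OF f h]
        contact_bracket_antisym_graded[OF h fg] contact_bracket_antisym_graded[OF hf g]
      by (cases "even a"; cases "even b"; cases "even c")
         (simp_all add: jacobiator_def signs algebra_simps neg_eq_iff_add_eq_0)
  next
    case 4
    let ?R = "jacobiator (odd a) (odd b) f g h"
    have R: "?R \<in> graded_part (a + b + c)"
    proof -
      have "contact_bracket f (contact_bracket g h) \<in> graded_part (a + b + c)"
        "contact_bracket (contact_bracket f g) h \<in> graded_part (a + b + c)"
        "contact_bracket g (contact_bracket f h) \<in> graded_part (a + b + c)"
        using contact_bracket_graded[OF f gh] contact_bracket_graded[OF fg h]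
          contact_bracket_graded[OF g fh] by (simp_all add: ac_simps)
      then show ?thesis unfolding jacobiator_def
        by (intro graded_part_diff graded_part_scale)
    qed
    have "agen x ?R = 0" for x
    proof -
      have "jacobiator (odd (a - 1)) (odd b) (agen x f) g h = 0"
        "jacobiator (odd a) (odd (b - 1)) f (agen x g) h = 0"
        "jacobiator (odd a) (odd b) f g (agen x h) = 0"
        using 4 less.hyps[OF _ agen_graded[OF f] g h] less.hyps[OF _ f agen_graded[OF g] h]
          less.hyps[OF _ f g agen_graded[OF h]] by simp_all
      moreover have "agen x ?R =
          contact_bracket (agen x f) (contact_bracket g h)
          + contact_bracket (parity_op f) (contact_bracket (agen x g) h)
          + contact_bracket (parity_op f) (contact_bracket (parity_op g) (agen x h))
          - (contact_bracket (contact_bracket (agen x f) g) h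
            + contact_bracket (contact_bracket (parity_op f) (agen x g)) h
            + contact_bracket (parity_op (contact_bracket f g)) (agen x h))
          - kscale (koszul_sign (odd a) (odd b))
             (contact_bracket (agen x g) (contact_bracket f h)
              + contact_bracket (parity_op g) (contact_bracket (agen x f) h)
              + contact_bracket (parity_op g) (contact_bracket (parity_op f) (agen x h)))"
        by (simp add: jacobiator_def agen_diff agen_add agen_scale agen_contact_bracket
            contact_bracket_add_left contact_bracket_add_right algebra_simps)
      ultimately show ?thesis
        unfolding parity_op_graded[OF f] parity_op_graded[OF g] parity_op_graded[OF fg]
        by (cases "even a"; cases "even b")
           (simp_all add: jacobiator_def signs algebra_simps)
    qed
    then have "?R \<in> graded_part (-2)" by (rule agen_eq_0_imp_const)
    then show ?thesis using R 4 by (intro graded_part_disjoint[of "-2" "a + b + c"]) auto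
  qed
qed

section \<open>Homogeneous components\<close>

text \<open>The degree and \<open>card S\<close> determine the exponent of t. The test discards the
  meaningless \<open>n\<close> obtained from an odd or negative numerator.\<close>

definition hcomp :: "int \<Rightarrow> kfun \<Rightarrow> kfun" where
  "hcomp d f = (\<lambda>S. let n = nat ((d + 2 - int (card S)) div 2) in
     if 2 * int n + int (card S) - 2 = d then monom (coeff (f S) n) n else 0)"

lemma coeff_hcomp:
  "coeff (hcomp d f S) n = (if 2 * int n + int (card S) - 2 = d then coeff (f S) n else 0)"
proof (cases "2 * int n + int (card S) - 2 = d")
  case True
  then have "d + 2 - int (card S) = 2 * int n" by simp
  then have "nat ((d + 2 - int (card S)) div 2) = n" by simp
  then show ?thesis using True by (simp add: hcomp_def)
qed (auto simp: hcomp_def Let_def)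

lemma hcomp_add: "hcomp d (f + g) = hcomp d f + hcomp d g"
  by (rule ext, rule poly_eqI) (simp add: coeff_hcomp)

lemma hcomp_scale: "hcomp d (kscale c f) = kscale c (hcomp d f)"
  by (rule ext, rule poly_eqI) (simp add: coeff_hcomp kscale_def)

lemma hcomp_zero [simp]: "hcomp d 0 = 0"
  by (rule ext, rule poly_eqI) (simp add: coeff_hcomp)

lemma hcomp_in_graded_part: "hcomp d f \<in> graded_part d"
  by (rule graded_partI) (auto simp: coeff_hcomp split: if_splits)

lemma hcomp_graded_part: "f \<in> graded_part e \<Longrightarrow> hcomp d f = (if d = e then f else 0)"
  by (rule ext, rule poly_eqI) (auto simp: coeff_hcomp dest: graded_partD)

lemma sum_hcomp: "\<exists>N. f = (\<Sum>d\<in>{-2..N}. hcomp d f)"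
proof
  \<comment> \<open>Any common bound of the degrees works; the sum over all index sets is
    one.\<close>
  define N where "N = int (\<Sum>S\<in>UNIV. 2 * degree (f S) + card S)"
  have "(\<Sum>d\<in>{-2..N}. coeff (hcomp d f S) n) = coeff (f S) n" for S n
  proof (cases "coeff (f S) n = 0")
    case False
    then have "2 * n + card S \<le> 2 * degree (f S) + card S" using le_degree by auto
    also have "\<dots> \<le> (\<Sum>S\<in>UNIV. 2 * degree (f S) + card S)"
      by (rule member_le_sum) auto
    finally have "int (2 * n + card S) \<le> N" unfolding N_def by (simp only: of_nat_le_iff)
    moreover have "(\<Sum>d\<in>{-2..N}. coeff (hcomp d f S) n)
        = (\<Sum>d\<in>{-2..N}. if d = 2 * int n + int (card S) - 2 then coeff (f S) n else 0)"
      by (rule sum.cong) (auto simp: coeff_hcomp)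
    ultimately show ?thesis by (subst (asm) sum.delta) auto
  qed (simp add: coeff_hcomp)
  then show "f = (\<Sum>d\<in>{-2..N}. hcomp d f)"
    by (intro ext poly_eqI) (simp add: sum_kfun_apply coeff_sum)
qed

text \<open>The first premise speaks only of the components of the given \<open>f\<close>, so what
  is known about them, such as membership in the prolong, stays available.\<close>

lemma sum_hcomp_induct:
  assumes "\<And>d. P (hcomp d f)" "P 0" "\<And>f g. P f \<Longrightarrow> P g \<Longrightarrow> P (f + g)"
  shows "P f"
proof -
  have "P (\<Sum>d\<in>A. hcomp d f)" if "finite A" for A
    using that by (induction A rule: finite_induct) (simp_all only: sum.empty sum.insert assms not_False_eq_True)
  then show ?thesis using sum_hcomp by (metis finite_atLeastAtMost_int)
qed

lemma hcomp_parity_part: "f \<in> parity_part p \<Longrightarrow> odd d \<noteq> p \<Longrightarrow> hcomp d f = 0"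
proof (intro ext poly_eqI)
  fix S n assume *: "f \<in> parity_part p" "odd d \<noteq> p"
  have "2 * int n + int (card S) - 2 \<noteq> d \<or> f S = 0"
    using * by (cases "f S = 0") (auto simp: parity_part_def)
  then show "coeff (hcomp d f S) n = coeff (0 S) n" by (auto simp: coeff_hcomp)
qed

lemma subspace_parity_part: "kfun.subspace (parity_part p)"
  by (rule kfun.subspaceI) (auto simp: parity_part_def kscale_def, metis add.right_neutral, metis add.right_neutral)

definition even_comp :: "kfun \<Rightarrow> kfun" where
  "even_comp f = (\<lambda>S. if even (card S) then f S else 0)"

lemma hcomp_even_comp: "hcomp d (even_comp f) = (if even d then hcomp d f else 0)"
proof (intro ext poly_eqI)
  fix S :: "gen set" and n
  have "2 * int n + int (card S) - 2 = d \<Longrightarrow> even d \<longleftrightarrow> even (card S)" by auto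
  then show "coeff (hcomp d (even_comp f) S) n = coeff ((if even d then hcomp d f else 0) S) n"
    by (auto simp: coeff_hcomp even_comp_def)
qed

section \<open>The elements t and t^2 and the degree zero component\<close>

definition kt2 :: kfun where
  "kt2 = (\<lambda>S. if S = {} then monom 1 2 else 0)"

lemma kt_mult_apply: "kmult kt f S = monom 1 1 * f S"
proof -
  have "kmult kt f S = (\<Sum>T\<in>Pow S. if T = {} then monom 1 1 * f S else 0)"
    unfolding kmult_def kt_def by (rule sum.cong) auto
  then show ?thesis by (simp add: sum.delta)
qed

lemma kt_graded: "kt \<in> graded_part 0" and kt2_graded: "kt2 \<in> graded_part 2"
  by (auto intro!: graded_partI simp: kt_def kt2_def split: if_splits)

lemma d_t_kt [simp]: "d_t kt = kone"
  by (rule ext) (simp add: d_t_def kt_def kone_def pderiv_monom monom_0)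

lemma d_t_kt2 [simp]: "d_t kt2 = kscale 2 kt"
  by (rule ext) (simp add: d_t_def kt2_def kt_def kscale_def pderiv_monom smult_monom)

lemma d_gen_kt [simp]: "d_gen x kt = 0" "d_gen x kt2 = 0"
  by (auto simp: d_gen_apply kt_def kt2_def)

lemma parity_op_kt [simp]: "parity_op kt = kt"
  by (rule ext) (simp add: parity_op_def kt_def)

lemma kt_mult_kgen: "kmult kt (kgen x) = kmult (kgen x) kt"
  using kmult_kgen_mult[of kt x kone] by simp

text \<open>The bracket with t is 2 t d_t + E - 2, which multiplies a monomial by its
  degree.\<close>

lemma kt_grading_element:
  assumes "f \<in> graded_part d"
  shows "contact_bracket kt f = kscale (of_int d) f"
proof (intro ext poly_eqI)
  fix S n
  have "Delta kt = kscale 2 kt" by (rule ext) (simp add: Delta_apply kt_def kscale_def)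
  then have "contact_bracket kt f = kscale 2 (kmult kt (d_t f)) - Delta f"
    by (simp add: contact_bracket_eq kmult_scale_left)
  then have *: "contact_bracket kt f S = smult 2 (monom 1 1 * pderiv (f S)) - smult (2 - of_nat (card S)) (f S)"
    by (simp add: kscale_def kt_mult_apply d_t_def Delta_apply)
  have "coeff (contact_bracket kt f S) n = (2 * of_nat n + of_nat (card S) - 2) * coeff (f S) n"
    unfolding * coeff_diff coeff_smult coeff_monom_mult by (cases n) (simp_all add: coeff_pderiv algebra_simps)
  also have "\<dots> = of_int (2 * int n + int (card S) - 2) * coeff (f S) n" by simp
  also have "\<dots> = of_int d * coeff (f S) n"
    using graded_partD[OF assms, of S n] by (cases "coeff (f S) n = 0") auto
  finally show "coeff (contact_bracket kt f S) n = coeff (kscale (of_int d) f S) n"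
    by (simp add: kscale_def)
qed

text \<open>The Euler operator kills t and is 2 on quadratic forms, hence the factor 1/2. The
  formula reduces statements about degree 0 to t and products of two generators.\<close>

lemma graded_part_zero_eq:
  assumes "D \<in> graded_part 0"
  shows "D = kscale (coeff (D {}) 1) kt + kscale (1/2) (\<Sum>x\<in>UNIV. kmult (kgen x) (d_gen x D))"
proof (intro ext poly_eqI)
  fix S n
  have "coeff (D S) n = 0 \<or> (n = 1 \<and> S = {}) \<or> (n = 0 \<and> card S = 2)"
  proof (cases "coeff (D S) n = 0")
    case False
    then have "2 * int n + int (card S) = 2" using graded_partD[OF assms, of S n] by simp
    then have "n = 1 \<and> card S = 0 \<or> n = 0 \<and> card S = 2" by presburger
    then show ?thesis by auto
  qed simp
  then show "coeff (D S) n = coeff ((kscale (coeff (D {}) 1) kt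
      + kscale (1/2) (\<Sum>x\<in>UNIV. kmult (kgen x) (d_gen x D))) S) n"
    unfolding euler_eq[symmetric]
    by (auto simp: kscale_def euler_apply kt_def coeff_monom of_nat_poly)
qed

section \<open>Partial prolongs are Lie superalgebras\<close>

text \<open>These assumptions pass to the image under the exchange of a dual pair, so one argument
  serves both prolongs.\<close>

locale g1_submodule =
  fixes H :: "kfun set"
  assumes H_graded: "H \<subseteq> graded_part 1"
    and H_submodule: "g0_submodule H"
    and g12_le_H: "g12 \<subseteq> H"
begin

abbreviation h :: "int \<Rightarrow> kfun set" where
  "h \<equiv> prolong_part H"

abbreviation V :: "kfun set" where
  "V \<equiv> partial_prolong H"

lemma h_nonpos: "i \<le> 0 \<Longrightarrow> h i = graded_part i"
  by (simp add: prolong_part_def)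

lemma h_one: "h 1 = H"
  by (simp add: prolong_part_def)

lemma h_step:
  assumes "i \<ge> 2"
  shows "h i = {D \<in> graded_part i. \<forall>v\<in>graded_part (-1). contact_bracket D v \<in> h (i - 1)}"
proof -
  have "nat (i - 1) = Suc (nat (i - 2))" "int (nat (i - 2)) + 2 = i" "nat (i - 1 - 1) = nat (i - 2)"
    using assms by simp_all
  then show ?thesis using assms by (simp add: prolong_part_def)
qed

lemma h_graded: "f \<in> h i \<Longrightarrow> f \<in> graded_part i"
proof -
  assume f: "f \<in> h i"
  consider "i \<le> 0" | "i = 1" | "i \<ge> 2" by linarith
  then show ?thesis using f h_nonpos h_one H_graded h_step by cases auto
qed

lemma subspace_h: "kfun.subspace (h i)"
proof (cases "i \<ge> 1")
  case False
  then show ?thesis using h_nonpos subspace_graded_part by simp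
next
  case True
  then show ?thesis
  proof (induction i rule: int_ge_induct)
    case base
    then show ?case using H_submodule by (simp add: h_one g0_submodule_def)
  next
    case (step i)
    have "h (i + 1) = {D \<in> graded_part (i + 1). \<forall>v\<in>graded_part (-1). contact_bracket D v \<in> h i}"
      using h_step[of "i + 1"] step.hyps by simp
    then show ?case using step.IH subspace_graded_part
      by (auto simp: kfun.subspace_def contact_bracket_add_left contact_bracket_scale_left)
  qed
qed

lemma h_lower:
  assumes "f \<in> h i" "v \<in> graded_part (-1)"
  shows "contact_bracket f v \<in> h (i - 1)"
proof -
  have gr: "contact_bracket f v \<in> graded_part (i - 1)"
    using contact_bracket_graded[OF h_graded[OF assms(1)] assms(2)] by simp
  show ?thesis
  proof (cases "i \<ge> 2")
    case True
    then show ?thesis using assms h_step by auto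
  qed (use gr in \<open>simp add: h_nonpos\<close>)
qed

lemma kone_from_generators: "kone = - contact_bracket (kgen (Xi I1)) (kgen (Eta I1))"
  by (simp add: contact_bracket_kgen agen_def d_gen_kgen)

text \<open>The recursion for prolongs tests only brackets with degree -1. Since 1 is up to sign a
  bracket of two generators, the Jacobi identity turns the bracket with a constant into two such
  steps.\<close>

lemma h_lower_const:
  assumes f: "f \<in> h i" and v: "v \<in> graded_part (-2)"
  shows "contact_bracket f v \<in> h (i - 2)"
proof -
  have low: "contact_bracket (contact_bracket f (kgen x)) (kgen y) \<in> h (i - 2)" for x y
    using h_lower[OF h_lower[OF f kgen_graded] kgen_graded, of x y] by simp
  have "jacobiator (odd i) True f (kgen x) (kgen y) = 0" for x y
    using jacobi_graded[OF h_graded[OF f] kgen_graded kgen_graded] by simp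
  then have *: "contact_bracket f (contact_bracket (kgen x) (kgen y))
      = contact_bracket (contact_bracket f (kgen x)) (kgen y)
        + kscale (koszul_sign (odd i) True) (contact_bracket (kgen x) (contact_bracket f (kgen y)))"
    for x y by (simp add: jacobiator_def algebra_simps)
  have "contact_bracket (kgen x) (contact_bracket f (kgen y))
      = - kscale (koszul_sign True (odd (i - 1))) (contact_bracket (contact_bracket f (kgen y)) (kgen x))"
    for x y
    using contact_bracket_antisym_graded[OF kgen_graded h_graded[OF h_lower[OF f kgen_graded]]]
    by simp
  then have "contact_bracket f (contact_bracket (kgen x) (kgen y)) \<in> h (i - 2)" for x y
    unfolding * by (simp only:) (intro kfun.subspace_add[OF subspace_h] kfun.subspace_neg[OF subspace_h]
      kfun.subspace_scale[OF subspace_h] low)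
  then have "contact_bracket f kone \<in> h (i - 2)"
    unfolding kone_from_generators contact_bracket_minus_right
    by (intro kfun.subspace_neg[OF subspace_h])
  then show ?thesis
    by (subst graded_part_minus_two[OF v])
      (simp add: contact_bracket_scale_right kfun.subspace_scale[OF subspace_h])
qed

lemma h_bracket_swap:
  assumes "contact_bracket g f \<in> h k" "f \<in> graded_part i" "g \<in> graded_part j"
  shows "contact_bracket f g \<in> h k"
  unfolding contact_bracket_antisym_graded[OF assms(2,3)]
  by (intro kfun.subspace_neg[OF subspace_h] kfun.subspace_scale[OF subspace_h] assms(1))

text \<open>In total degree at least 2 membership is tested on degree -1, where the Jacobi identity
  leads to pairs of smaller total degree. In total degree at most 0 the component is
  everything.\<close>

lemma h_bracket: "f \<in> h i \<Longrightarrow> g \<in> h j \<Longrightarrow> contact_bracket f g \<in> h (i + j)"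
proof (induction "nat (i + j)" arbitrary: i j f g rule: less_induct)
  case less
  note f = less.prems(1) and g = less.prems(2)
  note f' = h_graded[OF f] and g' = h_graded[OF g]
  note fg = contact_bracket_graded[OF f' g']
  have 0: "contact_bracket f g \<in> h (i + j)" if "i < -2 \<or> j < -2"
    using that graded_part_low[OF _ f'] graded_part_low[OF _ g'] kfun.subspace_0[OF subspace_h]
    by auto
  \<comment> \<open>Cases 3 to 8 are all the ways of reaching total degree 1 from degrees at least
    -2; there the module property of \<open>H\<close> or the defining condition of the prolong
    applies.\<close>
  consider "i < -2 \<or> j < -2" | "i + j \<le> 0" | "i = -2" "j = 3" | "i = 3" "j = -2"
    | "i = -1" "j = 2" | "i = 2" "j = -1" | "i = 0" "j = 1" | "i = 1" "j = 0" | "i + j \<ge> 2"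
    by linarith
  then show ?case
  proof cases
    case 1
    then show ?thesis by (rule 0)
  next
    case 2
    then show ?thesis using fg h_nonpos by simp
  next
    case 3
    then show ?thesis using h_bracket_swap[OF h_lower_const[OF g] f' g'] f' by simp
  next
    case 4
    then show ?thesis using h_lower_const[OF f] g' by simp
  next
    case 5
    then show ?thesis using h_bracket_swap[OF h_lower[OF g] f' g'] f' by simp
  next
    case 6
    then show ?thesis using h_lower[OF f] g' by simp
  next
    case 7
    then show ?thesis using f' g H_submodule by (simp add: h_one g0_submodule_def)
  next
    case 8
    then have "contact_bracket g f \<in> h 1" using f g' H_submodule by (simp add: h_one g0_submodule_def)
    then show ?thesis using h_bracket_swap[OF _ f' g'] 8 by simp
  next
    case 9
    have "contact_bracket (contact_bracket f g) v \<in> h (i + j - 1)" if v: "v \<in> graded_part (-1)" for v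
    proof -
      have "contact_bracket (contact_bracket f g) v = contact_bracket f (contact_bracket g v)
          - kscale (koszul_sign (odd i) (odd j)) (contact_bracket g (contact_bracket f v))"
        using jacobi_graded[OF f' g' v] by (simp add: jacobiator_def algebra_simps)
      moreover have "contact_bracket f (contact_bracket g v) \<in> h (i + j - 1)"
        using less.hyps[OF _ f h_lower[OF g v]] 9 by (simp add: algebra_simps)
      moreover have "contact_bracket g (contact_bracket f v) \<in> h (i + j - 1)"
        using less.hyps[OF _ g h_lower[OF f v]] 9 by (simp add: algebra_simps)
      ultimately show ?thesis
        by (auto intro!: kfun.subspace_diff[OF subspace_h] kfun.subspace_scale[OF subspace_h])
    qed
    then show ?thesis using fg h_step[OF 9] by simp
  qed
qed

text \<open>The summands have different degrees, so membership in the span can be tested on each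
  component separately.\<close>

lemma V_eq: "V = {f. \<forall>d. hcomp d f \<in> h d}"
proof
  have "kfun.subspace {f. \<forall>d. hcomp d f \<in> h d}"
    using subspace_h by (auto simp: kfun.subspace_def hcomp_add hcomp_scale)
  moreover have "(\<Union>i\<in>{-2..}. h i) \<subseteq> {f. \<forall>d. hcomp d f \<in> h d}"
    using hcomp_graded_part h_graded kfun.subspace_0[OF subspace_h] by fastforce
  ultimately show "V \<subseteq> {f. \<forall>d. hcomp d f \<in> h d}"
    unfolding partial_prolong_def by (intro kfun.span_minimal)
next
  show "{f. \<forall>d. hcomp d f \<in> h d} \<subseteq> V"
  proof
    fix f assume f: "f \<in> {f. \<forall>d. hcomp d f \<in> h d}"
    have "hcomp d f \<in> V" if "d \<ge> -2" for d
      unfolding partial_prolong_def using f that by (intro kfun.span_base) auto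
    then have "(\<Sum>d\<in>{-2..N}. hcomp d f) \<in> V" for N
      unfolding partial_prolong_def by (intro kfun.span_sum) auto
    then show "f \<in> V" using sum_hcomp by metis
  qed
qed

lemma h_le_V: "f \<in> h i \<Longrightarrow> f \<in> V"
  unfolding V_eq using hcomp_graded_part h_graded kfun.subspace_0[OF subspace_h] by fastforce

lemma subspace_V: "kfun.subspace V"
  unfolding partial_prolong_def by (rule kfun.subspace_span)

lemma V_hcomp: "f \<in> V \<Longrightarrow> hcomp d f \<in> h d"
  by (simp add: V_eq)

lemma V_bracket:
  assumes f: "f \<in> V" and g: "g \<in> V"
  shows "contact_bracket f g \<in> V"
proof (rule sum_hcomp_induct[of "\<lambda>f. contact_bracket f g \<in> V"])
  show "contact_bracket (hcomp d f) g \<in> V" for d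
  proof (rule sum_hcomp_induct[of "\<lambda>g. contact_bracket (hcomp d f) g \<in> V"])
    show "contact_bracket (hcomp d f) (hcomp e g) \<in> V" for e
      using h_bracket V_hcomp f g h_le_V by blast
  qed (use kfun.subspace_0[OF subspace_V] kfun.subspace_add[OF subspace_V] in
      \<open>auto simp only: contact_bracket_zero contact_bracket_add_right\<close>)
qed (use kfun.subspace_0[OF subspace_V] kfun.subspace_add[OF subspace_V] in
    \<open>auto simp only: contact_bracket_zero contact_bracket_add_left\<close>)

lemma prolong_parity_bracket:
  assumes f: "f \<in> prolong_parity H p" and g: "g \<in> prolong_parity H q"
  shows "contact_bracket f g \<in> prolong_parity H (p \<noteq> q)"
proof -
  have fp: "hcomp d f \<in> graded_part d \<and> (odd d = p \<or> hcomp d f = 0)"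
    and gp: "hcomp d g \<in> graded_part d \<and> (odd d = q \<or> hcomp d g = 0)" for d
    using f g hcomp_parity_part hcomp_in_graded_part unfolding prolong_parity_def by blast+
  note sub = kfun.subspace_0[OF subspace_parity_part] kfun.subspace_add[OF subspace_parity_part]
  have "contact_bracket f g \<in> parity_part (p \<noteq> q)"
  proof (rule sum_hcomp_induct[of "\<lambda>f. contact_bracket f g \<in> parity_part (p \<noteq> q)"])
    show "contact_bracket (hcomp d f) g \<in> parity_part (p \<noteq> q)" for d
    proof (rule sum_hcomp_induct[of "\<lambda>g. contact_bracket (hcomp d f) g \<in> parity_part (p \<noteq> q)"])
      fix e
      have "contact_bracket (hcomp d f) (hcomp e g) \<in> parity_part (odd (d + e))"
        using fp gp by (intro graded_part_parity_part contact_bracket_graded) auto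
      then show "contact_bracket (hcomp d f) (hcomp e g) \<in> parity_part (p \<noteq> q)"
        using fp[of d] gp[of e] sub(1) by (cases "odd d = p \<and> odd e = q") auto
    qed (use sub in \<open>auto simp only: contact_bracket_zero contact_bracket_add_right\<close>)
  qed (use sub in \<open>auto simp only: contact_bracket_zero contact_bracket_add_left\<close>)
  then show ?thesis using assms V_bracket by (simp add: prolong_parity_def)
qed

lemma jacobiator_add:
  "jacobiator p q (f + f') g k = jacobiator p q f g k + jacobiator p q f' g k"
  "jacobiator p q f (g + g') k = jacobiator p q f g k + jacobiator p q f g' k"
  "jacobiator p q f g (k + k') = jacobiator p q f g k + jacobiator p q f g k'"
  by (simp_all add: jacobiator_def contact_bracket_add_left contact_bracket_add_right
      kfun.scale_right_distrib algebra_simps)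

lemma jacobiator_zero [simp]: "jacobiator p q 0 g k = 0" "jacobiator p q f 0 k = 0" "jacobiator p q f g 0 = 0"
  by (simp_all add: jacobiator_def)

lemma jacobi_parity_part:
  assumes "f \<in> parity_part p" "g \<in> parity_part q"
  shows "jacobiator p q f g k = 0"
proof (rule sum_hcomp_induct[of "\<lambda>f. jacobiator p q f g k = 0"])
  show "jacobiator p q (hcomp a f) g k = 0" for a
  proof (rule sum_hcomp_induct[of "\<lambda>g. jacobiator p q (hcomp a f) g k = 0"])
    show "jacobiator p q (hcomp a f) (hcomp b g) k = 0" for b
    proof (rule sum_hcomp_induct[of "\<lambda>k. jacobiator p q (hcomp a f) (hcomp b g) k = 0"])
      fix c
      have "jacobiator (odd a) (odd b) (hcomp a f) (hcomp b g) (hcomp c k) = 0"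
        by (rule jacobi_graded) (rule hcomp_in_graded_part)+
      then show "jacobiator p q (hcomp a f) (hcomp b g) (hcomp c k) = 0"
        using hcomp_parity_part[OF assms(1), of a] hcomp_parity_part[OF assms(2), of b]
        by (cases "odd a = p \<and> odd b = q") auto
    qed (auto simp only: jacobiator_add jacobiator_zero add_0)
  qed (auto simp only: jacobiator_add jacobiator_zero add_0)
qed (auto simp only: jacobiator_add jacobiator_zero add_0)

lemma prolong_parity_sum: "V = {x + y | x y. x \<in> prolong_parity H False \<and> y \<in> prolong_parity H True}"
proof
  show "V \<subseteq> {x + y | x y. x \<in> prolong_parity H False \<and> y \<in> prolong_parity H True}"
  proof
    fix f assume f: "f \<in> V"
    then have e: "even_comp f \<in> V"
      using kfun.subspace_0[OF subspace_h] by (auto simp: V_eq hcomp_even_comp)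
    then have o: "f - even_comp f \<in> V" using f kfun.subspace_diff[OF subspace_V] by blast
    have "even_comp f \<in> parity_part False" "f - even_comp f \<in> parity_part True"
      by (auto simp: parity_part_def even_comp_def)
    then have "f = even_comp f + (f - even_comp f) \<and> even_comp f \<in> prolong_parity H False
        \<and> f - even_comp f \<in> prolong_parity H True"
      using e o by (simp add: prolong_parity_def)
    then show "f \<in> {x + y | x y. x \<in> prolong_parity H False \<and> y \<in> prolong_parity H True}"
      by blast
  qed
next
  show "{x + y | x y. x \<in> prolong_parity H False \<and> y \<in> prolong_parity H True} \<subseteq> V"
    using kfun.subspace_add[OF subspace_V] by (auto simp: prolong_parity_def)
qed

lemma lie_superalgebra_prolong:
  "lie_superalgebra kscale contact_bracket V (prolong_parity H)"
proof (intro lie_superalgebra.intro lie_superalgebra_axioms.intro kfun.vector_space_axioms)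
  fix p q r :: bool and c x y z
  show "kfun.subspace (prolong_parity H p)"
    unfolding prolong_parity_def by (intro kfun.subspace_inter subspace_V subspace_parity_part)
  show "prolong_parity H False \<inter> prolong_parity H True = {0}"
    using kfun.subspace_0[OF subspace_V]
    by (auto simp: prolong_parity_def parity_part_def fun_eq_iff)
  show "V = {x + y | x y. x \<in> prolong_parity H False \<and> y \<in> prolong_parity H True}"
    by (rule prolong_parity_sum)
  show "contact_bracket (x + y) z = contact_bracket x z + contact_bracket y z"
    by (rule contact_bracket_add_left)
  show "contact_bracket x (y + z) = contact_bracket x y + contact_bracket x z"
    by (rule contact_bracket_add_right)
  show "contact_bracket (kscale c x) y = kscale c (contact_bracket x y)"
    by (rule contact_bracket_scale_left)
  show "contact_bracket x (kscale c y) = kscale c (contact_bracket x y)"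
    by (rule contact_bracket_scale_right)
  assume x: "x \<in> prolong_parity H p" and y: "y \<in> prolong_parity H q"
  then show "contact_bracket x y \<in> prolong_parity H (p \<noteq> q)"
    by (rule prolong_parity_bracket)
  show "contact_bracket x y = - kscale (koszul_sign p q) (contact_bracket y x)"
    using x y by (intro contact_bracket_antisym) (auto simp: prolong_parity_def)
  assume "z \<in> prolong_parity H r"
  then show "contact_bracket x (contact_bracket y z) = contact_bracket (contact_bracket x y) z
      + kscale (koszul_sign p q) (contact_bracket y (contact_bracket x z))"
    using jacobi_parity_part[of x p y q z] x y
    by (simp add: prolong_parity_def jacobiator_def algebra_simps)
qed

section \<open>Simplicity\<close>

lemma kgen_mult_kt_in_H: "kmult (kgen x) kt \<in> H"
proof -
  have "kgen x \<in> Lambda 1" by (auto simp: Lambda_def kgen_def split: if_splits)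
  then show ?thesis using g12_le_H kt_mult_kgen unfolding g12_def by (metis image_subset_iff)
qed

text \<open>The bracket of t^2 with x is -2 x t, an element of \<open>g12\<close>.\<close>

lemma kt2_in_h: "kt2 \<in> h 2"
proof -
  have *: "contact_bracket kt2 (kgen x) = kscale (-2) (kmult (kgen x) kt)" for x
    using contact_bracket_antisym_graded[OF kt2_graded kgen_graded]
    by (simp add: koszul_sign_def contact_bracket_kgen agen_def kmult_scale_right kfun.scale_minus_left)
  have "contact_bracket kt2 (kgen x) \<in> h 1" for x
    unfolding * by (intro kfun.subspace_scale[OF subspace_h]) (simp add: h_one kgen_mult_kt_in_H)
  then have "contact_bracket kt2 (\<Sum>x\<in>UNIV. kscale (c x) (kgen x)) \<in> h 1" for c
    unfolding contact_bracket_sum_right contact_bracket_scale_right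
    by (intro kfun.subspace_sum[OF subspace_h] kfun.subspace_scale[OF subspace_h])
  then have "contact_bracket kt2 v \<in> h 1" if "v \<in> graded_part (-1)" for v
    using graded_part_minus_one[OF that] by metis
  then show ?thesis using h_step[of 2] kt2_graded by simp
qed

text \<open>The drop of the degree by one, stated for single monomials so that it applies to
  inhomogeneous \<open>f\<close>.\<close>

lemma agen_support:
  assumes "coeff (agen x f S) n \<noteq> 0"
  obtains T m where "coeff (f T) m \<noteq> 0" "2 * m + card T = Suc (2 * n + card S)"
proof -
  have "coeff (kmult (kgen x) (d_t f) S) n \<noteq> 0 \<or> coeff (d_gen (bar x) f S) n \<noteq> 0"
    using assms by (auto simp: agen_def)
  then consider "x \<in> S" "coeff (f (S - {x})) (Suc n) \<noteq> 0"
    | "bar x \<notin> S" "coeff (f (insert (bar x) S)) n \<noteq> 0"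
    by (auto simp: kgen_mult_apply d_gen_apply coeff_theta_sign_mult d_t_def coeff_pderiv
        split: if_splits)
  then show ?thesis
  proof cases
    case 1
    moreover have "card S = Suc (card (S - {x}))" using 1(1) by (subst card.remove[of S x]) auto
    ultimately show ?thesis using that[of "S - {x}" "Suc n"] by simp
  next
    case 2
    then show ?thesis using that[of "insert (bar x) S" n] by simp
  qed
qed

text \<open>Descent on a bound \<open>N\<close> for the highest degree in \<open>f\<close>: a
  nonzero \<open>agen x f\<close> lowers it, and when all of them vanish \<open>f\<close> is a
  nonzero constant.\<close>

lemma kone_in_subspace:
  assumes J: "kfun.subspace J" and agen_J: "\<And>x f. f \<in> J \<Longrightarrow> agen x f \<in> J"
    and "f \<in> J" "f \<noteq> 0" and "\<And>S n. coeff (f S) n \<noteq> 0 \<Longrightarrow> 2 * n + card S < N"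
  shows "kone \<in> J"
  using assms(3-5)
proof (induction N arbitrary: f)
  case 0
  then have "f = 0" by (intro ext poly_eqI) auto
  then show ?case using \<open>f \<noteq> 0\<close> by blast
next
  case (Suc N)
  show ?case
  proof (cases "\<exists>x. agen x f \<noteq> 0")
    case True
    then obtain x where x: "agen x f \<noteq> 0" by blast
    have "2 * n + card S < N" if "coeff (agen x f S) n \<noteq> 0" for S n
      using that Suc.prems(3) by (metis Suc_less_eq agen_support)
    then show ?thesis using Suc.IH[OF agen_J[OF Suc.prems(1)] x] by blast
  next
    case False
    then have "f \<in> graded_part (-2)" using agen_eq_0_imp_const by blast
    then obtain c where c: "f = kscale c kone" using graded_part_minus_two by blast
    then have "c \<noteq> 0" using Suc.prems(2) by auto
    then have "kone = kscale (1 / c) f" using c by simp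
    then show ?thesis using kfun.subspace_scale[OF J] Suc.prems(1) by metis
  qed
qed

lemma ideal_eq_V:
  assumes J: "kfun.subspace J" "J \<subseteq> V" and ideal: "\<And>x y. x \<in> V \<Longrightarrow> y \<in> J \<Longrightarrow> contact_bracket x y \<in> J"
    and "J \<noteq> {0}"
  shows "J = V"
proof -
  note J_intros = kfun.subspace_scale[OF J(1)] kfun.subspace_add[OF J(1)] kfun.subspace_sum[OF J(1)]
  have gen_V: "kgen x \<in> V" for x
    using h_le_V[of _ "-1"] kgen_graded by (simp add: h_nonpos)
  have agen_J: "agen x f \<in> J" if "f \<in> J" for x f
    using ideal[OF gen_V that, of x] by (simp add: contact_bracket_kgen)
  obtain f where f: "f \<in> J" "f \<noteq> 0" using \<open>J \<noteq> {0}\<close> kfun.subspace_0[OF J(1)] by blast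
  have "2 * n + card S < Suc (\<Sum>S\<in>UNIV. 2 * degree (f S) + card S)" if "coeff (f S) n \<noteq> 0" for S n
  proof -
    have "2 * n + card S \<le> 2 * degree (f S) + card S" using le_degree that by auto
    also have "\<dots> \<le> (\<Sum>S\<in>UNIV. 2 * degree (f S) + card S)" by (rule member_le_sum) auto
    finally show ?thesis by simp
  qed
  from kone_in_subspace[OF J(1) agen_J f this] have "kone \<in> J" .
  then have "contact_bracket kt2 kone \<in> J" using ideal h_le_V kt2_in_h by blast
  moreover have "contact_bracket kt2 kone = kscale (-4) kt"
    using contact_bracket_antisym_graded[OF kt2_graded kone_graded]
    by (simp add: koszul_sign_def contact_bracket_kone kfun.scale_minus_left)
  ultimately have "kscale (-1/4) (kscale (-4) kt) \<in> J" by (metis J_intros(1))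
  then have kt: "kt \<in> J" by simp
  have nonzero: "f \<in> J" if "f \<in> h d" "d \<noteq> 0" for f d
  proof -
    have "contact_bracket f kt = - kscale (of_int d) f"
      using contact_bracket_antisym_graded[OF h_graded[OF that(1)] kt_graded]
        kt_grading_element[OF h_graded[OF that(1)]] by (simp add: koszul_sign_def)
    then have "kscale (- 1 / of_int d) (- kscale (of_int d) f) \<in> J"
      using ideal[OF h_le_V[OF that(1)] kt] J_intros(1) by metis
    then show ?thesis using that(2) by (simp add: kfun.scale_minus_left)
  qed
  have "kmult (kgen x) (kgen z) \<in> J" for x z
  proof -
    have "kmult (kgen z) kt \<in> J" using nonzero[of _ 1] kgen_mult_kt_in_H by (simp add: h_one)
    \<comment> \<open>The adjoint action of t gives nothing in degree 0. The bracket of x with z t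
      is x z, minus t if z is dual to x; the added term compensates for this and t is already in
      \<open>J\<close>.\<close>
    then have "agen x (kmult (kgen z) kt) + (if bar x = z then kt else 0) \<in> J"
      using agen_J kt kfun.subspace_0[OF J(1)] by (intro J_intros(2)) auto
    moreover have "agen x (kmult (kgen z) kt) + (if bar x = z then kt else 0) = kmult (kgen x) (kgen z)"
      by (simp add: agen_def d_t_kgen_mult d_gen_kgen_mult)
    ultimately show ?thesis by simp
  qed
  then have "kmult (kgen x) (\<Sum>z\<in>UNIV. kscale (c z) (kgen z)) \<in> J" for x c
    unfolding kmult_sum_right kmult_scale_right by (intro J_intros)
  then have products: "kmult (kgen x) (d_gen x D) \<in> J" if "D \<in> graded_part 0" for D x
  proof -
    have "d_gen x D \<in> graded_part (-1)" using d_gen_graded[OF that, of x] by simp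
    define c where "c z = coeff (d_gen x D {z}) 0" for z
    have "d_gen x D = (\<Sum>z\<in>UNIV. kscale (c z) (kgen z))"
      unfolding c_def by (rule graded_part_minus_one) fact
    then show ?thesis using \<open>\<And>x c. kmult (kgen x) (\<Sum>z\<in>UNIV. kscale (c z) (kgen z)) \<in> J\<close> by simp
  qed
  have "D \<in> J" if "D \<in> graded_part 0" for D
    by (subst graded_part_zero_eq[OF that]) (intro J_intros kt products that)
  then have "f \<in> J" if "f \<in> h d" for d f
    using nonzero[OF that] h_nonpos[of d] that by (cases "d = 0") auto
  then have "f \<in> J" if "f \<in> V" for f
    using that V_hcomp J_intros(2) kfun.subspace_0[OF J(1)]
    by (intro sum_hcomp_induct[of "\<lambda>f. f \<in> J" f]) auto
  then show ?thesis using J(2) by blast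
qed

lemma simple_prolong:
  "simple_lie_superalgebra kscale contact_bracket V (prolong_parity H)"
proof -
  interpret L: lie_superalgebra kscale contact_bracket V "prolong_parity H"
    by (rule lie_superalgebra_prolong)
  show ?thesis
  proof unfold_locales
    have "contact_bracket kt kone = kscale (-2) kone"
      using kt_grading_element[OF kone_graded] by simp
    moreover have "kone {} \<noteq> 0" by (simp add: kone_def)
    then have "kscale (-2) kone \<noteq> 0" by (metis kfun.scale_eq_0_iff neg_numeral_neq_zero zero_fun_apply)
    moreover have "kt \<in> V" "kone \<in> V"
      using h_le_V[of _ 0] h_le_V[of _ "-2"] kt_graded kone_graded by (simp_all add: h_nonpos)
    ultimately show "\<not> L.abelian" unfolding L.abelian_def by metis
    show "J = {0} \<or> J = V" if "L.ideal J" for J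
      using that ideal_eq_V[of J] unfolding L.ideal_def by blast
  qed
qed

end

section \<open>The Hodge operator\<close>

text \<open>On the exterior algebra of one dual pair this exchanges \<open>1\<close> with \<open>\<xi>\<^sub>i\<eta>\<^sub>i\<close>, fixes \<open>\<xi>\<^sub>i\<close> and
  negates \<open>\<eta>\<^sub>i\<close>. It is chosen to intertwine multiplication by a generator of the pair with
  minus the derivative by the dual generator.\<close>

definition pair_star :: "idx \<Rightarrow> kfun \<Rightarrow> kfun" where
  "pair_star i f = kmult (kgen (Xi i)) (kmult (kgen (Eta i)) f) + d_gen (Eta i) (d_gen (Xi i) f)
     + kmult (kgen (Xi i)) (d_gen (Xi i) f) - kmult (kgen (Eta i)) (d_gen (Eta i) f)"

text \<open>In each pair odd degree k becomes 2 - k, so in total Lambda^k goes to Lambda^(6-k). In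
  particular cubic forms are mapped to cubic forms.\<close>

definition star :: "kfun \<Rightarrow> kfun" where
  "star f = pair_star I1 (pair_star I2 (pair_star I3 f))"

lemmas clifford_linear = kmult_add_right kmult_minus_right kmult_diff_right
  d_gen_add d_gen_minus d_gen_diff

lemma pair_star_add: "pair_star i (f + g) = pair_star i f + pair_star i g"
  by (simp add: pair_star_def clifford_linear)

lemma pair_star_minus: "pair_star i (- f) = - pair_star i f"
  by (simp add: pair_star_def clifford_linear)

lemma pair_star_diff: "pair_star i (f - g) = pair_star i f - pair_star i g"
  by (simp add: pair_star_def clifford_linear)

lemma pair_star_scale: "pair_star i (kscale c f) = kscale c (pair_star i f)"
  by (simp add: pair_star_def kmult_scale_right d_gen_scale kfun.scale_right_distrib
      kfun.scale_right_diff_distrib)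

lemma pair_star_d_t: "pair_star i (d_t f) = d_t (pair_star i f)"
  by (simp add: pair_star_def d_t_add d_t_diff d_t_kgen_mult d_t_d_gen)

lemma pair_star_kgen_mult:
  "pair_star i (kmult (kgen x) f) =
     (if x = Xi i \<or> x = Eta i then - d_gen (bar x) (pair_star i f)
      else kmult (kgen x) (pair_star i f))"
proof -
  consider "x = Xi i" | "x = Eta i" | "x \<noteq> Xi i" "x \<noteq> Eta i" by blast
  then show ?thesis
    by cases (simp_all add: pair_star_def clifford_linear d_gen_kgen_mult
      kgen_mult_anticomm[of "Eta i" "Xi i"] kgen_mult_anticomm[of x "Xi i"]
      kgen_mult_anticomm[of x "Eta i"] d_gen_anticomm[of "Xi i" "Eta i"])
qed

lemma pair_star_d_gen:
  "pair_star i (d_gen x f) =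
     (if x = Xi i \<or> x = Eta i then - kmult (kgen (bar x)) (pair_star i f)
      else d_gen x (pair_star i f))"
proof -
  consider "x = Xi i" | "x = Eta i" | "x \<noteq> Xi i" "x \<noteq> Eta i" by blast
  then show ?thesis
    by cases (simp_all add: pair_star_def clifford_linear d_gen_kgen_mult
      kgen_mult_anticomm[of "Eta i" "Xi i"] d_gen_anticomm[of "Xi i" "Eta i"]
      d_gen_anticomm[of x "Xi i"] d_gen_anticomm[of x "Eta i"])
qed

lemma pair_star_twice: "pair_star i (pair_star i f) = f"
  by (simp add: pair_star_def clifford_linear d_gen_kgen_mult
      kgen_mult_anticomm[of "Eta i" "Xi i"] d_gen_anticomm[of "Xi i" "Eta i"])

text \<open>Each summand of \<open>pair_star\<close> contains two odd operators of its own pair, so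
  no sign arises when it passes operators of another pair.\<close>

lemma pair_star_commute:
  assumes "i \<noteq> j"
  shows "pair_star i (pair_star j f) = pair_star j (pair_star i f)"
  unfolding pair_star_def[of j]
  using assms
  by (simp add: pair_star_add pair_star_diff pair_star_kgen_mult pair_star_d_gen)

lemma star_kgen_mult: "star (kmult (kgen x) f) = - d_gen (bar x) (star f)"
proof (cases x)
  case (Xi i)
  then show ?thesis
    by (cases i) (simp_all add: star_def pair_star_kgen_mult pair_star_d_gen pair_star_minus)
next
  case (Eta i)
  then show ?thesis
    by (cases i) (simp_all add: star_def pair_star_kgen_mult pair_star_d_gen pair_star_minus)
qed

lemma star_d_gen: "star (d_gen x f) = - kmult (kgen (bar x)) (star f)"
proof (cases x)
  case (Xi i)
  then show ?thesis
    by (cases i) (simp_all add: star_def pair_star_kgen_mult pair_star_d_gen pair_star_minus)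
next
  case (Eta i)
  then show ?thesis
    by (cases i) (simp_all add: star_def pair_star_kgen_mult pair_star_d_gen pair_star_minus)
qed

lemma star_add: "star (f + g) = star f + star g"
  by (simp add: star_def pair_star_add)

lemma star_minus: "star (- f) = - star f"
  by (simp add: star_def pair_star_minus)

lemma star_diff: "star (f - g) = star f - star g"
  by (simp add: star_def pair_star_diff)

lemma star_scale: "star (kscale c f) = kscale c (star f)"
  by (simp add: star_def pair_star_scale)

lemma star_zero [simp]: "star 0 = 0"
  using star_scale[of 0 0] by simp

lemma star_d_t: "star (d_t f) = d_t (star f)"
  by (simp add: star_def pair_star_d_t)

lemma star_star [simp]: "star (star f) = f"
  unfolding star_def
  by (simp add: pair_star_commute[of I3 I1] pair_star_commute[of I3 I2] pair_star_commute[of I2 I1]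
      pair_star_twice)

text \<open>On functions of t alone only the multiplicative summand of each \<open>pair_star\<close>
  survives, so the result is t-dependent times the top form.\<close>

lemma star_of_constants:
  assumes "\<And>x. d_gen x f = 0"
  shows "star f = kmult (kgen (Xi I3)) (kmult (kgen (Eta I3)) (kmult (kgen (Xi I2))
    (kmult (kgen (Eta I2)) (kmult (kgen (Xi I1)) (kmult (kgen (Eta I1)) f)))))"
proof -
  have "pair_star i f = kmult (kgen (Xi i)) (kmult (kgen (Eta i)) f)" for i
    by (simp add: pair_star_def assms)
  then show ?thesis by (simp add: star_def pair_star_kgen_mult)
qed

section \<open>Self-dual cubic forms\<close>

text \<open>\<open>Delta\<close> kills forms of odd degree two, so no t-derivative remains: the
  products x z act as so(6) by linear vector fields in the odd variables.\<close>

lemma contact_bracket_quadratic: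
  "contact_bracket (kmult (kgen x) (kgen z)) f
     = kmult (kgen z) (d_gen (bar x) f) - kmult (kgen x) (d_gen (bar z) f)"
proof -
  have "parity_op (kmult (kgen x) (kgen z)) = kmult (kgen x) (kgen z)"
    using kgen_mult_parity_op[of x "kgen z"] by (simp add: kmult_minus_right)
  then have "(\<Sum>y\<in>UNIV. kmult (d_gen y (parity_op (kmult (kgen x) (kgen z)))) (d_gen (bar y) f))
      = (\<Sum>y\<in>UNIV. (if y = x then kmult (kgen z) (d_gen (bar x) f) else 0)
          - (if y = z then kmult (kgen x) (d_gen (bar z) f) else 0))"
    by (intro sum.cong) (auto simp: d_gen_kgen_mult d_gen_kgen kmult_diff_left kmult_minus_left)
  also have "\<dots> = kmult (kgen z) (d_gen (bar x) f) - kmult (kgen x) (d_gen (bar z) f)"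
    by (simp only: sum_subtractf) (simp add: sum.delta)
  finally show ?thesis
    by (simp add: contact_bracket_eq Delta_kgen_mult d_t_kgen_mult)
qed

lemma g0_submoduleI:
  assumes M: "kfun.subspace M"
    and kt: "\<And>f. f \<in> M \<Longrightarrow> contact_bracket kt f \<in> M"
    and quadratic: "\<And>x z f. f \<in> M \<Longrightarrow> contact_bracket (kmult (kgen x) (kgen z)) f \<in> M"
  shows "g0_submodule M"
  unfolding g0_submodule_def
proof (intro conjI ballI M)
  fix D m assume D: "D \<in> graded_part 0" and m: "m \<in> M"
  note M_intros = kfun.subspace_scale[OF M] kfun.subspace_add[OF M] kfun.subspace_sum[OF M]
  have "contact_bracket (kmult (kgen x) (d_gen x D)) m \<in> M" for x
  proof -
    define c where "c z = coeff (d_gen x D {z}) 0" for z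
    have "d_gen x D \<in> graded_part (-1)" using d_gen_graded[OF D, of x] by simp
    then have *: "d_gen x D = (\<Sum>z\<in>UNIV. kscale (c z) (kgen z))"
      unfolding c_def by (rule graded_part_minus_one)
    show ?thesis
      unfolding * kmult_sum_right kmult_scale_right contact_bracket_sum_left contact_bracket_scale_left
      by (intro M_intros quadratic m)
  qed
  then show "contact_bracket D m \<in> M"
    by (subst graded_part_zero_eq[OF D])
      (simp only: contact_bracket_add_left contact_bracket_scale_left contact_bracket_sum_left,
        intro M_intros kt m)
qed

lemma Lambda_eq: "Lambda k = {f \<in> graded_part (int k - 2). d_t f = 0}"
proof (intro equalityI subsetI)
  fix f assume f: "f \<in> Lambda k"
  then have "pderiv (f S) = 0" for S
    by (intro poly_eqI) (force simp: Lambda_def coeff_pderiv)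
  then have "d_t f = 0" by (auto simp: d_t_def)
  then show "f \<in> {f \<in> graded_part (int k - 2). d_t f = 0}"
    using f by (auto simp: Lambda_def graded_part_def)
next
  fix f assume f: "f \<in> {f \<in> graded_part (int k - 2). d_t f = 0}"
  then have "d_t f S = 0" for S by simp
  then have "pderiv (f S) = 0" for S by (simp add: d_t_def)
  then have "degree (f S) = 0" for S by (simp add: pderiv_eq_0_iff)
  then have "coeff (f S) n \<noteq> 0 \<Longrightarrow> n = 0" for S n using le_degree by (metis le_zero_eq)
  then show "f \<in> Lambda k"
    using f graded_partD[of f "int k - 2"] by (fastforce simp: Lambda_def)
qed

lemma subspace_Lambda: "kfun.subspace (Lambda k)"
  using subspace_graded_part unfolding Lambda_eq
  by (auto simp: kfun.subspace_def d_t_add d_t_scale)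

lemma Lambda_graded: "f \<in> Lambda k \<Longrightarrow> f \<in> graded_part (int k - 2)"
  by (simp add: Lambda_eq)

lemma quadratic_graded:
  "f \<in> graded_part d \<Longrightarrow> contact_bracket (kmult (kgen x) (kgen z)) f \<in> graded_part d"
  using contact_bracket_graded[OF kmult_graded[OF kgen_graded kgen_graded], of f d x z] by simp

lemma quadratic_Lambda:
  "f \<in> Lambda k \<Longrightarrow> contact_bracket (kmult (kgen x) (kgen z)) f \<in> Lambda k"
  using quadratic_graded[of f "int k - 2" x z]
  by (simp add: Lambda_eq contact_bracket_quadratic d_t_diff d_t_kgen_mult d_t_d_gen)

definition self_dual_cubics :: "kfun set" where
  "self_dual_cubics = {f \<in> Lambda 3. star f = f}"

lemma subspace_self_dual_cubics: "kfun.subspace self_dual_cubics"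
  using subspace_Lambda unfolding self_dual_cubics_def
  by (auto simp: kfun.subspace_def star_add star_scale)

lemma self_dual_cubics_graded: "f \<in> self_dual_cubics \<Longrightarrow> f \<in> graded_part 1"
  using Lambda_graded[of f 3] by (simp add: self_dual_cubics_def)

text \<open>\<open>star\<close> carries each of the two terms of
  \<open>contact_bracket_quadratic\<close> to the other, and the two Kronecker terms cancel; hence
  it commutes with the action.\<close>

lemma self_dual_cubics_submodule: "g0_submodule self_dual_cubics"
proof (rule g0_submoduleI[OF subspace_self_dual_cubics])
  fix f assume f: "f \<in> self_dual_cubics"
  then show "contact_bracket kt f \<in> self_dual_cubics"
    using kt_grading_element[OF self_dual_cubics_graded[OF f]] by simp
  fix x z
  have "star f = f" "f \<in> Lambda 3" using f by (auto simp: self_dual_cubics_def)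
  then show "contact_bracket (kmult (kgen x) (kgen z)) f \<in> self_dual_cubics"
    using quadratic_Lambda[of f 3 x z] unfolding self_dual_cubics_def
    by (auto simp: contact_bracket_quadratic star_diff star_kgen_mult star_d_gen clifford_linear
        d_gen_kgen_mult)
qed

lemma g12_eq: "g12 = kmult kt ` graded_part (-1)"
proof -
  have "d_t f = 0" if "f \<in> graded_part (-1)" for f
    using d_t_graded[OF that] graded_part_low[of "-3"] by simp
  then have "Lambda 1 = graded_part (-1)" by (auto simp: Lambda_eq)
  then show ?thesis by (simp add: g12_def)
qed

lemma g12_graded: "f \<in> g12 \<Longrightarrow> f \<in> graded_part 1"
  using kmult_graded[OF kt_graded, of _ "-1"] by (auto simp: g12_eq)

lemma kmult_kt_kgen_mult: "kmult kt (kmult (kgen x) f) = kmult (kgen x) (kmult kt f)"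
  by (simp add: kmult_kgen_mult)

lemma kmult_kt_d_gen: "kmult kt (d_gen x f) = d_gen x (kmult kt f)"
  by (simp add: d_gen_kmult)

text \<open>Multiplication by t commutes with the action of x z, so stability is inherited from
  degree -1.\<close>

lemma g12_submodule: "g0_submodule g12"
proof (rule g0_submoduleI)
  show "kfun.subspace g12"
  proof (rule kfun.subspaceI)
    show "0 \<in> g12" unfolding g12_eq by (rule image_eqI[of _ _ 0]) auto
  qed (auto simp: g12_eq graded_part_add graded_part_scale
      simp flip: kmult_add_right kmult_scale_right)
  fix f assume f: "f \<in> g12"
  then show "contact_bracket kt f \<in> g12"
    using kt_grading_element[OF g12_graded[OF f]] by simp
  fix x z
  obtain v where v: "f = kmult kt v" "v \<in> graded_part (-1)" using f by (auto simp: g12_eq)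
  have "contact_bracket (kmult (kgen x) (kgen z)) f
      = kmult kt (contact_bracket (kmult (kgen x) (kgen z)) v)"
    by (simp add: v(1) contact_bracket_quadratic kmult_diff_right kmult_kt_kgen_mult kmult_kt_d_gen)
  then show "contact_bracket (kmult (kgen x) (kgen z)) f \<in> g12"
    using quadratic_graded[OF v(2)] by (simp add: g12_eq)
qed

lemma sum_space_submodule:
  assumes "g0_submodule A" "g0_submodule B"
  shows "g0_submodule (sum_space A B)"
proof -
  have "sum_space A B = {x + y | x y. x \<in> A \<and> y \<in> B}" by (simp add: sum_space_def)
  then have "kfun.subspace (sum_space A B)"
    using assms kfun.subspace_sums[of A B] by (simp add: g0_submodule_def)
  moreover have "contact_bracket D m \<in> sum_space A B"
    if D: "D \<in> graded_part 0" and "m \<in> sum_space A B" for D m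
  proof -
    from that obtain a b where "m = a + b" "a \<in> A" "b \<in> B" by (auto simp: sum_space_def)
    moreover from this have "contact_bracket D a \<in> A" "contact_bracket D b \<in> B"
      using D assms by (auto simp: g0_submodule_def)
    ultimately show ?thesis unfolding sum_space_def
      by (auto simp: contact_bracket_add_right)
  qed
  ultimately show ?thesis by (simp add: g0_submodule_def)
qed

lemma g1_submodule_self_dual: "g1_submodule (sum_space self_dual_cubics g12)"
proof
  show "sum_space self_dual_cubics g12 \<subseteq> graded_part 1"
    using self_dual_cubics_graded g12_graded graded_part_add by (auto simp: sum_space_def)
  show "g0_submodule (sum_space self_dual_cubics g12)"
    by (intro sum_space_submodule self_dual_cubics_submodule g12_submodule)
  have "0 \<in> self_dual_cubics" by (rule kfun.subspace_0[OF subspace_self_dual_cubics])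
  then show "g12 \<subseteq> sum_space self_dual_cubics g12"
    unfolding sum_space_def by (metis (mono_tags, lifting) add_0 mem_Collect_eq subsetI)
qed

section \<open>Irreducibility of the self-dual cubic forms\<close>

text \<open>The trailing \<open>kone\<close> writes a word as three left multiplications applied to
  1, so the rules for \<open>kmult (kgen x) f\<close> also treat its last letter.\<close>

abbreviation cubic :: "gen \<Rightarrow> gen \<Rightarrow> gen \<Rightarrow> kfun" where
  "cubic x y z \<equiv> kmult (kgen x) (kmult (kgen y) (kmult (kgen z) kone))"

text \<open>Weight vectors of the symmetric square of \<open>\<complex>\<^sup>4\<close>, in the order
  11, 12, 22, 23, 33, 34, 44, 24, 14, 13, such that neighbours (cyclically) differ by a root.\<close>

definition sd_basis :: "kfun list" where
  "sd_basis =
    [cubic (Xi I1) (Xi I2) (Xi I3),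
     cubic (Xi I1) (Xi I2) (Eta I2) + cubic (Xi I1) (Xi I3) (Eta I3),
     cubic (Xi I1) (Eta I2) (Eta I3),
     cubic (Eta I3) (Xi I1) (Eta I1) - cubic (Eta I3) (Xi I2) (Eta I2),
     cubic (Eta I1) (Xi I2) (Eta I3),
     cubic (Eta I1) (Xi I2) (Eta I2) - cubic (Eta I1) (Xi I3) (Eta I3),
     cubic (Eta I1) (Eta I2) (Xi I3),
     cubic (Eta I2) (Xi I1) (Eta I1) - cubic (Eta I2) (Xi I3) (Eta I3),
     cubic (Xi I3) (Xi I1) (Eta I1) + cubic (Xi I3) (Xi I2) (Eta I2),
     cubic (Xi I2) (Xi I1) (Eta I1) + cubic (Xi I2) (Xi I3) (Eta I3)]"

text \<open>Under \<open>cartan_element\<close> the weights of xi_1, xi_2, xi_3 are -1, -3, -9 and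
  those of the eta_i are opposite; each entry is the sum over one monomial of the basis
  vector.\<close>

definition sd_weight :: "complex list" where
  "sd_weight = [-13, -1, 11, 9, 7, 1, -5, 3, -9, -3]"

text \<open>The product of the pair at position k is a root vector for the difference between weight
  k + 1 and weight k, taken cyclically.\<close>

definition sd_root :: "(gen \<times> gen) list" where
  "sd_root = [(Eta I2, Eta I3), (Eta I2, Eta I3), (Eta I1, Xi I2), (Eta I1, Xi I2), (Eta I2, Xi I3),
     (Eta I2, Xi I3), (Xi I1, Eta I3), (Xi I2, Xi I3), (Xi I2, Eta I3), (Xi I1, Xi I3)]"

definition sd_step :: "complex list" where
  "sd_step = [-1, -2, -1, -2, -1, -2, -1, 1, -1, -2]"

text \<open>The coefficients 1, 3, 9 make the ten weights distinct; they are listed in \<open>sd_weight\<close>.\<close>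

definition cartan_element :: kfun where
  "cartan_element = kmult (kgen (Xi I1)) (kgen (Eta I1))
     + kscale 3 (kmult (kgen (Xi I2)) (kgen (Eta I2)))
     + kscale 9 (kmult (kgen (Xi I3)) (kgen (Eta I3)))"

text \<open>The order condition makes anticommutation a terminating rewrite rule that sorts
  words.\<close>

lemma kgen_mult_sort:
  "gen_pos y < gen_pos x \<Longrightarrow> kmult (kgen x) (kmult (kgen y) f) = - kmult (kgen y) (kmult (kgen x) f)"
  by (rule kgen_mult_anticomm)

lemma all_less_ten:
  "(\<forall>k<10. P k) \<longleftrightarrow> P 0 \<and> P 1 \<and> P 2 \<and> P 3 \<and> P 4 \<and> P 5 \<and> P 6 \<and> P 7 \<and> P 8 \<and> P (9::nat)"
  by (simp add: eval_nat_numeral All_less_Suc) blast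

lemma kscale_two: "kscale 2 f = 2 * f"
  by (rule ext) (simp add: kscale_def smult_two)

lemmas word_simps = kgen_mult_sort d_gen_kgen_mult clifford_linear

lemma sd_basis_step: "\<forall>k<10. contact_bracket
    (kmult (kgen (fst (sd_root ! k))) (kgen (snd (sd_root ! k)))) (sd_basis ! k)
    = kscale (sd_step ! k) (sd_basis ! (Suc k mod 10))"
  unfolding all_less_ten contact_bracket_quadratic
  by (simp add: sd_root_def sd_basis_def sd_step_def word_simps kscale_two del: mult_kone)

text \<open>Passing to the pointwise ring product lets arithmetic simplification collect equal
  words.\<close>

lemma kfun_scale_numeral: "kscale (numeral k) f = numeral k * f"
  by (rule ext, rule poly_eqI) (simp add: kscale_def numeral_poly)

lemma sd_basis_weight: "\<forall>k<10. contact_bracket cartan_element (sd_basis ! k)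
    = kscale (sd_weight ! k) (sd_basis ! k)"
  unfolding all_less_ten cartan_element_def contact_bracket_add_left contact_bracket_scale_left
    contact_bracket_quadratic
  by (simp add: sd_basis_def sd_weight_def word_simps kfun_scale_numeral
      kfun.scale_right_distrib kfun.scale_right_diff_distrib kfun.scale_minus_left
      distrib_left right_diff_distrib del: mult_kone)

lemma star_kone: "star kone = kmult (kgen (Xi I3)) (kmult (kgen (Eta I3)) (kmult (kgen (Xi I2))
    (kmult (kgen (Eta I2)) (kmult (kgen (Xi I1)) (kmult (kgen (Eta I1)) kone)))))"
  by (rule star_of_constants) simp

text \<open>\<open>star\<close> turns the three letters of a word into three derivatives of the top
  form \<open>star kone\<close>, which again leaves a cubic word.\<close>

lemma sd_basis_self_dual: "\<forall>k<10. sd_basis ! k \<in> self_dual_cubics"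
proof -
  have "cubic x y z \<in> Lambda 3" for x y z
    using kgen_mult_graded[OF kgen_mult_graded[OF kgen_mult_graded[OF kone_graded]], of x y z]
    by (simp add: Lambda_eq d_t_kgen_mult)
  then have "\<forall>k<10. sd_basis ! k \<in> Lambda 3"
    unfolding all_less_ten by (simp add: sd_basis_def kfun.subspace_add[OF subspace_Lambda]
      kfun.subspace_diff[OF subspace_Lambda] del: mult_kone)
  moreover have "\<forall>k<10. star (sd_basis ! k) = sd_basis ! k"
    unfolding all_less_ten
    by (simp add: sd_basis_def word_simps star_add star_diff star_kgen_mult star_minus star_kone
        del: mult_kone)
  ultimately show ?thesis by (simp add: self_dual_cubics_def)
qed

text \<open>The coefficients are indexed by list position, the form in which
  \<open>eigen_component\<close> separates the summands.\<close>

definition sd_span :: "kfun set" where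
  "sd_span = range (\<lambda>c. \<Sum>k<10. kscale (c k) (sd_basis ! k))"

lemma subspace_sd_span: "kfun.subspace sd_span"
proof (rule kfun.subspaceI)
  show "0 \<in> sd_span" unfolding sd_span_def by (rule range_eqI[of _ _ "\<lambda>_. 0"]) simp
  fix f g assume "f \<in> sd_span" "g \<in> sd_span"
  then obtain c c' where "f = (\<Sum>k<10. kscale (c k) (sd_basis ! k))"
    "g = (\<Sum>k<10. kscale (c' k) (sd_basis ! k))" by (auto simp: sd_span_def)
  then show "f + g \<in> sd_span" unfolding sd_span_def
    by (intro range_eqI[of _ _ "\<lambda>k. c k + c' k"])
      (simp add: kfun.scale_left_distrib sum.distrib)
next
  fix a f assume "f \<in> sd_span"
  then obtain c where "f = (\<Sum>k<10. kscale (c k) (sd_basis ! k))" by (auto simp: sd_span_def)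
  then show "kscale a f \<in> sd_span" unfolding sd_span_def
    by (intro range_eqI[of _ _ "\<lambda>k. a * c k"]) (simp add: kfun.scale_sum_right)
qed

lemma sd_basis_in_span: "k < 10 \<Longrightarrow> sd_basis ! k \<in> sd_span"
proof -
  assume k: "k < 10"
  have "(\<Sum>i<10. kscale (if i = k then 1 else 0) (sd_basis ! i))
      = (\<Sum>i<10. if i = k then sd_basis ! k else 0)"
    by (rule sum.cong) auto
  also have "\<dots> = sd_basis ! k" using k by (subst sum.delta) auto
  finally show ?thesis unfolding sd_span_def by (intro range_eqI) (rule sym)
qed

text \<open>Twice the projection onto the forms fixed by the involution \<open>star\<close>.\<close>

definition symmetrize :: "kfun \<Rightarrow> kfun" where
  "symmetrize f = f + star f"

lemma symmetrize_linear:
  "symmetrize (f + g) = symmetrize f + symmetrize g"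
  "symmetrize (- f) = - symmetrize f"
  "symmetrize (kscale c f) = kscale c (symmetrize f)"
  "symmetrize 0 = 0"
  by (simp_all add: symmetrize_def star_add star_minus star_scale kfun.scale_right_distrib)

text \<open>These are the 20 sorted words. The eight with one letter from each pair are eigenvectors
  of \<open>star\<close>: fixed if the number of eta_i is even, negated if it is odd. The other
  twelve are exchanged in couples up to sign, each couple giving one basis vector, so 4 + 6 =
  10.\<close>

lemma symmetrize_sorted_cubic:
  "symmetrize (cubic (Xi I1) (Xi I2) (Xi I3)) = kscale 2 (sd_basis ! 0)"
  "symmetrize (cubic (Xi I1) (Xi I2) (Eta I1)) = kscale (-1) (sd_basis ! 9)"
  "symmetrize (cubic (Xi I1) (Xi I2) (Eta I2)) = kscale 1 (sd_basis ! 1)"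
  "symmetrize (cubic (Xi I1) (Xi I2) (Eta I3)) = 0"
  "symmetrize (cubic (Xi I1) (Xi I3) (Eta I1)) = kscale (-1) (sd_basis ! 8)"
  "symmetrize (cubic (Xi I1) (Xi I3) (Eta I2)) = 0"
  "symmetrize (cubic (Xi I1) (Xi I3) (Eta I3)) = kscale 1 (sd_basis ! 1)"
  "symmetrize (cubic (Xi I1) (Eta I1) (Eta I2)) = kscale 1 (sd_basis ! 7)"
  "symmetrize (cubic (Xi I1) (Eta I1) (Eta I3)) = kscale 1 (sd_basis ! 3)"
  "symmetrize (cubic (Xi I1) (Eta I2) (Eta I3)) = kscale 2 (sd_basis ! 2)"
  "symmetrize (cubic (Xi I2) (Xi I3) (Eta I1)) = 0"
  "symmetrize (cubic (Xi I2) (Xi I3) (Eta I2)) = kscale (-1) (sd_basis ! 8)"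
  "symmetrize (cubic (Xi I2) (Xi I3) (Eta I3)) = kscale 1 (sd_basis ! 9)"
  "symmetrize (cubic (Xi I2) (Eta I1) (Eta I2)) = kscale (-1) (sd_basis ! 5)"
  "symmetrize (cubic (Xi I2) (Eta I1) (Eta I3)) = kscale (-2) (sd_basis ! 4)"
  "symmetrize (cubic (Xi I2) (Eta I2) (Eta I3)) = kscale (-1) (sd_basis ! 3)"
  "symmetrize (cubic (Xi I3) (Eta I1) (Eta I2)) = kscale 2 (sd_basis ! 6)"
  "symmetrize (cubic (Xi I3) (Eta I1) (Eta I3)) = kscale 1 (sd_basis ! 5)"
  "symmetrize (cubic (Xi I3) (Eta I2) (Eta I3)) = kscale 1 (sd_basis ! 7)"
  "symmetrize (cubic (Eta I1) (Eta I2) (Eta I3)) = 0"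
  by (simp_all add: symmetrize_def sd_basis_def word_simps star_kgen_mult star_minus star_kone
      kscale_two kfun.scale_minus_left algebra_simps del: mult_kone)

lemma all_gen: "(\<forall>x. P x) \<longleftrightarrow> P (Xi I1) \<and> P (Xi I2) \<and> P (Xi I3)
    \<and> P (Eta I1) \<and> P (Eta I2) \<and> P (Eta I3)"
proof -
  have "(\<forall>x. P x) \<longleftrightarrow> (\<forall>x\<in>UNIV. P x)" by simp
  then show ?thesis unfolding UNIV_gen UNIV_idx by auto
qed

lemma symmetrize_cubic: "symmetrize (cubic x y z) \<in> sd_span"
proof -
  have neg: "- f \<in> sd_span \<longleftrightarrow> f \<in> sd_span" for f
    using kfun.subspace_neg[OF subspace_sd_span] by (metis add.inverse_inverse)
  note in_span = kfun.subspace_scale[OF subspace_sd_span] kfun.subspace_0[OF subspace_sd_span]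
    sd_basis_in_span neg
  have "\<forall>x y z. symmetrize (cubic x y z) \<in> sd_span"
    unfolding all_gen
    by (simp add: kgen_mult_sort kmult_minus_right symmetrize_linear symmetrize_sorted_cubic in_span
        del: mult_kone)
  then show ?thesis by blast
qed

lemma Lambda_card: "f \<in> Lambda k \<Longrightarrow> f S \<noteq> 0 \<Longrightarrow> card S = k"
  unfolding Lambda_def by (metis (mono_tags, lifting) leading_coeff_0_iff mem_Collect_eq)

text \<open>By Euler's identity a form of degree k + 1 is the sum of the x d_x f divided by k + 1,
  hence a combination of products of a generator with a form of degree k.\<close>

lemma Lambda_kgen_mult_induct:
  assumes U: "kfun.subspace U" and step: "\<And>x g. g \<in> Lambda k \<Longrightarrow> kmult (kgen x) g \<in> U"
    and f: "f \<in> Lambda (Suc k)"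
  shows "f \<in> U"
proof -
  have "d_gen x f \<in> Lambda k" for x
    using f d_gen_graded[of f "int (Suc k) - 2" x] by (simp add: Lambda_eq d_t_d_gen)
  then have "kscale (1 / of_nat (Suc k)) (euler f) \<in> U"
    unfolding euler_eq by (intro kfun.subspace_scale[OF U] kfun.subspace_sum[OF U] step)
  moreover have "kscale (1 / of_nat (Suc k)) (euler f) = f"
  proof (rule ext)
    fix S
    show "kscale (1 / of_nat (Suc k)) (euler f) S = f S"
      using Lambda_card[OF f, of S]
      by (cases "f S = 0") (simp_all add: kscale_def euler_apply of_nat_poly del: of_nat_Suc)
  qed
  ultimately show ?thesis by simp
qed

lemma symmetrize_Lambda: "f \<in> Lambda 3 \<Longrightarrow> symmetrize f \<in> sd_span"
proof -
  let ?U = "{f. symmetrize f \<in> sd_span}"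
  have U: "kfun.subspace ?U"
    using subspace_sd_span by (auto simp: kfun.subspace_def symmetrize_linear)
  \<comment> \<open>Preimages under left multiplication allow the letters to be peeled off one at a
    time.\<close>
  have U': "kfun.subspace {g. kmult (kgen x) g \<in> A}" if "kfun.subspace A" for x A
    using that by (auto simp: kfun.subspace_def kmult_add_right kmult_scale_right)
  have 0: "g \<in> A" if "kfun.subspace A" "kone \<in> A" "g \<in> Lambda 0" for g A
    using graded_part_minus_two[of g] Lambda_graded[OF that(3)] kfun.subspace_scale[OF that(1,2)]
    by (metis of_nat_0 diff_0)
  have 1: "g \<in> A" if "kfun.subspace A" "\<And>z. kmult (kgen z) kone \<in> A" "g \<in> Lambda 1" for g A
    using Lambda_kgen_mult_induct[of A 0 g] 0[OF U'[OF that(1)]] that by simp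
  have 2: "g \<in> A" if "kfun.subspace A" "\<And>y z. kmult (kgen y) (kmult (kgen z) kone) \<in> A" "g \<in> Lambda 2"
    for g A
    using Lambda_kgen_mult_induct[of A 1 g] 1[OF U'[OF that(1)]] that by (simp add: numeral_2_eq_2)
  assume "f \<in> Lambda 3"
  then have "f \<in> ?U"
    using Lambda_kgen_mult_induct[of ?U 2 f] 2[OF U'[OF U]] U symmetrize_cubic
    by (simp add: numeral_3_eq_3 numeral_2_eq_2)
  then show "symmetrize f \<in> sd_span" by simp
qed

lemma self_dual_cubics_le_span: "self_dual_cubics \<subseteq> sd_span"
proof
  fix f assume f: "f \<in> self_dual_cubics"
  then have "symmetrize f \<in> sd_span" by (simp add: self_dual_cubics_def symmetrize_Lambda)
  then have "kscale (1/2) (symmetrize f) \<in> sd_span"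
    by (rule kfun.subspace_scale[OF subspace_sd_span])
  moreover have "symmetrize f = kscale 2 f"
    using f by (simp add: self_dual_cubics_def symmetrize_def kscale_two)
  ultimately show "f \<in> sd_span" by simp
qed

text \<open>Applying T - lam j deletes the summand j and multiplies each other one by lam i - lam j,
  which is nonzero. The induction thus isolates the others, and subtracting them recovers the
  summand j.\<close>

lemma eigen_component:
  fixes w :: "nat \<Rightarrow> kfun"
  assumes N: "kfun.subspace N" and T_N: "\<And>f. f \<in> N \<Longrightarrow> T f \<in> N"
    and T_sum: "\<And>I F :: nat \<Rightarrow> kfun. T (\<Sum>i\<in>I. F i) = (\<Sum>i\<in>I. T (F i))"
    and T_scale: "\<And>c f. T (kscale c f) = kscale c (T f)"
    and "finite I" "inj_on lam I" "\<And>i. i \<in> I \<Longrightarrow> T (w i) = kscale (lam i) (w i)"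
    and "(\<Sum>i\<in>I. kscale (c i) (w i)) \<in> N" "k \<in> I"
  shows "kscale (c k) (w k) \<in> N"
  using assms(5-)
proof (induction I arbitrary: c k rule: finite_induct)
  case empty
  then show ?case by blast
next
  case (insert j I)
  define f where "f = (\<Sum>i\<in>insert j I. kscale (c i) (w i))"
  have f_N: "f \<in> N" using insert.prems(3) unfolding f_def .
  have f_eq: "f = kscale (c j) (w j) + (\<Sum>i\<in>I. kscale (c i) (w i))"
    unfolding f_def by (rule sum.insert) (use insert.hyps in auto)
  have "T f = (\<Sum>i\<in>insert j I. kscale (lam i * c i) (w i))"
    unfolding f_def T_sum T_scale
    by (rule sum.cong) (use insert.prems(2) in \<open>auto simp: mult.commute\<close>)
  also have "\<dots> = kscale (lam j * c j) (w j) + (\<Sum>i\<in>I. kscale (lam i * c i) (w i))"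
    by (rule sum.insert) (use insert.hyps in auto)
  finally have "T f - kscale (lam j) f = (\<Sum>i\<in>I. kscale ((lam i - lam j) * c i) (w i))"
    unfolding f_eq
    by (simp add: kfun.scale_right_distrib kfun.scale_sum_right left_diff_distrib
        kfun.scale_left_diff_distrib sum_subtractf)
  moreover have "T f - kscale (lam j) f \<in> N"
    by (intro kfun.subspace_diff[OF N] kfun.subspace_scale[OF N] T_N f_N)
  ultimately have "kscale ((lam i - lam j) * c i) (w i) \<in> N" if "i \<in> I" for i
    using insert.IH[of "\<lambda>i. (lam i - lam j) * c i" i] insert.prems(1,2) that by (simp add: inj_on_insert)
  then have "kscale (1 / (lam i - lam j)) (kscale ((lam i - lam j) * c i) (w i)) \<in> N" if "i \<in> I" for i
    using kfun.subspace_scale[OF N] that by blast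
  moreover have "lam i \<noteq> lam j" if "i \<in> I" for i
    using insert.prems(1) insert.hyps(2) that by (auto simp: inj_on_def)
  ultimately have I: "kscale (c i) (w i) \<in> N" if "i \<in> I" for i using that by fastforce
  have "f - (\<Sum>i\<in>I. kscale (c i) (w i)) \<in> N"
    by (intro kfun.subspace_diff[OF N] kfun.subspace_sum[OF N] f_N I)
  then have "kscale (c j) (w j) \<in> N" unfolding f_eq by simp
  then show ?case using I insert.prems(4) by blast
qed

lemma cartan_element_graded: "cartan_element \<in> graded_part 0"
  using kmult_graded[OF kgen_graded kgen_graded]
  unfolding cartan_element_def by (intro graded_part_add graded_part_scale) simp_all

lemma self_dual_cubics_le_submodule:
  assumes "g0_submodule N" "N \<subseteq> self_dual_cubics" "N \<noteq> {0}"
  shows "self_dual_cubics \<subseteq> N"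
proof -
  have N: "kfun.subspace N" and N_g0: "\<And>D m. D \<in> graded_part 0 \<Longrightarrow> m \<in> N \<Longrightarrow> contact_bracket D m \<in> N"
    using assms(1) by (auto simp: g0_submodule_def)
  obtain f where f: "f \<in> N" "f \<noteq> 0" using assms(3) kfun.subspace_0[OF N] by blast
  then obtain c where c: "f = (\<Sum>k<10. kscale (c k) (sd_basis ! k))"
    using assms(2) self_dual_cubics_le_span by (auto simp: sd_span_def)
  have "\<exists>k<10. c k \<noteq> 0"
  proof (rule ccontr)
    assume "\<not> (\<exists>k<10. c k \<noteq> 0)"
    then have "f = 0" unfolding c by (intro sum.neutral) auto
    then show False using f(2) by blast
  qed
  then obtain k where k: "k < 10" "c k \<noteq> 0" by blast
  have "distinct sd_weight" by (simp add: sd_weight_def)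
  moreover have "length sd_weight = 10" by (simp add: sd_weight_def)
  ultimately have "inj_on ((!) sd_weight) {..<10}"
    by (intro inj_on_nth) auto
  then have "kscale (c k) (sd_basis ! k) \<in> N"
    using f(1) k sd_basis_weight unfolding c
    by (intro eigen_component[where T = "contact_bracket cartan_element" and I = "{..<10}"
          and lam = "(!) sd_weight" and w = "(!) sd_basis" and c = c])
      (auto simp: N N_g0 cartan_element_graded contact_bracket_sum_right contact_bracket_scale_right)
  then have "kscale (1 / c k) (kscale (c k) (sd_basis ! k)) \<in> N"
    by (rule kfun.subspace_scale[OF N])
  then have basis_k: "sd_basis ! k \<in> N" using k by simp
  have step_nonzero: "\<forall>k<10. sd_step ! k \<noteq> 0"
    unfolding all_less_ten by (simp add: sd_step_def)
  have step: "sd_basis ! (Suc j mod 10) \<in> N" if "j < 10" "sd_basis ! j \<in> N" for j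
  proof -
    have "kmult (kgen x) (kgen y) \<in> graded_part 0" for x y
      using kmult_graded[OF kgen_graded kgen_graded, of x y] by simp
    then have "kscale (sd_step ! j) (sd_basis ! (Suc j mod 10)) \<in> N"
      using N_g0[OF _ that(2)] sd_basis_step that(1) by metis
    then have "kscale (1 / sd_step ! j) (kscale (sd_step ! j) (sd_basis ! (Suc j mod 10))) \<in> N"
      by (rule kfun.subspace_scale[OF N])
    then show ?thesis using step_nonzero that(1) by simp
  qed
  have "sd_basis ! ((k + m) mod 10) \<in> N" for m
  proof (induction m)
    case 0
    then show ?case using basis_k k(1) by simp
  next
    case (Suc m)
    then show ?case using step[of "(k + m) mod 10"] by (simp add: mod_Suc_eq)
  qed
  \<comment> \<open>Going once around the cycle past position 0 leads from k to j.\<close>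
  from this[of "10 - k + j" for j] have "sd_basis ! j \<in> N" if "j < 10" for j
    using k(1) that by (metis (no_types, lifting) add.assoc le_add_diff_inverse less_imp_le_nat mod_add_self1 mod_less)
  then have "sd_span \<subseteq> N"
    unfolding sd_span_def by (auto intro!: kfun.subspace_sum[OF N] kfun.subspace_scale[OF N])
  then show ?thesis using self_dual_cubics_le_span by blast
qed

lemma xi_cubed_eq: "xi_cubed = sd_basis ! 0"
  by (simp add: xi_cubed_def sd_basis_def)

lemma xi_cubed_nonzero: "xi_cubed \<noteq> 0"
proof
  assume "xi_cubed = 0"
  then have "d_gen (Xi I3) (d_gen (Xi I2) (d_gen (Xi I1) xi_cubed)) = 0" by simp
  moreover have "d_gen (Xi I3) (d_gen (Xi I2) (d_gen (Xi I1) xi_cubed)) = kone"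
    by (simp add: xi_cubed_def d_gen_kgen_mult d_gen_kgen clifford_linear)
  moreover have "kone {} \<noteq> 0" by (simp add: kone_def)
  ultimately show False by (metis zero_fun_apply)
qed

lemma xi_cubed_self_dual: "xi_cubed \<in> self_dual_cubics"
  using sd_basis_self_dual by (simp add: xi_cubed_eq)

lemma irreducible_self_dual_cubics: "irreducible_g0_submodule self_dual_cubics"
  using self_dual_cubics_submodule self_dual_cubics_le_submodule xi_cubed_self_dual xi_cubed_nonzero
  unfolding irreducible_g0_submodule_def by blast

lemma irreducible_unique:
  assumes "irreducible_g0_submodule A" "irreducible_g0_submodule B" "v \<in> A" "v \<in> B" "v \<noteq> 0"
  shows "A = B"
proof -
  have "g0_submodule (A \<inter> B)"
    using assms(1,2) by (auto simp: irreducible_g0_submodule_def g0_submodule_def kfun.subspace_inter)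
  moreover have "A \<inter> B \<noteq> {0}" using assms(3-5) by blast
  ultimately have "A \<inter> B = A" "A \<inter> B = B"
    using assms(1,2) unfolding irreducible_g0_submodule_def by blast+
  then show ?thesis by blast
qed

lemma g11_xi_eq: "g11_xi = self_dual_cubics"
  unfolding g11_xi_def
proof (rule the_equality)
  show "irreducible_g0_submodule self_dual_cubics \<and> self_dual_cubics \<subseteq> g11 \<and> xi_cubed \<in> self_dual_cubics"
    using irreducible_self_dual_cubics xi_cubed_self_dual by (auto simp: g11_def self_dual_cubics_def)
  show "M = self_dual_cubics" if "irreducible_g0_submodule M \<and> M \<subseteq> g11 \<and> xi_cubed \<in> M" for M
    using that irreducible_unique irreducible_self_dual_cubics xi_cubed_self_dual xi_cubed_nonzero by blast
qed

section \<open>Infinite dimension\<close>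

definition proj :: "nat \<Rightarrow> kfun \<Rightarrow> kfun" where
  "proj k f = (\<lambda>S. if card S = k then f S else 0)"

lemma proj_add: "proj k (f + g) = proj k f + proj k g"
  by (rule ext) (simp add: proj_def)

lemma proj_diff: "proj k (f - g) = proj k f - proj k g"
  by (rule ext) (simp add: proj_def)

lemma proj_scale: "proj k (kscale c f) = kscale c (proj k f)"
  by (rule ext) (simp add: proj_def kscale_def)

lemma proj_zero [simp]: "proj k 0 = 0"
  by (rule ext) (simp add: proj_def)

lemma proj_d_t: "proj k (d_t f) = d_t (proj k f)"
  by (rule ext) (simp add: proj_def d_t_def)

lemma proj_kgen_mult:
  "proj (Suc k) (kmult (kgen x) f) = kmult (kgen x) (proj k f)"
  "proj 0 (kmult (kgen x) f) = 0"
proof -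
  have "x \<in> S \<Longrightarrow> card S = Suc (card (S - {x}))" for S by (subst card.remove[of S x]) auto
  then show "proj (Suc k) (kmult (kgen x) f) = kmult (kgen x) (proj k f)"
    by (intro ext) (auto simp: proj_def kgen_mult_apply)
  show "proj 0 (kmult (kgen x) f) = 0"
    by (rule ext) (auto simp: proj_def kgen_mult_apply)
qed

lemma proj_d_gen: "proj k (d_gen x f) = d_gen x (proj (Suc k) f)"
  by (rule ext) (auto simp: proj_def d_gen_apply)

lemma proj_seven [simp]: "proj 7 f = 0"
proof -
  have "card (UNIV :: idx set) = 3" by (simp add: UNIV_idx)
  moreover have "card (UNIV :: gen set) = card (UNIV :: idx set) + card (UNIV :: idx set)"
    unfolding UNIV_gen by (subst card_Un_disjoint) (auto simp: card_image inj_def)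
  ultimately have "card S \<noteq> 7" for S :: "gen set" using card_mono[of UNIV S] by auto
  then show ?thesis by (auto simp: proj_def)
qed

text \<open>This is the known description of the prolong as the Cheng--Kac algebra \<open>CK\<^sub>6\<close>; only the
  inclusion into the prolong is needed.\<close>

definition star_closed :: "kfun set" where
  "star_closed = {f. proj 3 f = star (proj 3 f) \<and> proj 4 f = d_t (star (proj 2 f))
     \<and> proj 5 f = d_t (d_t (star (proj 1 f))) \<and> proj 6 f = d_t (d_t (d_t (star (proj 0 f))))}"

lemma subspace_star_closed: "kfun.subspace star_closed"
proof (rule kfun.subspaceI)
  fix f g assume "f \<in> star_closed" "g \<in> star_closed"
  then show "f + g \<in> star_closed" unfolding star_closed_def mem_Collect_eq
    by (simp only: proj_add star_add d_t_add)
next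
  fix c f assume "f \<in> star_closed"
  then show "kscale c f \<in> star_closed" unfolding star_closed_def mem_Collect_eq
    by (simp only: proj_scale star_scale d_t_scale)
qed (simp add: star_closed_def)

text \<open>The conditions say that component 6 - k equals d_t^(3-k) applied to \<open>star\<close>
  of component k. Component 6 - k of \<open>agen x f\<close> comes from components 5 - k and 7 - k,
  which the conditions tie to k + 1 and k - 1; \<open>star\<close> exchanges x with - d_(bar x), and
  the powers of d_t match.\<close>

lemma agen_star_closed: "f \<in> star_closed \<Longrightarrow> agen x f \<in> star_closed"
proof -
  assume f: "f \<in> star_closed"
  have p: "proj (Suc k) (agen x f) = kmult (kgen x) (d_t (proj k f)) - d_gen (bar x) (proj (Suc (Suc k)) f)"
    "proj 0 (agen x f) = - d_gen (bar x) (proj 1 f)" for k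
    by (simp_all add: agen_def proj_diff proj_kgen_mult proj_d_gen proj_d_t)
  have s: "proj 3 f = star (proj 3 f)" "proj 4 f = d_t (star (proj 2 f))"
    "proj 5 f = d_t (d_t (star (proj 1 f)))" "proj 6 f = d_t (d_t (d_t (star (proj 0 f))))"
    using f by (auto simp: star_closed_def)
  have p': "proj 1 (agen x f) = kmult (kgen x) (d_t (proj 0 f)) - d_gen (bar x) (proj 2 f)"
    "proj 2 (agen x f) = kmult (kgen x) (d_t (proj 1 f)) - d_gen (bar x) (proj 3 f)"
    "proj 3 (agen x f) = kmult (kgen x) (d_t (proj 2 f)) - d_gen (bar x) (proj 4 f)"
    "proj 4 (agen x f) = kmult (kgen x) (d_t (proj 3 f)) - d_gen (bar x) (proj 5 f)"
    "proj 5 (agen x f) = kmult (kgen x) (d_t (proj 4 f)) - d_gen (bar x) (proj 6 f)"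
    "proj 6 (agen x f) = kmult (kgen x) (d_t (proj 5 f)) - d_gen (bar x) (proj 7 f)"
    using p(1)[of 0] p(1)[of 1] p(1)[of 2] p(1)[of 3] p(1)[of 4] p(1)[of 5]
    by (simp_all add: eval_nat_numeral)
  note simps = star_diff star_minus star_kgen_mult star_d_gen star_d_t d_t_diff d_t_minus
    d_t_kgen_mult d_t_d_gen
  show ?thesis
    unfolding star_closed_def mem_Collect_eq p p'
  proof (intro conjI)
    show "kmult (kgen x) (d_t (proj 2 f)) - d_gen (bar x) (proj 4 f)
        = star (kmult (kgen x) (d_t (proj 2 f)) - d_gen (bar x) (proj 4 f))"
      unfolding s(2) by (simp add: simps)
    show "kmult (kgen x) (d_t (proj 3 f)) - d_gen (bar x) (proj 5 f)
        = d_t (star (kmult (kgen x) (d_t (proj 1 f)) - d_gen (bar x) (proj 3 f)))"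
      unfolding s(3) by (simp add: simps flip: s(1))
    show "kmult (kgen x) (d_t (proj 4 f)) - d_gen (bar x) (proj 6 f)
        = d_t (d_t (star (kmult (kgen x) (d_t (proj 0 f)) - d_gen (bar x) (proj 2 f))))"
      unfolding s(2,4) by (simp add: simps)
    show "kmult (kgen x) (d_t (proj 5 f)) - d_gen (bar x) (proj 7 f)
        = d_t (d_t (d_t (star (- d_gen (bar x) (proj 1 f)))))"
      unfolding s(3) by (simp add: simps)
  qed
qed

text \<open>Bracketing with a generator stays in \<open>star_closed\<close>, so only degree 1 has to
  be inspected: its cubic component is fixed by \<open>star\<close>, its linear component lies in
  \<open>g12\<close>.\<close>

lemma star_closed_le_prolong_pos:
  "f \<in> star_closed \<Longrightarrow> f \<in> graded_part (int n + 1) \<Longrightarrow> f \<in> prolong_pos (sum_space self_dual_cubics g12) n"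
proof (induction n arbitrary: f)
  case 0
  then have f: "f \<in> graded_part 1" by simp
  have 3: "coeff (f S) n \<noteq> 0 \<Longrightarrow> n = 1 \<and> card S = 1 \<or> n = 0 \<and> card S = 3" for S n
    using graded_partD[OF f, of S n] by presburger
  then have "f S = 0" if "card S \<noteq> 1" "card S \<noteq> 3" for S using that by (metis leading_coeff_0_iff)
  then have sum: "f = proj 3 f + proj 1 f" by (auto simp: proj_def)
  have "proj 3 f \<in> Lambda 3"
    using 3 by (fastforce simp: Lambda_def proj_def)
  then have "proj 3 f \<in> self_dual_cubics"
    using 0(1) by (simp add: self_dual_cubics_def star_closed_def)
  \<comment> \<open>In degree 1 the coefficients of odd degree one are multiples of t, on which t
    d_t is the identity.\<close>
  moreover have "proj 1 f = kmult kt (d_t (proj 1 f))"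
  proof (intro ext poly_eqI)
    fix S n
    have "card S = 1 \<Longrightarrow> n \<noteq> 1 \<Longrightarrow> coeff (f S) n = 0" using 3[of S n] by fastforce
    then show "coeff (proj 1 f S) n = coeff (kmult kt (d_t (proj 1 f)) S) n"
      by (cases n) (auto simp: proj_def kt_mult_apply d_t_def coeff_monom_mult coeff_pderiv)
  qed
  moreover have "proj 1 f \<in> graded_part 1"
    by (rule graded_partI) (auto simp: proj_def dest: graded_partD[OF f] split: if_splits)
  then have "d_t (proj 1 f) \<in> graded_part (-1)"
    using d_t_graded[of "proj 1 f" 1] by simp
  ultimately show ?case
    using sum unfolding sum_space_def g12_eq by auto
next
  case (Suc n)
  have gen: "contact_bracket f (kgen x) \<in> prolong_pos (sum_space self_dual_cubics g12) n" for x
  proof (rule Suc.IH)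
    have "contact_bracket f (kgen x) = - kscale (koszul_sign (odd (int (Suc n) + 1)) True) (agen x f)"
      using contact_bracket_antisym_graded[OF Suc.prems(2) kgen_graded]
      by (simp add: contact_bracket_kgen)
    then show "contact_bracket f (kgen x) \<in> star_closed"
      using agen_star_closed[OF Suc.prems(1)] kfun.subspace_neg[OF subspace_star_closed]
        kfun.subspace_scale[OF subspace_star_closed] by metis
    show "contact_bracket f (kgen x) \<in> graded_part (int n + 1)"
      using contact_bracket_graded[OF Suc.prems(2) kgen_graded, of x] by (simp add: add.commute)
  qed
  have sub: "kfun.subspace (prolong_pos (sum_space self_dual_cubics g12) n)"
    using g1_submodule.subspace_h[OF g1_submodule_self_dual, of "int n + 1"]
    by (simp add: prolong_part_def)
  have "contact_bracket f v \<in> prolong_pos (sum_space self_dual_cubics g12) n"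
    if v: "v \<in> graded_part (-1)" for v
    by (subst graded_part_minus_one[OF v])
      (simp only: contact_bracket_sum_right contact_bracket_scale_right,
        intro kfun.subspace_sum[OF sub] kfun.subspace_scale[OF sub] gen)
  then show ?case using Suc.prems(2) by (simp add: add.commute)
qed

definition t_power :: "nat \<Rightarrow> kfun" where
  "t_power n = (\<lambda>S. if S = {} then monom 1 n else 0)"

lemma t_power_graded: "t_power n \<in> graded_part (2 * int n - 2)"
  by (auto intro!: graded_partI simp: t_power_def split: if_splits)

text \<open>The condition on component 6 in \<open>star_closed\<close> forces the second summand. It
  vanishes for n <= 2.\<close>

definition dual_t_power :: "nat \<Rightarrow> kfun" where
  "dual_t_power n = t_power n + d_t (d_t (d_t (star (t_power n))))"

lemma star_t_power: "star (t_power n) = kmult (kgen (Xi I3)) (kmult (kgen (Eta I3)) (kmult (kgen (Xi I2))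
    (kmult (kgen (Eta I2)) (kmult (kgen (Xi I1)) (kmult (kgen (Eta I1)) (t_power n))))))"
  by (rule star_of_constants) (auto simp: d_gen_apply t_power_def)

lemma dual_t_power_graded: "dual_t_power n \<in> graded_part (2 * int n - 2)"
proof -
  have "star (t_power n) \<in> graded_part (2 * int n - 2 + 1 + 1 + 1 + 1 + 1 + 1)"
    unfolding star_t_power by (intro kgen_mult_graded t_power_graded)
  then have "d_t (d_t (d_t (star (t_power n)))) \<in> graded_part (2 * int n - 2 + 1 + 1 + 1 + 1 + 1 + 1 - 2 - 2 - 2)"
    by (intro d_t_graded)
  then show ?thesis unfolding dual_t_power_def by (intro graded_part_add t_power_graded) simp
qed

lemma dual_t_power_star_closed: "dual_t_power n \<in> star_closed"
proof -
  have t: "proj 0 (t_power n) = t_power n" "k \<noteq> 0 \<Longrightarrow> proj k (t_power n) = 0" for k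
    by (auto simp: proj_def t_power_def)
  have "proj 6 (star (t_power n)) = star (t_power n)"
    "proj 0 (star (t_power n)) = 0" "proj 1 (star (t_power n)) = 0" "proj 2 (star (t_power n)) = 0"
    "proj 3 (star (t_power n)) = 0" "proj 4 (star (t_power n)) = 0" "proj 5 (star (t_power n)) = 0"
    unfolding star_t_power by (simp_all add: eval_nat_numeral proj_kgen_mult t)
  then show ?thesis
    by (simp add: star_closed_def dual_t_power_def proj_add proj_d_t t)
qed

lemma dual_t_power_empty: "dual_t_power n {} = monom 1 n"
proof -
  have "star (t_power n) {} = 0" by (simp add: star_t_power kgen_mult_apply)
  moreover have "t_power n {} = monom 1 n" by (simp add: t_power_def)
  ultimately show ?thesis by (simp add: dual_t_power_def d_t_def)
qed

text \<open>The t-degree of the coefficient at the empty set is bounded on a finite span, but it is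
  n on \<open>dual_t_power n\<close>.\<close>

lemma prolong_not_in_finite_span:
  assumes "finite B" shows "\<not> partial_prolong (sum_space self_dual_cubics g12) \<subseteq> kfun.span B"
proof
  assume le: "partial_prolong (sum_space self_dual_cubics g12) \<subseteq> kfun.span B"
  \<comment> \<open>Larger than every degree in \<open>B\<close>, and at least 2 so that the index 2
    N - 3 of the prolong component is not truncated.\<close>
  define N where "N = Suc (\<Sum>b\<in>B. degree (b {})) + 1"
  have "kfun.subspace {f. degree (f {}) < N}"
    by (rule kfun.subspaceI) (auto simp: N_def kscale_def intro: degree_add_less)
  moreover have "B \<subseteq> {f. degree (f {}) < N}"
  proof
    fix b assume "b \<in> B"
    then have "degree (b {}) \<le> (\<Sum>b\<in>B. degree (b {}))" by (intro member_le_sum assms) auto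
    then show "b \<in> {f. degree (f {}) < N}" by (simp add: N_def)
  qed
  ultimately have "kfun.span B \<subseteq> {f. degree (f {}) < N}" by (intro kfun.span_minimal)
  moreover have "dual_t_power N \<in> partial_prolong (sum_space self_dual_cubics g12)"
  proof -
    have N: "N \<ge> 2" by (simp add: N_def)
    then have "int (2 * N - 3) + 1 = 2 * int N - 2" by simp
    then have "dual_t_power N \<in> prolong_pos (sum_space self_dual_cubics g12) (2 * N - 3)"
      using star_closed_le_prolong_pos dual_t_power_star_closed dual_t_power_graded by metis
    moreover have "nat (int (2 * N - 2) - 1) = 2 * N - 3" using N by simp
    ultimately have "dual_t_power N \<in> prolong_part (sum_space self_dual_cubics g12) (int (2 * N - 2))"
      using N by (simp add: prolong_part_def)
    then show ?thesis by (rule g1_submodule.h_le_V[OF g1_submodule_self_dual])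
  qed
  ultimately show False using le by (auto simp: dual_t_power_empty degree_monom_eq)
qed

lemma infinite_dimensional_prolong:
  "lie_superalgebra.infinite_dimensional kscale (partial_prolong (sum_space self_dual_cubics g12))"
proof -
  interpret L: lie_superalgebra kscale contact_bracket
    "partial_prolong (sum_space self_dual_cubics g12)" "prolong_parity (sum_space self_dual_cubics g12)"
    by (rule g1_submodule.lie_superalgebra_prolong[OF g1_submodule_self_dual])
  show ?thesis unfolding L.infinite_dimensional_def using prolong_not_in_finite_span by blast
qed

section \<open>The automorphism exchanging one dual pair of odd variables\<close>

text \<open>The reflection of the odd variables that exchanges \<open>\<xi>\<^sub>1\<close> and \<open>\<eta>\<^sub>1\<close>, extended to an
  algebra automorphism.\<close>

definition swap :: "kfun \<Rightarrow> kfun" where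
  "swap f = f - kmult (kgen (Xi I1) - kgen (Eta I1)) (d_gen (Xi I1) f - d_gen (Eta I1) f)"

definition swap_gen :: "gen \<Rightarrow> gen" where
  "swap_gen x = (if x = Xi I1 then Eta I1 else if x = Eta I1 then Xi I1 else x)"

lemma swap_gen_swap_gen [simp]: "swap_gen (swap_gen x) = x"
  by (simp add: swap_gen_def)

lemma swap_gen_bar: "swap_gen (bar x) = bar (swap_gen x)"
  by (cases x) (auto simp: swap_gen_def)

lemma swap_add: "swap (f + g) = swap f + swap g"
  by (simp add: swap_def d_gen_add kmult_add_right kmult_diff_right)

lemma swap_diff: "swap (f - g) = swap f - swap g"
  by (simp add: swap_def d_gen_diff kmult_diff_right)

lemma swap_minus: "swap (- f) = - swap f"
  by (simp add: swap_def d_gen_minus kmult_diff_right kmult_minus_right)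

lemma swap_scale: "swap (kscale c f) = kscale c (swap f)"
  by (simp add: swap_def d_gen_scale kmult_diff_right kmult_scale_right kfun.scale_right_diff_distrib)

lemma swap_zero [simp]: "swap 0 = 0"
  using swap_scale[of 0 0] by simp

lemma swap_sum: "swap (\<Sum>i\<in>A. F i) = (\<Sum>i\<in>A. swap (F i))" for F :: "'b \<Rightarrow> kfun"
  by (induction A rule: infinite_finite_induct)
    (simp_all only: sum.infinite sum.empty sum.insert not_False_eq_True swap_add swap_zero)

lemma swap_d_t: "d_t (swap f) = swap (d_t f)"
  by (simp add: swap_def d_t_diff d_t_kmult d_t_d_gen)

lemma swap_parity_op: "parity_op (swap f) = swap (parity_op f)"
  by (simp add: swap_def parity_op_diff parity_op_kmult d_gen_parity_op kmult_minus_left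
      kmult_diff_left kmult_diff_right kmult_minus_right)

text \<open>With \<open>u = \<xi>\<^sub>1 - \<eta>\<^sub>1\<close> and the odd derivation \<open>D = \<partial>\<^sub>\<xi>\<^sub>1 - \<partial>\<^sub>\<eta>\<^sub>1\<close> one has
  \<open>swap f = f - u D f\<close>, which is multiplicative because \<open>u\<^sup>2 = 0\<close>.\<close>

lemma swap_kmult: "swap (kmult f g) = kmult (swap f) (swap g)"
proof -
  define U where "U h = kmult (kgen (Xi I1) - kgen (Eta I1)) h" for h
  define D where "D h = d_gen (Xi I1) h - d_gen (Eta I1) h" for h
  have swap: "swap h = h - U (D h)" for h by (simp add: swap_def U_def D_def)
  have U_left: "kmult (U h) k = U (kmult h k)" for h k
    by (simp add: U_def kmult_diff_left kgen_mult_assoc)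
  have U_right: "kmult h (U k) = U (kmult (parity_op h) k)" for h k
    by (simp add: U_def kmult_diff_left kmult_diff_right kmult_kgen_mult)
  have UU: "U (U h) = 0" for h
    by (simp add: U_def kmult_diff_left kmult_diff_right kgen_mult_anticomm[of "Eta I1" "Xi I1"])
  have U_add: "U (h + k) = U h + U k" for h k
    by (simp add: U_def kmult_add_right)
  have D: "D (kmult f g) = kmult (D f) g + kmult (parity_op f) (D g)"
    by (simp add: D_def d_gen_kmult kmult_diff_left kmult_diff_right)
  have "kmult (U (D f)) (U (D g)) = 0"
    unfolding U_left unfolding U_right by (rule UU)
  then have "kmult (swap f) (swap g) = kmult f g - U (kmult (parity_op f) (D g)) - U (kmult (D f) g)"
    unfolding swap kmult_diff_left kmult_diff_right by (simp add: U_left U_right)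
  then show ?thesis by (simp add: swap D U_add)
qed

lemma swap_kgen: "swap (kgen x) = kgen (swap_gen x)"
  by (auto simp: swap_def swap_gen_def d_gen_kgen kmult_diff_left kmult_diff_right kmult_minus_right)

lemma swap_kgen_mult: "swap (kmult (kgen x) f) = kmult (kgen (swap_gen x)) (swap f)"
  by (simp add: swap_kmult swap_kgen)

lemma swap_d_gen: "swap (d_gen x f) = d_gen (swap_gen x) (swap f)"
proof -
  consider "x = Xi I1" | "x = Eta I1" | "x \<noteq> Xi I1" "x \<noteq> Eta I1" by blast
  then show ?thesis
    by cases (simp_all add: swap_def swap_gen_def clifford_linear kmult_diff_left d_gen_kgen_mult
      d_gen_anticomm[of "Eta I1" "Xi I1"] d_gen_anticomm[of x "Xi I1"] d_gen_anticomm[of x "Eta I1"]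
      algebra_simps)
qed

lemma swap_swap [simp]: "swap (swap f) = f"
  by (simp add: swap_def clifford_linear kmult_diff_left d_gen_kgen_mult
      d_gen_anticomm[of "Eta I1" "Xi I1"] kgen_mult_anticomm[of "Eta I1" "Xi I1"] algebra_simps)

lemma swap_kt: "swap kt = kt"
  by (simp add: swap_def)

lemma swap_Delta: "Delta (swap f) = swap (Delta f)"
proof -
  have "swap (euler f) = (\<Sum>x\<in>UNIV. kmult (kgen (swap_gen x)) (d_gen (swap_gen x) (swap f)))"
    by (simp only: euler_eq swap_sum swap_kgen_mult swap_d_gen)
  also have "\<dots> = euler (swap f)"
    unfolding euler_eq by (rule sum.reindex_bij_witness[of _ swap_gen swap_gen]) auto
  finally show ?thesis by (simp add: Delta_def swap_diff swap_scale)
qed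

text \<open>The reflection preserves the pairing of dual generators, so the Poisson sum is merely
  reindexed by \<open>swap_gen\<close>.\<close>

lemma swap_contact_bracket: "swap (contact_bracket f g) = contact_bracket (swap f) (swap g)"
proof -
  have "swap (\<Sum>y\<in>UNIV. kmult (d_gen y (parity_op f)) (d_gen (bar y) g))
      = (\<Sum>y\<in>UNIV. kmult (d_gen (swap_gen y) (parity_op (swap f))) (d_gen (bar (swap_gen y)) (swap g)))"
    by (simp only: swap_sum swap_kmult swap_d_gen swap_parity_op swap_gen_bar)
  also have "\<dots> = (\<Sum>y\<in>UNIV. kmult (d_gen y (parity_op (swap f))) (d_gen (bar y) (swap g)))"
    by (rule sum.reindex_bij_witness[of _ swap_gen swap_gen]) auto
  finally show ?thesis
    by (simp add: contact_bracket_eq swap_add swap_diff swap_kmult swap_Delta swap_d_t)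
qed

lemma swap_graded: "f \<in> graded_part d \<Longrightarrow> swap f \<in> graded_part d"
proof -
  assume f: "f \<in> graded_part d"
  have "kmult (kgen x) (d_gen y f) \<in> graded_part d" for x y
    using kgen_mult_graded[OF d_gen_graded[OF f]] by simp
  then show ?thesis
    unfolding swap_def kmult_diff_left kmult_diff_right by (intro graded_part_diff f)
qed

lemma swap_graded_iff: "swap f \<in> graded_part d \<longleftrightarrow> f \<in> graded_part d"
  using swap_graded by (metis swap_swap)

text \<open>Homogeneity as an eigenvalue condition, which is preserved by any linear operator
  commuting with \<open>parity_op\<close>.\<close>

lemma parity_part_iff: "f \<in> parity_part p \<longleftrightarrow> parity_op f = (if p then - f else f)"
proof
  assume *: "parity_op f = (if p then - f else f)"
  have "odd (card S) = p" if "f S \<noteq> 0" for S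
    using fun_cong[OF *, of S] that
    by (auto simp: parity_op_def minus_one_power_iff equal_neg_zero neg_equal_zero split: if_splits)
  then show "f \<in> parity_part p" by (simp add: parity_part_def)
qed (rule parity_part_ops)

lemma swap_parity_part: "f \<in> parity_part p \<Longrightarrow> swap f \<in> parity_part p"
  unfolding parity_part_iff by (simp add: swap_parity_op swap_minus)

lemma swap_image_iff: "f \<in> swap ` A \<longleftrightarrow> swap f \<in> A"
  by (metis image_iff swap_swap)

lemma swap_g0_submodule: "g0_submodule M \<Longrightarrow> g0_submodule (swap ` M)"
proof -
  assume M: "g0_submodule M"
  then have "kfun.subspace (swap ` M)"
    by (auto simp: g0_submodule_def kfun.subspace_def swap_image_iff swap_add swap_scale)
  moreover have "contact_bracket D m \<in> swap ` M" if "D \<in> graded_part 0" "m \<in> swap ` M" for D m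
    using M that swap_graded[of D 0]
    by (simp add: g0_submodule_def swap_image_iff swap_contact_bracket)
  ultimately show ?thesis by (simp add: g0_submodule_def)
qed

lemma swap_irreducible: "irreducible_g0_submodule M \<Longrightarrow> irreducible_g0_submodule (swap ` M)"
proof -
  assume M: "irreducible_g0_submodule M"
  have "N = {0} \<or> N = swap ` M" if N: "g0_submodule N" "N \<subseteq> swap ` M" for N
  proof -
    have "swap ` N \<subseteq> M" using N(2) by (auto simp: swap_image_iff)
    then have "swap ` N = {0} \<or> swap ` N = M"
      using M swap_g0_submodule[OF N(1)] by (auto simp: irreducible_g0_submodule_def)
    moreover have "swap ` swap ` N = N" by (simp add: image_image)
    ultimately show ?thesis by auto
  qed
  moreover have "swap ` M \<noteq> {0}"
  proof
    assume "swap ` M = {0}"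
    then have "swap ` swap ` M = {0}" by simp
    then show False using M by (simp add: image_image irreducible_g0_submodule_def)
  qed
  moreover have "g0_submodule (swap ` M)"
    using M by (intro swap_g0_submodule) (simp add: irreducible_g0_submodule_def)
  ultimately show ?thesis by (simp add: irreducible_g0_submodule_def)
qed

lemma g11_eq: "g11 = {f \<in> graded_part 1. d_t f = 0}"
  by (simp add: g11_def Lambda_eq)

text \<open>The exchange turns eta_1 eta_2 eta_3 into xi_1 eta_2 eta_3, which has an even number of
  eta_i and so is self-dual. Irreducible submodules sharing a nonzero vector coincide, which settles
  the definite description.\<close>

lemma g11_eta_eq: "g11_eta = swap ` g11_xi"
  unfolding g11_eta_def g11_xi_eq
proof (rule the_equality)
  have irr: "irreducible_g0_submodule (swap ` self_dual_cubics)"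
    by (rule swap_irreducible[OF irreducible_self_dual_cubics])
  have "swap eta_cubed = sd_basis ! 2"
    by (simp add: eta_cubed_def swap_kmult swap_kgen swap_gen_def sd_basis_def)
  then have eta: "eta_cubed \<in> swap ` self_dual_cubics"
    using sd_basis_self_dual by (simp add: swap_image_iff)
  have "swap ` self_dual_cubics \<subseteq> g11"
    by (auto simp: self_dual_cubics_def Lambda_eq g11_eq swap_graded swap_d_t)
  then show "irreducible_g0_submodule (swap ` self_dual_cubics) \<and> swap ` self_dual_cubics \<subseteq> g11
      \<and> eta_cubed \<in> swap ` self_dual_cubics"
    using irr eta by blast
  have "eta_cubed \<noteq> 0"
  proof
    assume "eta_cubed = 0"
    then have "d_gen (Eta I3) (d_gen (Eta I2) (d_gen (Eta I1) eta_cubed)) = 0" by simp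
    moreover have "d_gen (Eta I3) (d_gen (Eta I2) (d_gen (Eta I1) eta_cubed)) = kone"
      by (simp add: eta_cubed_def d_gen_kgen_mult d_gen_kgen clifford_linear)
    moreover have "kone {} \<noteq> 0" by (simp add: kone_def)
    ultimately show False by (metis zero_fun_apply)
  qed
  then show "M = swap ` self_dual_cubics"
    if "irreducible_g0_submodule M \<and> M \<subseteq> g11 \<and> eta_cubed \<in> M" for M
    using that irreducible_unique irr eta by blast
qed

lemma swap_g12: "swap ` g12 = g12"
proof -
  have "swap f \<in> g12" if "f \<in> g12" for f
    using that swap_graded by (auto simp: g12_eq swap_kmult swap_kt)
  then show ?thesis using swap_swap by (auto simp: swap_image_iff)
qed

lemma swap_sum_space: "swap ` sum_space A B = sum_space (swap ` A) (swap ` B)"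
proof (intro equalityI subsetI)
  fix f assume "f \<in> swap ` sum_space A B"
  then obtain a b where "f = swap (a + b)" "a \<in> A" "b \<in> B" by (auto simp: sum_space_def)
  then show "f \<in> sum_space (swap ` A) (swap ` B)" by (auto simp: sum_space_def swap_add)
next
  fix f assume "f \<in> sum_space (swap ` A) (swap ` B)"
  then obtain a b where "f = swap (a + b)" "a \<in> A" "b \<in> B"
    by (auto simp: sum_space_def swap_add)
  then show "f \<in> swap ` sum_space A B" by (auto simp: sum_space_def)
qed

lemma swap_prolong_pos: "swap f \<in> prolong_pos (swap ` H) n \<longleftrightarrow> f \<in> prolong_pos H n"
proof (induction n arbitrary: f)
  case 0
  then show ?case by (simp add: swap_image_iff)
next
  case (Suc n)
  have "(\<forall>v\<in>graded_part (-1). contact_bracket (swap f) v \<in> prolong_pos (swap ` H) n)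
      \<longleftrightarrow> (\<forall>v\<in>graded_part (-1). contact_bracket f v \<in> prolong_pos H n)"
    using Suc swap_graded by (metis swap_contact_bracket swap_swap)
  then show ?case by (simp add: swap_graded_iff)
qed

lemma swap_prolong_le: "f \<in> partial_prolong H \<Longrightarrow> swap f \<in> partial_prolong (swap ` H)"
proof -
  have "kfun.subspace {f. swap f \<in> partial_prolong (swap ` H)}"
    using kfun.subspace_span by (auto simp: partial_prolong_def kfun.subspace_def swap_add swap_scale)
  moreover have "swap f \<in> prolong_part (swap ` H) i" if "f \<in> prolong_part H i" for f i
    using that by (auto simp: prolong_part_def swap_graded_iff swap_prolong_pos)
  then have "(\<Union>i\<in>{-2..}. prolong_part H i) \<subseteq> {f. swap f \<in> partial_prolong (swap ` H)}"
    by (auto simp: partial_prolong_def intro!: kfun.span_base)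
  ultimately have "partial_prolong H \<subseteq> {f. swap f \<in> partial_prolong (swap ` H)}"
    unfolding partial_prolong_def[of H] by (intro kfun.span_minimal)
  then show "f \<in> partial_prolong H \<Longrightarrow> swap f \<in> partial_prolong (swap ` H)" by blast
qed

lemma swap_prolong: "swap f \<in> partial_prolong (swap ` H) \<longleftrightarrow> f \<in> partial_prolong H"
  using swap_prolong_le[of "swap f" "swap ` H"] swap_prolong_le[of f H] by (auto simp: image_image)

lemma swap_prolong_parity: "swap ` prolong_parity H p = prolong_parity (swap ` H) p"
proof -
  have "f \<in> swap ` prolong_parity H p \<longleftrightarrow> f \<in> prolong_parity (swap ` H) p" for f
    using swap_prolong[of "swap f" H] swap_parity_part[of f p] swap_parity_part[of "swap f" p]
    by (auto simp: swap_image_iff prolong_parity_def)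
  then show ?thesis by blast
qed

lemma swap_lie_superalgebra_iso:
  assumes "g1_submodule H"
  shows "lie_superalgebra_iso kscale contact_bracket (partial_prolong H) (prolong_parity H)
    kscale contact_bracket (partial_prolong (swap ` H)) (prolong_parity (swap ` H)) swap"
proof -
  have "g1_submodule (swap ` H)"
  proof
    show "swap ` H \<subseteq> graded_part 1"
      using g1_submodule.H_graded[OF assms] swap_graded by auto
    show "g0_submodule (swap ` H)"
      by (rule swap_g0_submodule[OF g1_submodule.H_submodule[OF assms]])
    show "g12 \<subseteq> swap ` H"
      using image_mono[OF g1_submodule.g12_le_H[OF assms], of swap] by (simp add: swap_g12)
  qed
  moreover have "bij_betw swap (partial_prolong H) (partial_prolong (swap ` H))"
    by (rule bij_betw_byWitness[of _ swap])
      (use swap_prolong in \<open>auto simp: swap_prolong, metis swap_swap swap_prolong\<close>)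
  ultimately show ?thesis
    using assms g1_submodule.lie_superalgebra_prolong
    by (simp add: lie_superalgebra_iso_def swap_add swap_scale swap_prolong_parity swap_contact_bracket)
qed

theorem theorem0p9:
  shows "simple_lie_superalgebra kscale contact_bracket
           (partial_prolong (sum_space g11_xi g12)) (prolong_parity (sum_space g11_xi g12))
       \<and> lie_superalgebra.infinite_dimensional kscale
           (partial_prolong (sum_space g11_xi g12))
       \<and> lie_superalgebra_isomorphic
           kscale contact_bracket
           (partial_prolong (sum_space g11_xi g12)) (prolong_parity (sum_space g11_xi g12))
           kscale contact_bracket
           (partial_prolong (sum_space g11_eta g12)) (prolong_parity (sum_space g11_eta g12))"
proof (intro conjI)
  let ?H = "sum_space g11_xi g12"
  have H: "g1_submodule ?H"
    using g1_submodule_self_dual by (simp add: g11_xi_eq)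
  show "simple_lie_superalgebra kscale contact_bracket (partial_prolong ?H) (prolong_parity ?H)"
    by (rule g1_submodule.simple_prolong[OF H])
  show "lie_superalgebra.infinite_dimensional kscale (partial_prolong ?H)"
    using infinite_dimensional_prolong by (simp add: g11_xi_eq)
  have "sum_space g11_eta g12 = swap ` ?H"
    by (simp add: g11_eta_eq swap_sum_space swap_g12)
  then show "lie_superalgebra_isomorphic kscale contact_bracket (partial_prolong ?H) (prolong_parity ?H)
      kscale contact_bracket (partial_prolong (sum_space g11_eta g12))
      (prolong_parity (sum_space g11_eta g12))"
    using swap_lie_superalgebra_iso[OF H] by (auto simp: lie_superalgebra_isomorphic_def)
qed

end
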